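(* Let $(\mathrm{CoFib}, \mathrm{Fib}, \mathrm{Weq})$ be a model structure on a weakly idempotent complete additive category $\mathcal A$. Put $\mathrm{TCoFib}=\mathrm{CoFib}\cap\mathrm{Weq}$, let $\mathcal C$ be the class of cofibrant objects, $\mathcal W$ the class of trivial objects, and $\mathrm{T}\mathcal C=\mathcal C\cap\mathcal W$. Then the following are equivalent: (1) $(\mathrm{CoFib}, \mathrm{Fib}, \mathrm{Weq})$ is a fibrant model structure, i.e. every object of $\mathcal A$ is fibrant. (2) $\mathrm{TCoFib}=\{\text{splitting monomorphism } f \mid \mathrm{Coker} f\in \mathrm{T}\mathcal C\}$. (3) $\mathrm{Fib}=\{\text{morphism } f \mid f \text{ is } \mathrm{Hom}_{\mathcal A}(\mathrm{T}\mathcal C,-)\text{-epic}\}$. If this is the case, then the homotopy category $\mathrm{Ho}(\mathcal A)$ is equivalent to $\mathcal C/\mathrm{T}\mathcal C$ as additive categories.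
   Context: An additive category is weakly idempotent complete if every splitting monomorphism (morphism with a left inverse) has a cokernel, or equivalently every splitting epimorphism (morphism with a right inverse) has a kernel. For morphisms $f:A\to B$, $g:C\to D$ write $f\,\square\, g$ if for all $u:A\to C$, $v:B\to D$ with $gu=vf$ there is $h:B\to C$ with $hf=u$ and $gh=v$. A morphism $g:A'\to B'$ is a retract of $f:A\to B$ if there are $\varphi_1:A'\to A$, $\psi_1:A\to A'$, $\varphi_2:B'\to B$, $\psi_2:B\to B'$ with $f\varphi_1=\varphi_2 g$, $g\psi_1=\psi_2 f$, $\psi_1\varphi_1=\mathrm{Id}_{A'}$, $\psi_2\varphi_2=\mathrm{Id}_{B'}$. A model structure on a category $\mathcal M$ (no existence of limits or colimits is required) is a triple $(\mathrm{CoFib},\mathrm{Fib},\mathrm{Weq})$ of classes of morphisms (cofibrations, fibrations, weak equivalences) such that: (two out of three) for composable $f,g$, if two of $f,g,gf$ are in $\mathrm{Weq}$, so is the third; (retract) each of the three classes is closed under retracts; (lifting) if $f\in\mathrm{CoFib}$, $g\in\mathrm{Fib}$ and either $f\in\mathrm{Weq}$ or $g\in\mathrm{Weq}$, then $f\,\square\, g$; (factorization) every morphism $f$ admits factorizations $f=pi$ and $f=qj$ with $i\in\mathrm{CoFib}\cap\mathrm{Weq}$, $p\in\mathrm{Fib}$, $j\in\mathrm{CoFib}$, $q\in\mathrm{Fib}\cap\mathrm{Weq}$. An object $X$ is cofibrant if $0\to X$ is in $\mathrm{CoFib}$; fibrant if $X\to 0$ is in $\mathrm{Fib}$; trivial if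 $0\to X$ is in $\mathrm{Weq}$ (equivalently $X\to 0$ is in $\mathrm{Weq}$). For a class $\mathcal U$ of objects, a morphism $f$ is $\mathrm{Hom}_{\mathcal A}(\mathcal U,-)$-epic if $\mathrm{Hom}_{\mathcal A}(U,f)$ is surjective for every $U\in\mathcal U$. The homotopy category $\mathrm{Ho}(\mathcal A)$ is the localization category $\mathcal A[\mathrm{Weq}^{-1}]$. For an additive category $\mathcal B$ and a full additive subcategory $\mathcal U$ (closed under finite coproducts), $\mathcal B/\mathcal U$ has the same objects as $\mathcal B$, and $\mathrm{Hom}_{\mathcal B/\mathcal U}(X,Y)$ is $\mathrm{Hom}_{\mathcal B}(X,Y)$ modulo the subgroup of morphisms factoring through an object of $\mathcal U$. Classes of objects are regarded as full subcategories. *)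

theory Defs
  imports "HOL-Algebra.Coset"
begin

record ('o, 'm) cat =
  Ob :: "'o set"
  Arr :: "'m set"
  Dom :: "'m \<Rightarrow> 'o"
  Cod :: "'m \<Rightarrow> 'o"
  Idn :: "'o \<Rightarrow> 'm"
  Comp :: "'m \<Rightarrow> 'm \<Rightarrow> 'm"  (infixl "\<cdot>\<index>" 70)

definition Hom :: "('o, 'm, 'z) cat_scheme \<Rightarrow> 'o \<Rightarrow> 'o \<Rightarrow> 'm set" where
  "Hom A X Y = {f \<in> Arr A. Dom A f = X \<and> Cod A f = Y}"

text \<open>Composition is written in the usual order: \<open>g \<cdot> f\<close> is first \<open>f\<close>, then \<open>g\<close>.\<close>

locale category =
  fixes A :: "('o, 'm, 'z) cat_scheme" (structure)
  assumes Dom_Ob: "f \<in> Arr A \<Longrightarrow> Dom A f \<in> Ob A"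
    and Cod_Ob: "f \<in> Arr A \<Longrightarrow> Cod A f \<in> Ob A"
    and Idn_Hom: "X \<in> Ob A \<Longrightarrow> Idn A X \<in> Hom A X X"
    and Comp_Hom: "\<lbrakk>f \<in> Hom A X Y; g \<in> Hom A Y Z\<rbrakk> \<Longrightarrow> g \<cdot> f \<in> Hom A X Z"
    and Comp_assoc: "\<lbrakk>f \<in> Hom A X Y; g \<in> Hom A Y Z; h \<in> Hom A Z W\<rbrakk>
      \<Longrightarrow> (h \<cdot> g) \<cdot> f = h \<cdot> (g \<cdot> f)"
    and Comp_Idn_right: "f \<in> Hom A X Y \<Longrightarrow> f \<cdot> Idn A X = f"
    and Comp_Idn_left: "f \<in> Hom A X Y \<Longrightarrow> Idn A Y \<cdot> f = f"

definition isomorphism :: "('o, 'm, 'z) cat_scheme \<Rightarrow> 'm \<Rightarrow> bool" where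
  "isomorphism A f \<longleftrightarrow> f \<in> Arr A \<and> (\<exists>g \<in> Hom A (Cod A f) (Dom A f).
     g \<cdot>\<^bsub>A\<^esub> f = Idn A (Dom A f) \<and> f \<cdot>\<^bsub>A\<^esub> g = Idn A (Cod A f))"

definition full_subcategory :: "('o, 'm, 'z) cat_scheme \<Rightarrow> 'o set \<Rightarrow> ('o, 'm, 'z) cat_scheme" where
  "full_subcategory A U =
     A\<lparr>Ob := Ob A \<inter> U, Arr := {f \<in> Arr A. Dom A f \<in> U \<and> Cod A f \<in> U}\<rparr>"

definition is_functor ::
  "('o, 'm, 'z) cat_scheme \<Rightarrow> ('p, 'n, 'y) cat_scheme \<Rightarrow> ('o \<Rightarrow> 'p) \<Rightarrow> ('m \<Rightarrow> 'n) \<Rightarrow> bool" where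
  "is_functor A B Fo Fa \<longleftrightarrow>
     Fo ` Ob A \<subseteq> Ob B \<and>
     (\<forall>f \<in> Arr A. Fa f \<in> Hom B (Fo (Dom A f)) (Fo (Cod A f))) \<and>
     (\<forall>X \<in> Ob A. Fa (Idn A X) = Idn B (Fo X)) \<and>
     (\<forall>f \<in> Arr A. \<forall>g \<in> Arr A. Cod A f = Dom A g \<longrightarrow> Fa (g \<cdot>\<^bsub>A\<^esub> f) = Fa g \<cdot>\<^bsub>B\<^esub> Fa f)"

definition naturally_isomorphic ::
  "('o, 'm, 'z) cat_scheme \<Rightarrow> ('p, 'n, 'y) cat_scheme
    \<Rightarrow> ('o \<Rightarrow> 'p) \<Rightarrow> ('m \<Rightarrow> 'n) \<Rightarrow> ('o \<Rightarrow> 'p) \<Rightarrow> ('m \<Rightarrow> 'n) \<Rightarrow> bool" where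
  "naturally_isomorphic A B Fo Fa Go Ga \<longleftrightarrow>
     (\<exists>\<eta>. (\<forall>X \<in> Ob A. \<eta> X \<in> Hom B (Fo X) (Go X) \<and> isomorphism B (\<eta> X)) \<and>
          (\<forall>f \<in> Arr A. Ga f \<cdot>\<^bsub>B\<^esub> \<eta> (Dom A f) = \<eta> (Cod A f) \<cdot>\<^bsub>B\<^esub> Fa f))"

record ('o, 'm) acat = "('o, 'm) cat" +
  Add :: "'m \<Rightarrow> 'm \<Rightarrow> 'm"  (infixl "\<boxplus>\<index>" 65)
  Zero :: "'o \<Rightarrow> 'o \<Rightarrow> 'm"

definition hom_group :: "('o, 'm, 'z) acat_scheme \<Rightarrow> 'o \<Rightarrow> 'o \<Rightarrow> 'm monoid" where
  "hom_group A X Y = \<lparr>carrier = Hom A X Y, monoid.mult = Add A, one = Zero A X Y\<rparr>"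

definition zero_object :: "('o, 'm, 'z) cat_scheme \<Rightarrow> 'o \<Rightarrow> bool" where
  "zero_object A Z \<longleftrightarrow> Z \<in> Ob A \<and>
     (\<forall>X \<in> Ob A. (\<exists>!f. f \<in> Hom A Z X) \<and> (\<exists>!f. f \<in> Hom A X Z))"

definition biproduct :: "('o, 'm, 'z) acat_scheme \<Rightarrow> 'o \<Rightarrow> 'o \<Rightarrow> 'o \<Rightarrow> bool" where
  "biproduct A X Y S \<longleftrightarrow> S \<in> Ob A \<and>
     (\<exists>i \<in> Hom A X S. \<exists>j \<in> Hom A Y S. \<exists>p \<in> Hom A S X. \<exists>q \<in> Hom A S Y.
        p \<cdot>\<^bsub>A\<^esub> i = Idn A X \<and> q \<cdot>\<^bsub>A\<^esub> j = Idn A Y \<and>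
        p \<cdot>\<^bsub>A\<^esub> j = Zero A Y X \<and> q \<cdot>\<^bsub>A\<^esub> i = Zero A X Y \<and>
        (i \<cdot>\<^bsub>A\<^esub> p) \<boxplus>\<^bsub>A\<^esub> (j \<cdot>\<^bsub>A\<^esub> q) = Idn A S)"

locale additive_category = category A
  for A :: "('o, 'm, 'z) acat_scheme" (structure) +
  assumes hom_comm_group: "\<lbrakk>X \<in> Ob A; Y \<in> Ob A\<rbrakk> \<Longrightarrow> comm_group (hom_group A X Y)"
    and Comp_Add_right: "\<lbrakk>f \<in> Hom A X Y; f' \<in> Hom A X Y; g \<in> Hom A Y Z\<rbrakk>
      \<Longrightarrow> g \<cdot> (f \<boxplus> f') = (g \<cdot> f) \<boxplus> (g \<cdot> f')"
    and Comp_Add_left: "\<lbrakk>f \<in> Hom A X Y; g \<in> Hom A Y Z; g' \<in> Hom A Y Z\<rbrakk>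
      \<Longrightarrow> (g \<boxplus> g') \<cdot> f = (g \<cdot> f) \<boxplus> (g' \<cdot> f)"
    and ex_zero_object: "\<exists>Z. zero_object A Z"
    and ex_biproduct: "\<lbrakk>X \<in> Ob A; Y \<in> Ob A\<rbrakk> \<Longrightarrow> \<exists>S. biproduct A X Y S"

text \<open>The choice is immaterial: classes closed under retracts are closed under isomorphism.\<close>

definition zero_ob :: "('o, 'm, 'z) cat_scheme \<Rightarrow> 'o" where
  "zero_ob A = (SOME Z. zero_object A Z)"

definition additive_functor ::
  "('o, 'm, 'z) acat_scheme \<Rightarrow> ('p, 'n, 'y) acat_scheme \<Rightarrow> ('o \<Rightarrow> 'p) \<Rightarrow> ('m \<Rightarrow> 'n) \<Rightarrow> bool" where
  "additive_functor A B Fo Fa \<longleftrightarrow> is_functor A B Fo Fa \<and>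
     (\<forall>f \<in> Arr A. \<forall>g \<in> Arr A. Dom A f = Dom A g \<and> Cod A f = Cod A g \<longrightarrow>
        Fa (f \<boxplus>\<^bsub>A\<^esub> g) = Fa f \<boxplus>\<^bsub>B\<^esub> Fa g)"

definition equivalent_as_additive_categories ::
  "('o, 'm, 'z) acat_scheme \<Rightarrow> ('p, 'n, 'y) acat_scheme \<Rightarrow> bool" where
  "equivalent_as_additive_categories A B \<longleftrightarrow>
     additive_category A \<and> additive_category B \<and>
     (\<exists>Fo Fa Go Ga.
        additive_functor A B Fo Fa \<and> additive_functor B A Go Ga \<and>
        naturally_isomorphic A A (\<lambda>X. X) (\<lambda>f. f) (Go \<circ> Fo) (Ga \<circ> Fa) \<and>
        naturally_isomorphic B B (Fo \<circ> Go) (Fa \<circ> Ga) (\<lambda>X. X) (\<lambda>f. f))"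

definition split_mono :: "('o, 'm, 'z) cat_scheme \<Rightarrow> 'm \<Rightarrow> bool" where
  "split_mono A f \<longleftrightarrow> f \<in> Arr A \<and>
     (\<exists>r \<in> Hom A (Cod A f) (Dom A f). r \<cdot>\<^bsub>A\<^esub> f = Idn A (Dom A f))"

definition is_cokernel :: "('o, 'm, 'z) acat_scheme \<Rightarrow> 'm \<Rightarrow> 'm \<Rightarrow> bool" where
  "is_cokernel A f c \<longleftrightarrow> f \<in> Arr A \<and> c \<in> Arr A \<and> Dom A c = Cod A f \<and>
     c \<cdot>\<^bsub>A\<^esub> f = Zero A (Dom A f) (Cod A c) \<and>
     (\<forall>g \<in> Arr A. Dom A g = Cod A f \<and> g \<cdot>\<^bsub>A\<^esub> f = Zero A (Dom A f) (Cod A g) \<longrightarrow>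
        (\<exists>!h. h \<in> Hom A (Cod A c) (Cod A g) \<and> h \<cdot>\<^bsub>A\<^esub> c = g))"

locale weakly_idempotent_complete = additive_category +
  assumes split_mono_has_cokernel: "split_mono A f \<Longrightarrow> \<exists>c. is_cokernel A f c"

definition lifts_against :: "('o, 'm, 'z) cat_scheme \<Rightarrow> 'm \<Rightarrow> 'm \<Rightarrow> bool" where
  "lifts_against M f g \<longleftrightarrow>
     (\<forall>u \<in> Hom M (Dom M f) (Dom M g). \<forall>v \<in> Hom M (Cod M f) (Cod M g).
        g \<cdot>\<^bsub>M\<^esub> u = v \<cdot>\<^bsub>M\<^esub> f \<longrightarrow>
        (\<exists>h \<in> Hom M (Cod M f) (Dom M g). h \<cdot>\<^bsub>M\<^esub> f = u \<and> g \<cdot>\<^bsub>M\<^esub> h = v))"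

definition is_retract :: "('o, 'm, 'z) cat_scheme \<Rightarrow> 'm \<Rightarrow> 'm \<Rightarrow> bool" where
  "is_retract M g f \<longleftrightarrow> g \<in> Arr M \<and> f \<in> Arr M \<and>
     (\<exists>\<phi>1 \<in> Hom M (Dom M g) (Dom M f). \<exists>\<psi>1 \<in> Hom M (Dom M f) (Dom M g).
      \<exists>\<phi>2 \<in> Hom M (Cod M g) (Cod M f). \<exists>\<psi>2 \<in> Hom M (Cod M f) (Cod M g).
        f \<cdot>\<^bsub>M\<^esub> \<phi>1 = \<phi>2 \<cdot>\<^bsub>M\<^esub> g \<and> g \<cdot>\<^bsub>M\<^esub> \<psi>1 = \<psi>2 \<cdot>\<^bsub>M\<^esub> f \<and>
        \<psi>1 \<cdot>\<^bsub>M\<^esub> \<phi>1 = Idn M (Dom M g) \<and> \<psi>2 \<cdot>\<^bsub>M\<^esub> \<phi>2 = Idn M (Cod M g))"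

locale model_structure = category M
  for M :: "('o, 'm, 'z) cat_scheme" (structure) +
  fixes CoFib Fib Weq :: "'m set"
  assumes CoFib_Arr: "CoFib \<subseteq> Arr M" and Fib_Arr: "Fib \<subseteq> Arr M" and Weq_Arr: "Weq \<subseteq> Arr M"
    and two_of_three: "\<lbrakk>f \<in> Hom M X Y; g \<in> Hom M Y Z\<rbrakk> \<Longrightarrow>
      (f \<in> Weq \<and> g \<in> Weq \<longrightarrow> g \<cdot> f \<in> Weq) \<and>
      (f \<in> Weq \<and> g \<cdot> f \<in> Weq \<longrightarrow> g \<in> Weq) \<and>
      (g \<in> Weq \<and> g \<cdot> f \<in> Weq \<longrightarrow> f \<in> Weq)"
    and retract_CoFib: "\<lbrakk>is_retract M g f; f \<in> CoFib\<rbrakk> \<Longrightarrow> g \<in> CoFib"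
    and retract_Fib: "\<lbrakk>is_retract M g f; f \<in> Fib\<rbrakk> \<Longrightarrow> g \<in> Fib"
    and retract_Weq: "\<lbrakk>is_retract M g f; f \<in> Weq\<rbrakk> \<Longrightarrow> g \<in> Weq"
    and lifting: "\<lbrakk>f \<in> CoFib; g \<in> Fib; f \<in> Weq \<or> g \<in> Weq\<rbrakk> \<Longrightarrow> lifts_against M f g"
    and factor_TCoFib_Fib: "f \<in> Arr M \<Longrightarrow>
      \<exists>i p. i \<in> CoFib \<inter> Weq \<and> p \<in> Fib \<and> Cod M i = Dom M p \<and> f = p \<cdot> i"
    and factor_CoFib_TFib: "f \<in> Arr M \<Longrightarrow>
      \<exists>j q. j \<in> CoFib \<and> q \<in> Fib \<inter> Weq \<and> Cod M j = Dom M q \<and> f = q \<cdot> j"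

definition cofibrant_objects :: "('o, 'm, 'z) acat_scheme \<Rightarrow> 'm set \<Rightarrow> 'o set" where
  "cofibrant_objects A CoFib = {X \<in> Ob A. Zero A (zero_ob A) X \<in> CoFib}"

definition fibrant_objects :: "('o, 'm, 'z) acat_scheme \<Rightarrow> 'm set \<Rightarrow> 'o set" where
  "fibrant_objects A Fib = {X \<in> Ob A. Zero A X (zero_ob A) \<in> Fib}"

definition trivial_objects :: "('o, 'm, 'z) acat_scheme \<Rightarrow> 'm set \<Rightarrow> 'o set" where
  "trivial_objects A Weq = {X \<in> Ob A. Zero A (zero_ob A) X \<in> Weq}"

definition hom_epic :: "('o, 'm, 'z) cat_scheme \<Rightarrow> 'o set \<Rightarrow> 'm \<Rightarrow> bool" where
  "hom_epic A U f \<longleftrightarrow> f \<in> Arr A \<and>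
     (\<forall>X \<in> U. (\<lambda>u. f \<cdot>\<^bsub>A\<^esub> u) ` Hom A X (Dom A f) = Hom A X (Cod A f))"

text \<open>The quotient of a category by an equivalence relation \<open>R\<close> on its arrows which only relates
  parallel arrows and is compatible with composition. Arrows are \<open>R\<close>-classes; the unions below
  are then unions of copies of a single class, as in \<^const>\<open>congruent2\<close> and its lemmas.\<close>

definition quotient_cat :: "('o, 'm, 'z) cat_scheme \<Rightarrow> ('m \<times> 'm) set \<Rightarrow> ('o, 'm set) cat" where
  "quotient_cat A R =
     \<lparr>Ob = Ob A,
      Arr = Arr A // R,
      Dom = (\<lambda>K. the_elem (Dom A ` K)),
      Cod = (\<lambda>K. the_elem (Cod A ` K)),
      Idn = (\<lambda>X. R `` {Idn A X}),
      Comp = (\<lambda>L K. \<Union>g \<in> L. \<Union>f \<in> K. R `` {g \<cdot>\<^bsub>A\<^esub> f})\<rparr>"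

definition factoring :: "('o, 'm, 'z) cat_scheme \<Rightarrow> 'o set \<Rightarrow> 'o \<Rightarrow> 'o \<Rightarrow> 'm set" where
  "factoring A U X Y = {b \<cdot>\<^bsub>A\<^esub> a | V a b. V \<in> U \<and> a \<in> Hom A X V \<and> b \<in> Hom A V Y}"

text \<open>Two arrows \<open>X \<rightarrow> Y\<close> are identified iff they lie in the same coset of the subgroup
  \<open>factoring A U X Y\<close>, i.e. their difference factors through an object of \<open>U\<close>.\<close>

definition factoring_rel :: "('o, 'm, 'z) acat_scheme \<Rightarrow> 'o set \<Rightarrow> ('m \<times> 'm) set" where
  "factoring_rel A U =
     (\<Union>X \<in> Ob A. \<Union>Y \<in> Ob A. r_congruent (hom_group A X Y) (factoring A U X Y))"

definition additive_quotient :: "('o, 'm, 'z) acat_scheme \<Rightarrow> 'o set \<Rightarrow> ('o, 'm set) acat" where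
  "additive_quotient A U =
     cat.extend (quotient_cat A (factoring_rel A U))
       (acat.fields
         (\<lambda>K L. \<Union>f \<in> K. \<Union>g \<in> L. factoring_rel A U `` {f \<boxplus>\<^bsub>A\<^esub> g})
         (\<lambda>X Y. factoring_rel A U `` {Zero A X Y}))"

text \<open>The localization of \<open>A\<close> at \<open>W\<close>, following Gabriel and Zisman: the category of paths
  in the graph with edges the arrows of \<open>A\<close> and formal inverses of the arrows in \<open>W\<close>, modulo the
  relations of \<open>A\<close> and those making the formal inverses into inverses. A path carries its end
  points; its edges are listed in the order in which they are traversed.\<close>

datatype 'm edge = Fwd 'm | Bwd 'm

type_synonym ('o, 'm) path = "'o \<times> 'm edge list \<times> 'o"

fun is_path :: "('o, 'm, 'z) cat_scheme \<Rightarrow> 'm set \<Rightarrow> 'o \<Rightarrow> 'm edge list \<Rightarrow> 'o \<Rightarrow> bool" where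
  "is_path A W X [] Y \<longleftrightarrow> X \<in> Ob A \<and> X = Y"
| "is_path A W X (Fwd f # es) Y \<longleftrightarrow> f \<in> Arr A \<and> Dom A f = X \<and> is_path A W (Cod A f) es Y"
| "is_path A W X (Bwd w # es) Y \<longleftrightarrow>
     w \<in> Arr A \<and> w \<in> W \<and> Cod A w = X \<and> is_path A W (Dom A w) es Y"

definition path_cat :: "('o, 'm, 'z) cat_scheme \<Rightarrow> 'm set \<Rightarrow> ('o, ('o, 'm) path) cat" where
  "path_cat A W =
     \<lparr>Ob = Ob A,
      Arr = {(X, es, Y). is_path A W X es Y},
      Dom = (\<lambda>(X, es, Y). X),
      Cod = (\<lambda>(X, es, Y). Y),
      Idn = (\<lambda>X. (X, [], X)),
      Comp = (\<lambda>(Y', fs, Z) (X, es, Y). (X, es @ fs, Z))\<rparr>"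

inductive_set localization_rel ::
  "('o, 'm, 'z) cat_scheme \<Rightarrow> 'm set \<Rightarrow> (('o, 'm) path \<times> ('o, 'm) path) set"
  for A :: "('o, 'm, 'z) cat_scheme" and W :: "'m set" where
  Idn: "X \<in> Ob A \<Longrightarrow> ((X, [Fwd (Idn A X)], X), (X, [], X)) \<in> localization_rel A W"
| Comp: "\<lbrakk>f \<in> Hom A X Y; g \<in> Hom A Y Z\<rbrakk>
    \<Longrightarrow> ((X, [Fwd f, Fwd g], Z), (X, [Fwd (g \<cdot>\<^bsub>A\<^esub> f)], Z)) \<in> localization_rel A W"
| inv_left: "\<lbrakk>w \<in> Hom A X Y; w \<in> W\<rbrakk>
    \<Longrightarrow> ((X, [Fwd w, Bwd w], X), (X, [], X)) \<in> localization_rel A W"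
| inv_right: "\<lbrakk>w \<in> Hom A X Y; w \<in> W\<rbrakk>
    \<Longrightarrow> ((Y, [Bwd w, Fwd w], Y), (Y, [], Y)) \<in> localization_rel A W"
| refl: "p \<in> Arr (path_cat A W) \<Longrightarrow> (p, p) \<in> localization_rel A W"
| sym: "(p, q) \<in> localization_rel A W \<Longrightarrow> (q, p) \<in> localization_rel A W"
| trans: "\<lbrakk>(p, q) \<in> localization_rel A W; (q, r) \<in> localization_rel A W\<rbrakk>
    \<Longrightarrow> (p, r) \<in> localization_rel A W"
| cong: "\<lbrakk>(p, p') \<in> localization_rel A W; (q, q') \<in> localization_rel A W;
    Cod (path_cat A W) p = Dom (path_cat A W) q\<rbrakk>
    \<Longrightarrow> (q \<cdot>\<^bsub>path_cat A W\<^esub> p, q' \<cdot>\<^bsub>path_cat A W\<^esub> p') \<in> localization_rel A W"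

definition localization :: "('o, 'm, 'z) cat_scheme \<Rightarrow> 'm set \<Rightarrow> ('o, ('o, 'm) path set) cat" where
  "localization A W = quotient_cat (path_cat A W) (localization_rel A W)"

definition localization_map ::
  "('o, 'm, 'z) cat_scheme \<Rightarrow> 'm set \<Rightarrow> 'm \<Rightarrow> ('o, 'm) path set" where
  "localization_map A W f = localization_rel A W `` {(Dom A f, [Fwd f], Cod A f)}"

text \<open>\<open>H\<close> is the localization \<open>A[W\<^sup>-\<^sup>1]\<close> together with an addition of arrows that makes it an
  additive category and the localization functor additive. Since the addition of an additive
  category is determined by its underlying category, \<open>H\<close> is unique on arrows if it exists.\<close>

definition additive_localization ::
  "('o, 'm, 'z) acat_scheme \<Rightarrow> 'm set \<Rightarrow> ('o, ('o, 'm) path set) acat \<Rightarrow> bool" where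
  "additive_localization A W H \<longleftrightarrow>
     cat.truncate H = localization A W \<and> additive_category H \<and>
     additive_functor A H (\<lambda>X. X) (localization_map A W)"

end

theory Submission
  imports Defs
begin

text \<open>Cofibrations, trivial cofibrations and fibrations are determined by lifting properties, and
  lifting against \<open>0 \<rightarrow> K\<close> means being \<open>Hom(K, -)\<close>-epic. If all objects are fibrant, a trivial
  cofibration \<open>f : X \<rightarrow> Y\<close> lifts against \<open>X \<rightarrow> 0\<close>, so it splits, and it then lifts against the same
  morphisms as \<open>0 \<rightarrow> Coker f\<close>. This gives (1) \<open>\<Rightarrow>\<close> (2) \<open>\<Rightarrow>\<close> (3), and \<open>X \<rightarrow> 0\<close> is always \<open>Hom(TC, -)\<close>-epic.

  For the homotopy category choose trivial fibrations \<open>Qo X \<rightarrow> X\<close> with \<open>Qo X\<close> cofibrant. Lifts of a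
  morphism along them are unique up to maps through \<open>TC\<close>, and \<open>C/TC\<close> inverts weak equivalences
  since trivial cofibrations split with cokernel in \<open>TC\<close> and trivial fibrations onto cofibrant
  objects have sections. So \<open>Qo\<close> induces a functor \<open>A[Weq\<^sup>-\<^sup>1] \<rightarrow> C/TC\<close>. It is full, faithful and dense,
  and the addition of \<open>C/TC\<close> is transported along it.\<close>

section \<open>Additive categories\<close>

text \<open>Membership in a class goes through the retract argument, and two maps between cofibrant
  objects are identified when they differ by a map through \<open>TC\<close>. Cofibrant replacement
  need not be functorial on \<open>A\<close>: a chosen lift respects identities and composition
  modulo \<open>TC\<close>, so the functor has to land in \<open>C/TC\<close> at once. Fibrancy
  enters the second half through the splitting of trivial cofibrations, whose complement in
  \<open>TC\<close> dies in \<open>C/TC\<close>. Fullness and faithfulness rest on a normal form: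
  each arrow \<open>K\<close> of the localization satisfies \<open>K \<cdot> \<gamma> (rep X) =
  \<gamma> (rep Y) \<cdot> \<gamma> f\<close> for some \<open>f\<close> of \<open>A\<close>. The
  localization is a concrete category of zigzag classes without an addition, and the conclusion asks
  for an additive category with exactly this underlying category. Hence the addition is pulled back
  along bijections of Hom-sets, and the category is not exchanged for an equivalent one.\<close>

context category
begin

lemma Hom_Arr: "f \<in> Hom A X Y \<Longrightarrow> f \<in> Arr A"
  and Hom_Dom: "f \<in> Hom A X Y \<Longrightarrow> Dom A f = X"
  and Hom_Cod: "f \<in> Hom A X Y \<Longrightarrow> Cod A f = Y"
  by (auto simp: Hom_def)

lemma Hom_Ob: "f \<in> Hom A X Y \<Longrightarrow> X \<in> Ob A \<and> Y \<in> Ob A"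
  using Dom_Ob Cod_Ob by (auto simp: Hom_def)

lemma Arr_Hom: "f \<in> Arr A \<Longrightarrow> f \<in> Hom A (Dom A f) (Cod A f)"
  by (auto simp: Hom_def)

lemma isomorphismI:
  assumes "f \<in> Hom A X Y" "g \<in> Hom A Y X" "g \<cdot> f = Idn A X" "f \<cdot> g = Idn A Y"
  shows "isomorphism A f"
  using assms unfolding isomorphism_def by (auto simp: Hom_def)

lemma isomorphismE:
  assumes "isomorphism A f" "f \<in> Hom A X Y"
  obtains g where "g \<in> Hom A Y X" "g \<cdot> f = Idn A X" "f \<cdot> g = Idn A Y"
  using assms unfolding isomorphism_def by (auto simp: Hom_def)

lemma isomorphism_Comp:
  assumes "f \<in> Hom A X Y" "g \<in> Hom A Y Z" "isomorphism A f" "isomorphism A g"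
  shows "isomorphism A (g \<cdot> f)"
proof -
  obtain f' where f': "f' \<in> Hom A Y X" "f' \<cdot> f = Idn A X" "f \<cdot> f' = Idn A Y"
    using assms(1,3) by (blast elim: isomorphismE)
  obtain g' where g': "g' \<in> Hom A Z Y" "g' \<cdot> g = Idn A Y" "g \<cdot> g' = Idn A Z"
    using assms(2,4) by (blast elim: isomorphismE)
  note gf = Comp_Hom[OF assms(1,2)] and gf' = Comp_Hom[OF g'(1) f'(1)]
  have "(f' \<cdot> g') \<cdot> (g \<cdot> f) = f' \<cdot> ((g' \<cdot> g) \<cdot> f)"
    using Comp_assoc[OF gf g'(1) f'(1)] Comp_assoc[OF assms(1,2) g'(1)] by simp
  moreover have "(g \<cdot> f) \<cdot> (f' \<cdot> g') = g \<cdot> ((f \<cdot> f') \<cdot> g')"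
    using Comp_assoc[OF gf' assms(1,2)] Comp_assoc[OF g'(1) f'(1) assms(1)] by simp
  ultimately show ?thesis
    using f' g' Comp_Idn_left[OF assms(1)] Comp_Idn_left[OF g'(1)]
    by (intro isomorphismI[OF gf gf']) simp_all
qed

lemma isomorphism_cancel_left:
  assumes "p \<in> Hom A Y Z" "isomorphism A p" "f \<in> Hom A X Y" "g \<in> Hom A X Y" "p \<cdot> f = p \<cdot> g"
  shows "f = g"
proof -
  obtain p' where p': "p' \<in> Hom A Z Y" "p' \<cdot> p = Idn A Y" using assms(2,1) by (rule isomorphismE)
  have "f = p' \<cdot> (p \<cdot> f)"
    using Comp_assoc[OF assms(3,1) p'(1)] p'(2) Comp_Idn_left[OF assms(3)] by simp
  also have "\<dots> = g"
    unfolding assms(5) using Comp_assoc[OF assms(4,1) p'(1)] p'(2) Comp_Idn_left[OF assms(4)] by simp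
  finally show ?thesis .
qed

lemma isomorphism_cancel_right:
  assumes "p \<in> Hom A X Y" "isomorphism A p" "f \<in> Hom A Y Z" "g \<in> Hom A Y Z" "f \<cdot> p = g \<cdot> p"
  shows "f = g"
proof -
  obtain p' where p': "p' \<in> Hom A Y X" "p \<cdot> p' = Idn A Y" using assms(2,1) by (rule isomorphismE)
  have "f = (f \<cdot> p) \<cdot> p'"
    using Comp_assoc[OF p'(1) assms(1,3)] p'(2) Comp_Idn_right[OF assms(3)] by simp
  also have "\<dots> = g"
    unfolding assms(5) using Comp_assoc[OF p'(1) assms(1,4)] p'(2) Comp_Idn_right[OF assms(4)] by simp
  finally show ?thesis .
qed

section \<open>Lifts and the retract argument\<close>

lemma lifts_againstD:
  assumes "lifts_against A f g" "f \<in> Hom A X Y" "g \<in> Hom A P Q"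
    and "u \<in> Hom A X P" "v \<in> Hom A Y Q" "g \<cdot> u = v \<cdot> f"
  obtains h where "h \<in> Hom A Y P" "h \<cdot> f = u" "g \<cdot> h = v"
  using assms unfolding lifts_against_def by (auto simp: Hom_def)

text \<open>Retract argument: the square with \<open>i\<close> on top and the identity of
  \<open>Y\<close> below has a lift \<open>h\<close>, a section of \<open>p\<close>. Then
  \<open>(Id, h)\<close> and \<open>(Id, p)\<close> are the retraction data.\<close>

lemma retract_of_left_factor:
  assumes i: "i \<in> Hom A X E" and p: "p \<in> Hom A E Y" and l: "lifts_against A (p \<cdot> i) p"
  shows "is_retract A (p \<cdot> i) i"
proof -
  have f: "p \<cdot> i \<in> Hom A X Y" using i p by (rule Comp_Hom)
  obtain h where h: "h \<in> Hom A Y E" "h \<cdot> (p \<cdot> i) = i" "p \<cdot> h = Idn A Y"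
    using lifts_againstD[OF l f p i] Idn_Hom[of Y] Comp_Idn_left[OF f] Hom_Ob[OF f] by metis
  have X: "Idn A X \<in> Hom A X X" using Idn_Hom Hom_Ob[OF f] by blast
  show ?thesis
    unfolding is_retract_def Hom_Dom[OF f] Hom_Cod[OF f] Hom_Dom[OF i] Hom_Cod[OF i]
    using h p X Hom_Arr[OF f] Hom_Arr[OF i]
    by (intro conjI bexI[of _ "Idn A X"] bexI[of _ h] bexI[of _ p])
      (simp_all add: Comp_Idn_right[OF i] Comp_Idn_right[OF f] Comp_Idn_left[OF X])
qed

text \<open>Dual form: a lift in the square with the identity of \<open>X\<close> on top and
  \<open>p\<close> below is a retraction \<open>h\<close> of \<open>i\<close>, and the data are
  \<open>(i, Id)\<close> and \<open>(h, Id)\<close>.\<close>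

lemma retract_of_right_factor:
  assumes i: "i \<in> Hom A X E" and p: "p \<in> Hom A E Y" and l: "lifts_against A i (p \<cdot> i)"
  shows "is_retract A (p \<cdot> i) p"
proof -
  have f: "p \<cdot> i \<in> Hom A X Y" using i p by (rule Comp_Hom)
  obtain h where h: "h \<in> Hom A E X" "h \<cdot> i = Idn A X" "(p \<cdot> i) \<cdot> h = p"
    using lifts_againstD[OF l i f _ p] Idn_Hom[of X] Comp_Idn_right[OF f] Hom_Ob[OF f] by metis
  have Y: "Idn A Y \<in> Hom A Y Y" using Idn_Hom Hom_Ob[OF f] by blast
  show ?thesis
    unfolding is_retract_def Hom_Dom[OF f] Hom_Cod[OF f] Hom_Dom[OF p] Hom_Cod[OF p]
    using h i Y Hom_Arr[OF f] Hom_Arr[OF p]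
    by (intro conjI bexI[of _ "Idn A Y"] bexI[of _ h] bexI[of _ i])
      (simp_all add: Comp_Idn_left[OF p] Comp_Idn_left[OF f] Comp_Idn_left[OF Y])
qed

end

text \<open>The category axioms speak of these six fields only, so records with further fields, such
  as an addition, inherit them.\<close>

lemma category_cong:
  assumes "category A" "Ob B = Ob A" "Arr B = Arr A" "Dom B = Dom A" "Cod B = Cod A"
    "Idn B = Idn A" "Comp B = Comp A"
  shows "category B"
  using assms unfolding category_def Hom_def by simp

section \<open>Hom-groups, zero objects and biproducts\<close>

context additive_category
begin

lemma
  assumes "X \<in> Ob A" "Y \<in> Ob A"
  shows Zero_Hom: "Zero A X Y \<in> Hom A X Y"
    and Add_Hom: "f \<in> Hom A X Y \<Longrightarrow> g \<in> Hom A X Y \<Longrightarrow> f \<boxplus> g \<in> Hom A X Y"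
    and ex_neg: "f \<in> Hom A X Y \<Longrightarrow> \<exists>g \<in> Hom A X Y. g \<boxplus> f = Zero A X Y"
proof -
  interpret comm_group "hom_group A X Y" using assms by (rule hom_comm_group)
  show "Zero A X Y \<in> Hom A X Y" using one_closed by (simp add: hom_group_def)
  show "f \<in> Hom A X Y \<Longrightarrow> g \<in> Hom A X Y \<Longrightarrow> f \<boxplus> g \<in> Hom A X Y"
    using m_closed by (simp add: hom_group_def)
  show "f \<in> Hom A X Y \<Longrightarrow> \<exists>g \<in> Hom A X Y. g \<boxplus> f = Zero A X Y"
    using l_inv_ex by (simp add: hom_group_def)
qed

lemma Add_closed: "f \<in> Hom A X Y \<Longrightarrow> g \<in> Hom A X Y \<Longrightarrow> f \<boxplus> g \<in> Hom A X Y"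
  using Add_Hom Hom_Ob by blast

lemma
  assumes f: "f \<in> Hom A X Y"
  shows Add_Zero_left: "Zero A X Y \<boxplus> f = f"
    and Add_Zero_right: "f \<boxplus> Zero A X Y = f"
    and Add_commute: "g \<in> Hom A X Y \<Longrightarrow> f \<boxplus> g = g \<boxplus> f"
    and Add_assoc: "g \<in> Hom A X Y \<Longrightarrow> h \<in> Hom A X Y \<Longrightarrow> (f \<boxplus> g) \<boxplus> h = f \<boxplus> (g \<boxplus> h)"
    and Add_left_cancel: "g \<in> Hom A X Y \<Longrightarrow> h \<in> Hom A X Y \<Longrightarrow> f \<boxplus> g = f \<boxplus> h \<longleftrightarrow> g = h"
proof -
  interpret comm_group "hom_group A X Y" using Hom_Ob[OF f] by (auto intro: hom_comm_group)
  show "Zero A X Y \<boxplus> f = f" "f \<boxplus> Zero A X Y = f"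
    using l_one[of f] r_one[of f] f by (simp_all add: hom_group_def)
  show "g \<in> Hom A X Y \<Longrightarrow> f \<boxplus> g = g \<boxplus> f"
    using m_comm[of f g] f by (simp add: hom_group_def)
  show "g \<in> Hom A X Y \<Longrightarrow> h \<in> Hom A X Y \<Longrightarrow> (f \<boxplus> g) \<boxplus> h = f \<boxplus> (g \<boxplus> h)"
    using m_assoc[of f g h] f by (simp add: hom_group_def)
  show "g \<in> Hom A X Y \<Longrightarrow> h \<in> Hom A X Y \<Longrightarrow> f \<boxplus> g = f \<boxplus> h \<longleftrightarrow> g = h"
    using Units_l_cancel[of f g h] f by (simp add: hom_group_def Units_eq[unfolded hom_group_def])
qed

text \<open>In a group only the neutral element is idempotent. Bilinearity makes
  \<open>g \<cdot> 0\<close> and \<open>0 \<cdot> f\<close> idempotent, hence zero.\<close>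

lemma Add_idem_Zero:
  assumes "f \<in> Hom A X Y" "f \<boxplus> f = f"
  shows "f = Zero A X Y"
  using Add_left_cancel[OF assms(1) assms(1) Zero_Hom] Add_Zero_right[OF assms(1)] assms(2)
    Hom_Ob[OF assms(1)] by simp

lemma Comp_Zero_right:
  assumes "g \<in> Hom A Y Z" "X \<in> Ob A"
  shows "g \<cdot> Zero A X Y = Zero A X Z"
proof (rule Add_idem_Zero)
  have z: "Zero A X Y \<in> Hom A X Y" using Zero_Hom assms Hom_Ob by blast
  show "g \<cdot> Zero A X Y \<in> Hom A X Z" using z assms(1) by (rule Comp_Hom)
  show "g \<cdot> Zero A X Y \<boxplus> g \<cdot> Zero A X Y = g \<cdot> Zero A X Y"
    using Comp_Add_right[OF z z assms(1)] Add_Zero_left[OF z] by simp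
qed

lemma Comp_Zero_left:
  assumes "f \<in> Hom A X Y" "Z \<in> Ob A"
  shows "Zero A Y Z \<cdot> f = Zero A X Z"
proof (rule Add_idem_Zero)
  have z: "Zero A Y Z \<in> Hom A Y Z" using Zero_Hom assms Hom_Ob by blast
  show "Zero A Y Z \<cdot> f \<in> Hom A X Z" using assms(1) z by (rule Comp_Hom)
  show "Zero A Y Z \<cdot> f \<boxplus> Zero A Y Z \<cdot> f = Zero A Y Z \<cdot> f"
    using Comp_Add_left[OF assms(1) z z] Add_Zero_left[OF z] by simp
qed

text \<open>Stands in for subtraction: the record has an addition but no negation, so
  \<open>f - g\<close> is handled as some \<open>d\<close> with
  \<open>f = g \<boxplus> d\<close>.\<close>

lemma difference:
  assumes "f \<in> Hom A X Y" "g \<in> Hom A X Y"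
  obtains d where "d \<in> Hom A X Y" "f = g \<boxplus> d"
proof -
  obtain n where n: "n \<in> Hom A X Y" "n \<boxplus> g = Zero A X Y"
    using ex_neg assms Hom_Ob by metis
  have "g \<boxplus> (n \<boxplus> f) = f"
    using Add_assoc[OF assms(2) n(1) assms(1)] Add_commute[OF assms(2) n(1)] n(2)
      Add_Zero_left[OF assms(1)] by simp
  then show thesis using that[OF Add_closed[OF n(1) assms(1)]] by simp
qed

lemma zero_object_zero_ob: "zero_object A (zero_ob A)"
  unfolding zero_ob_def using ex_zero_object by (rule someI_ex)

lemma zero_ob_Ob: "zero_ob A \<in> Ob A"
  using zero_object_zero_ob by (simp add: zero_object_def)

lemma from_zero_ob:
  assumes "f \<in> Hom A (zero_ob A) X"
  shows "f = Zero A (zero_ob A) X"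
  using assms Zero_Hom[OF zero_ob_Ob, of X] Hom_Ob[OF assms] zero_object_zero_ob
  unfolding zero_object_def by blast

lemma to_zero_ob:
  assumes "f \<in> Hom A X (zero_ob A)"
  shows "f = Zero A X (zero_ob A)"
  using assms Zero_Hom[OF _ zero_ob_Ob, of X] Hom_Ob[OF assms] zero_object_zero_ob
  unfolding zero_object_def by blast

lemma Zero_zero_ob: "Zero A (zero_ob A) (zero_ob A) = Idn A (zero_ob A)"
  using from_zero_ob[OF Idn_Hom] zero_ob_Ob by simp

lemma zero_objectI:
  assumes "Z \<in> Ob A" "Idn A Z = Zero A Z Z"
  shows "zero_object A Z"
proof -
  have "f = Zero A Z X" if "f \<in> Hom A Z X" for f X
    using Comp_Idn_right[OF that] Comp_Zero_right[OF that assms(1)] assms(2) by simp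
  moreover have "f = Zero A X Z" if "f \<in> Hom A X Z" for f X
    using Comp_Idn_left[OF that] Comp_Zero_left[OF that assms(1)] assms(2) by simp
  ultimately show ?thesis
    unfolding zero_object_def using assms(1) Zero_Hom[of Z] Zero_Hom[of _ Z] by blast
qed

lemma biproduct_Ob: "biproduct A X Y S \<Longrightarrow> S \<in> Ob A"
  by (simp add: biproduct_def)

lemma biproductE:
  assumes "biproduct A X Y S"
  obtains i j p q where "i \<in> Hom A X S" "j \<in> Hom A Y S" "p \<in> Hom A S X" "q \<in> Hom A S Y"
    "p \<cdot> i = Idn A X" "q \<cdot> j = Idn A Y" "p \<cdot> j = Zero A Y X" "q \<cdot> i = Zero A X Y"
    "(i \<cdot> p) \<boxplus> (j \<cdot> q) = Idn A S"
  using assms unfolding biproduct_def by blast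

section \<open>Cokernels of split monomorphisms\<close>

lemma is_cokernelD:
  assumes "is_cokernel A f c" "f \<in> Hom A X Y" "c \<in> Hom A Y K"
  shows "c \<cdot> f = Zero A X K"
    and "g \<in> Hom A Y Z \<Longrightarrow> g \<cdot> f = Zero A X Z \<Longrightarrow> \<exists>h \<in> Hom A K Z. h \<cdot> c = g"
    and "h \<in> Hom A K Z \<Longrightarrow> h' \<in> Hom A K Z \<Longrightarrow> h \<cdot> c = h' \<cdot> c \<Longrightarrow> h = h'"
proof -
  show 0: "c \<cdot> f = Zero A X K"
    using assms unfolding is_cokernel_def by (auto simp: Hom_def)
  have *: "\<exists>!h. h \<in> Hom A K Z \<and> h \<cdot> c = g" if "g \<in> Hom A Y Z" "g \<cdot> f = Zero A X Z" for g Z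
  proof -
    have "Dom A g = Cod A f \<and> g \<cdot> f = Zero A (Dom A f) (Cod A g)"
      using that Hom_Dom[OF assms(2)] Hom_Cod[OF assms(2)] Hom_Dom[OF that(1)] Hom_Cod[OF that(1)]
      by simp
    then have "\<exists>!h. h \<in> Hom A (Cod A c) (Cod A g) \<and> h \<cdot> c = g"
      using assms(1) Hom_Arr[OF that(1)] unfolding is_cokernel_def by blast
    then show ?thesis using Hom_Cod[OF assms(3)] Hom_Cod[OF that(1)] by simp
  qed
  show "g \<in> Hom A Y Z \<Longrightarrow> g \<cdot> f = Zero A X Z \<Longrightarrow> \<exists>h \<in> Hom A K Z. h \<cdot> c = g"
    using * by blast
  assume h: "h \<in> Hom A K Z" "h' \<in> Hom A K Z" "h \<cdot> c = h' \<cdot> c"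
  have "(h \<cdot> c) \<cdot> f = Zero A X Z"
    using Comp_assoc[OF assms(2,3) h(1)] 0 Comp_Zero_right[OF h(1)] Hom_Ob[OF assms(2)] by simp
  then show "h = h'" using *[OF Comp_Hom[OF assms(3) h(1)]] h by metis
qed

text \<open>The complement of \<open>f \<cdot> r\<close> in the identity of \<open>Y\<close> kills
  \<open>f\<close> and so factors as \<open>s \<cdot> c\<close>. Together \<open>f\<close>,
  \<open>r\<close>, \<open>s\<close>, \<open>c\<close> present \<open>Y\<close> as the biproduct of
  \<open>X\<close> and the cokernel \<open>K\<close>.\<close>

lemma split_mono_decomposition:
  assumes "split_mono A f" "is_cokernel A f c" "f \<in> Hom A X Y" "c \<in> Hom A Y K"
  obtains r s where "r \<in> Hom A Y X" "s \<in> Hom A K Y" "r \<cdot> f = Idn A X" "c \<cdot> s = Idn A K"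
    "(f \<cdot> r) \<boxplus> (s \<cdot> c) = Idn A Y"
proof -
  obtain r where r: "r \<in> Hom A Y X" "r \<cdot> f = Idn A X"
    using assms(1,3) unfolding split_mono_def by (auto simp: Hom_def)
  have XY: "X \<in> Ob A" "Y \<in> Ob A" "K \<in> Ob A" using Hom_Ob assms(3,4) by blast+
  have fr: "f \<cdot> r \<in> Hom A Y Y" using r(1) assms(3) by (rule Comp_Hom)
  have Y: "Idn A Y \<in> Hom A Y Y" using XY(2) by (rule Idn_Hom)
  obtain d where d: "d \<in> Hom A Y Y" "Idn A Y = (f \<cdot> r) \<boxplus> d"
    using difference[OF Y fr] by blast
  have "f \<boxplus> (d \<cdot> f) = ((f \<cdot> r) \<cdot> f) \<boxplus> (d \<cdot> f)"
    using Comp_assoc[OF assms(3) r(1) assms(3)] r(2) Comp_Idn_right[OF assms(3)] by simp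
  also have "\<dots> = f" using Comp_Add_left[OF assms(3) fr d(1)] d(2) Comp_Idn_left[OF assms(3)] by simp
  finally have "d \<cdot> f = Zero A X Y"
    using Add_left_cancel[OF assms(3) Comp_Hom[OF assms(3) d(1)] Zero_Hom] XY
      Add_Zero_right[OF assms(3)] by simp
  then obtain s where s: "s \<in> Hom A K Y" "s \<cdot> c = d"
    using is_cokernelD(2)[OF assms(2-4) d(1)] by blast
  \<comment> \<open>Composing the decomposition with \<open>c\<close> leaves
    \<open>c = c \<cdot> s \<cdot> c\<close>, since \<open>c\<close> kills \<open>f\<close>;
    uniqueness in the cokernel then cancels \<open>c\<close> on the right.\<close>
  have "c = c \<cdot> ((f \<cdot> r) \<boxplus> (s \<cdot> c))" using Comp_Idn_right[OF assms(4)] d(2) s(2) by simp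
  also have "\<dots> = (c \<cdot> (f \<cdot> r)) \<boxplus> (c \<cdot> (s \<cdot> c))"
    using Comp_Add_right[OF fr _ assms(4)] s(2) d(1) by simp
  also have "c \<cdot> (f \<cdot> r) = Zero A Y K"
    using Comp_assoc[OF r(1) assms(3,4)] is_cokernelD(1)[OF assms(2-4)] Comp_Zero_left[OF r(1)] XY
    by simp
  also have "Zero A Y K \<boxplus> (c \<cdot> (s \<cdot> c)) = c \<cdot> (s \<cdot> c)"
    using Add_Zero_left Comp_Hom assms(4) s(1) by metis
  also have "\<dots> = (c \<cdot> s) \<cdot> c" using Comp_assoc[OF assms(4) s(1) assms(4)] by simp
  finally have "Idn A K \<cdot> c = (c \<cdot> s) \<cdot> c" using Comp_Idn_left[OF assms(4)] by simp
  then have "c \<cdot> s = Idn A K"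
    using is_cokernelD(3)[OF assms(2-4) Idn_Hom Comp_Hom[OF s(1) assms(4)]] XY by simp
  then show thesis using that r s d by metis
qed

section \<open>Hom-epic morphisms and lifting\<close>

lemma hom_epicI:
  assumes "f \<in> Hom A P Q" "\<And>X v. X \<in> U \<Longrightarrow> v \<in> Hom A X Q \<Longrightarrow> \<exists>h \<in> Hom A X P. f \<cdot> h = v"
  shows "hom_epic A U f"
  unfolding hom_epic_def Hom_Dom[OF assms(1)] Hom_Cod[OF assms(1)]
  using assms Comp_Hom[OF _ assms(1)] Hom_Arr by fast

lemma hom_epicD:
  assumes "hom_epic A U f" "f \<in> Hom A P Q" "X \<in> U" "v \<in> Hom A X Q"
  obtains h where "h \<in> Hom A X P" "f \<cdot> h = v"
proof -
  have "v \<in> (\<lambda>u. f \<cdot> u) ` Hom A X P"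
    using assms unfolding hom_epic_def Hom_Dom[OF assms(2)] Hom_Cod[OF assms(2)] by simp
  then show thesis using that by blast
qed

text \<open>A zero object leaves no choice for the upper edge and makes every square commute, so
  only the lifting of \<open>v : K -> Q\<close> through \<open>g\<close> remains. The singleton
  \<open>{K}\<close> allows \<open>C\<close> and \<open>TC\<close> to be tested one object at a
  time.\<close>

lemma lifts_against_from_zero:
  assumes "K \<in> Ob A" "g \<in> Arr A"
  shows "lifts_against A (Zero A (zero_ob A) K) g \<longleftrightarrow> hom_epic A {K} g"
proof -
  let ?z = "Zero A (zero_ob A) K"
  have z: "?z \<in> Hom A (zero_ob A) K" using Zero_Hom zero_ob_Ob assms(1) by blast
  obtain P Q where g: "g \<in> Hom A P Q" using Arr_Hom assms(2) by blast
  note PQ = Hom_Ob[OF g]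
  note ty = Hom_Dom[OF z] Hom_Cod[OF z] Hom_Dom[OF g] Hom_Cod[OF g]
  show ?thesis
  proof
    assume l: "lifts_against A ?z g"
    show "hom_epic A {K} g"
    proof (rule hom_epicI[OF g])
      fix X v assume "X \<in> {K}" "v \<in> Hom A X Q"
      then have "X = K" and v: "v \<in> Hom A K Q" by auto
      have "g \<cdot> Zero A (zero_ob A) P = v \<cdot> ?z"
        using Comp_Zero_right[OF g zero_ob_Ob] Comp_Zero_right[OF v zero_ob_Ob] by simp
      then show "\<exists>h \<in> Hom A X P. g \<cdot> h = v"
        using lifts_againstD[OF l z g Zero_Hom[OF zero_ob_Ob] v] PQ \<open>X = K\<close> by metis
    qed
  next
    assume "hom_epic A {K} g"
    then show "lifts_against A ?z g"
      unfolding lifts_against_def ty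
      by (metis hom_epicD[OF _ g] singletonI from_zero_ob Comp_Hom z)
  qed
qed

text \<open>A map out of \<open>S\<close> is determined by its two components; their lifts
  \<open>h\<close> and \<open>k\<close> combine to
  \<open>h \<cdot> p \<boxplus> k \<cdot> q\<close>.\<close>

lemma hom_epic_biproduct:
  assumes "biproduct A X Y S" "hom_epic A {X} g" "hom_epic A {Y} g"
  shows "hom_epic A {S} g"
proof -
  obtain P Q where g: "g \<in> Hom A P Q" using Arr_Hom assms(2) unfolding hom_epic_def by blast
  obtain i j p q where b: "i \<in> Hom A X S" "j \<in> Hom A Y S" "p \<in> Hom A S X" "q \<in> Hom A S Y"
    "(i \<cdot> p) \<boxplus> (j \<cdot> q) = Idn A S"
    using assms(1) by (rule biproductE)
  show ?thesis
  proof (rule hom_epicI[OF g])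
    fix S' v assume "S' \<in> {S}" "v \<in> Hom A S' Q"
    then have "S' = S" and v: "v \<in> Hom A S Q" by auto
    obtain h where h: "h \<in> Hom A X P" "g \<cdot> h = v \<cdot> i"
      using hom_epicD[OF assms(2) g] Comp_Hom[OF b(1) v] by blast
    obtain k where k: "k \<in> Hom A Y P" "g \<cdot> k = v \<cdot> j"
      using hom_epicD[OF assms(3) g] Comp_Hom[OF b(2) v] by blast
    have hk: "h \<cdot> p \<in> Hom A S P" "k \<cdot> q \<in> Hom A S P" using Comp_Hom b h k by blast+
    have ij: "i \<cdot> p \<in> Hom A S S" "j \<cdot> q \<in> Hom A S S" using Comp_Hom b by blast+
    have "g \<cdot> (h \<cdot> p \<boxplus> k \<cdot> q) = ((g \<cdot> h) \<cdot> p) \<boxplus> ((g \<cdot> k) \<cdot> q)"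
      using Comp_Add_right[OF hk g] Comp_assoc[OF b(3) h(1) g] Comp_assoc[OF b(4) k(1) g] by simp
    also have "\<dots> = v \<cdot> (i \<cdot> p \<boxplus> j \<cdot> q)"
      using Comp_Add_right[OF ij v] Comp_assoc[OF b(3,1) v] Comp_assoc[OF b(4,2) v] h k by simp
    also have "\<dots> = v" using b(5) Comp_Idn_right[OF v] by simp
    finally show "\<exists>h \<in> Hom A S' P. g \<cdot> h = v"
      using Add_closed[OF hk] \<open>S' = S\<close> by blast
  qed
qed

text \<open>With \<open>Y\<close> split into \<open>X\<close> and \<open>K\<close>, the lift is
  \<open>u\<close> on \<open>X\<close> and any lift of \<open>v \<cdot> s\<close> on
  \<open>K\<close>.\<close>

lemma lifts_against_summand:
  assumes f: "f \<in> Hom A X Y" and c: "c \<in> Hom A Y K" and rs: "r \<in> Hom A Y X" "s \<in> Hom A K Y"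
    "r \<cdot> f = Idn A X" "c \<cdot> f = Zero A X K" "(f \<cdot> r) \<boxplus> (s \<cdot> c) = Idn A Y"
    and he: "hom_epic A {K} g"
  shows "lifts_against A f g"
proof -
  obtain P Q where g: "g \<in> Hom A P Q" using Arr_Hom he unfolding hom_epic_def by blast
  have fr: "f \<cdot> r \<in> Hom A Y Y" "s \<cdot> c \<in> Hom A Y Y" using rs f c Comp_Hom by blast+
  have "\<exists>h\<in>Hom A Y P. h \<cdot> f = u \<and> g \<cdot> h = v"
    if u: "u \<in> Hom A X P" and v: "v \<in> Hom A Y Q" and sq: "g \<cdot> u = v \<cdot> f" for u v
  proof -
    obtain h where h: "h \<in> Hom A K P" "g \<cdot> h = v \<cdot> s"
      using hom_epicD[OF he g] Comp_Hom[OF rs(2) v] by blast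
    have ur: "u \<cdot> r \<in> Hom A Y P" "h \<cdot> c \<in> Hom A Y P" using rs u c h Comp_Hom by blast+
    have "(u \<cdot> r \<boxplus> h \<cdot> c) \<cdot> f = (u \<cdot> (r \<cdot> f)) \<boxplus> (h \<cdot> (c \<cdot> f))"
      using Comp_Add_left[OF f ur] Comp_assoc[OF f rs(1) u] Comp_assoc[OF f c h(1)] by simp
    also have "\<dots> = u"
      using rs(3,4) Comp_Zero_right[OF h(1)] Hom_Ob[OF f]
        Comp_Idn_right[OF u] Add_Zero_right[OF u] by simp
    finally have 1: "(u \<cdot> r \<boxplus> h \<cdot> c) \<cdot> f = u" .
    have "g \<cdot> (u \<cdot> r \<boxplus> h \<cdot> c) = ((g \<cdot> u) \<cdot> r) \<boxplus> ((g \<cdot> h) \<cdot> c)"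
      using Comp_Add_right[OF ur g] Comp_assoc[OF rs(1) u g] Comp_assoc[OF c h(1) g] by simp
    also have "\<dots> = v \<cdot> (f \<cdot> r \<boxplus> s \<cdot> c)"
      using Comp_Add_right[OF fr v] Comp_assoc[OF rs(1) f v] Comp_assoc[OF c rs(2) v] h sq by simp
    also have "\<dots> = v" using rs(5) Comp_Idn_right[OF v] by simp
    finally show ?thesis using 1 Add_closed[OF ur] by blast
  qed
  then show ?thesis
    unfolding lifts_against_def Hom_Dom[OF f] Hom_Cod[OF f] Hom_Dom[OF g] Hom_Cod[OF g] by blast
qed

text \<open>\<open>K\<close> is the pushout of \<open>f\<close> along \<open>X -> 0\<close>, and
  lifting properties pass to pushouts: the square with \<open>0\<close> on top and
  \<open>v \<cdot> c\<close> below has a lift that kills \<open>f\<close>, so this lift factors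
  through \<open>c\<close>.\<close>

lemma hom_epic_cokernel:
  assumes f: "f \<in> Hom A X Y" and c: "c \<in> Hom A Y K" 
    and ck: "is_cokernel A f c" and l: "lifts_against A f g" "g \<in> Arr A"
  shows "hom_epic A {K} g"
proof -
  obtain P Q where g: "g \<in> Hom A P Q" using Arr_Hom l(2) by blast
  show ?thesis
  proof (rule hom_epicI[OF g])
    fix K' v assume "K' \<in> {K}" "v \<in> Hom A K' Q"
    then have "K' = K" and v: "v \<in> Hom A K Q" by auto
    have X: "X \<in> Ob A" using Hom_Ob f by blast
    have z: "Zero A X P \<in> Hom A X P" using X Hom_Ob g Zero_Hom by blast
    have "g \<cdot> Zero A X P = (v \<cdot> c) \<cdot> f"
      using Comp_Zero_right[OF g X] Comp_assoc[OF f c v] is_cokernelD(1)[OF ck f c]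
        Comp_Zero_right[OF v X] by simp
    then obtain h where h: "h \<in> Hom A Y P" "h \<cdot> f = Zero A X P" "g \<cdot> h = v \<cdot> c"
      using lifts_againstD[OF l(1) f g z Comp_Hom[OF c v]] by blast
    obtain k where k: "k \<in> Hom A K P" "k \<cdot> c = h"
      using is_cokernelD(2)[OF ck f c] h by blast
    have "(g \<cdot> k) \<cdot> c = v \<cdot> c" using Comp_assoc[OF c k(1) g] k h by simp
    then have "g \<cdot> k = v" using is_cokernelD(3)[OF ck f c Comp_Hom[OF k(1) g] v] by blast
    then show "\<exists>h \<in> Hom A K' P. g \<cdot> h = v" using k \<open>K' = K\<close> by blast
  qed
qed

end

section \<open>Quotient categories\<close>

text \<open>Serves twice: for the quotient of an additive category by an ideal of maps, and for
  zigzags modulo the relations of a localization.\<close>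

locale congruence = category A for A :: "('o, 'm, 'z) cat_scheme" (structure) +
  fixes R :: "('m \<times> 'm) set"
  assumes equiv: "equiv (Arr A) R"
    and parallel: "(f, g) \<in> R \<Longrightarrow> Dom A f = Dom A g \<and> Cod A f = Cod A g"
    and compatible: "\<lbrakk>(f, f') \<in> R; (g, g') \<in> R; Cod A f = Dom A g\<rbrakk> \<Longrightarrow> (g \<cdot> f, g' \<cdot> f') \<in> R"
begin

abbreviation Q where "Q \<equiv> quotient_cat A R"

lemma Ob_quotient: "Ob Q = Ob A"
  by (simp add: quotient_cat_def)

lemma rel_Arr: "(f, g) \<in> R \<Longrightarrow> f \<in> Arr A \<and> g \<in> Arr A"
  using equiv unfolding equiv_def refl_on_def by blast

lemma class_eq_iff: "f \<in> Arr A \<Longrightarrow> g \<in> Arr A \<Longrightarrow> R `` {f} = R `` {g} \<longleftrightarrow> (f, g) \<in> R"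
  using equiv by (simp add: eq_equiv_class_iff)

lemma rel_refl: "f \<in> Arr A \<Longrightarrow> (f, f) \<in> R"
  using equiv by (meson equiv_def refl_onD)

lemma rel_Hom: "f \<in> Hom A X Y \<Longrightarrow> (f, g) \<in> R \<Longrightarrow> g \<in> Hom A X Y"
  using parallel rel_Arr by (fastforce simp: Hom_def)

lemma class_Dom: "f \<in> Hom A X Y \<Longrightarrow> Dom Q (R `` {f}) = X"
  and class_Cod: "f \<in> Hom A X Y \<Longrightarrow> Cod Q (R `` {f}) = Y"
proof -
  assume f: "f \<in> Hom A X Y"
  have "Dom A ` (R `` {f}) = {X}" "Cod A ` (R `` {f}) = {Y}"
    using rel_Hom[OF f] rel_refl[OF Hom_Arr[OF f]] by (auto simp: Hom_def)
  then show "Dom Q (R `` {f}) = X" "Cod Q (R `` {f}) = Y"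
    by (simp_all add: quotient_cat_def)
qed

lemma class_Hom: "f \<in> Hom A X Y \<Longrightarrow> R `` {f} \<in> Hom Q X Y"
  using class_Dom class_Cod quotientI[OF Hom_Arr] unfolding Hom_def[of Q]
  by (simp add: quotient_cat_def)

lemma HomE:
  assumes "K \<in> Hom Q X Y"
  obtains f where "f \<in> Hom A X Y" "K = R `` {f}"
proof -
  have "K \<in> Arr A // R" using assms by (simp add: Hom_def quotient_cat_def)
  then obtain f where f: "f \<in> Arr A" "K = R `` {f}" by (blast elim: quotientE)
  then have "Dom A f = X" "Cod A f = Y"
    using assms class_Dom[OF Arr_Hom] class_Cod[OF Arr_Hom] by (auto simp: Hom_def)
  then show thesis using that f Arr_Hom by blast
qed

lemma class_Comp:
  assumes "f \<in> Hom A X Y" "g \<in> Hom A Y Z"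
  shows "R `` {g} \<cdot>\<^bsub>Q\<^esub> R `` {f} = R `` {g \<cdot> f}"
proof -
  have "R `` {g' \<cdot> f'} = R `` {g \<cdot> f}" if "(f, f') \<in> R" "(g, g') \<in> R" for f' g'
    using compatible[OF that] assms equiv_class_eq[OF equiv] by (auto simp: Hom_def)
  then show ?thesis
    using rel_refl[OF Hom_Arr[OF assms(1)]] rel_refl[OF Hom_Arr[OF assms(2)]]
    unfolding quotient_cat_def cat.select_convs by (intro SUP_eq_const) blast+
qed

lemma class_Idn: "Idn Q X = R `` {Idn A X}"
  by (simp add: quotient_cat_def)

lemma category_quotient: "category Q"
proof
  fix K assume "K \<in> Arr Q"
  then obtain f where f: "f \<in> Hom A (Dom A f) (Cod A f)" "K = R `` {f}"
    using Arr_Hom by (auto simp: quotient_cat_def elim: quotientE)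
  show "Dom Q K \<in> Ob Q" "Cod Q K \<in> Ob Q"
    using class_Dom[OF f(1)] class_Cod[OF f(1)] f Hom_Ob[OF f(1)] by (simp_all add: Ob_quotient)
next
  fix X assume "X \<in> Ob Q" 
  then show "Idn Q X \<in> Hom Q X X" using class_Hom[OF Idn_Hom] by (simp add: class_Idn Ob_quotient)
next
  fix K L X Y Z assume "K \<in> Hom Q X Y" "L \<in> Hom Q Y Z"
  then show "L \<cdot>\<^bsub>Q\<^esub> K \<in> Hom Q X Z"
    by (elim HomE) (simp add: class_Comp class_Hom Comp_Hom)
next
  fix K L M X Y Z W assume "K \<in> Hom Q X Y" "L \<in> Hom Q Y Z" "M \<in> Hom Q Z W"
  then obtain f g h where f: "f \<in> Hom A X Y" "K = R `` {f}" and g: "g \<in> Hom A Y Z" "L = R `` {g}"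
    and h: "h \<in> Hom A Z W" "M = R `` {h}" by (blast elim: HomE)
  show "M \<cdot>\<^bsub>Q\<^esub> L \<cdot>\<^bsub>Q\<^esub> K = M \<cdot>\<^bsub>Q\<^esub> (L \<cdot>\<^bsub>Q\<^esub> K)"
    using class_Comp[OF f(1) g(1)] class_Comp[OF g(1) h(1)] class_Comp[OF f(1) Comp_Hom[OF g(1) h(1)]]
      class_Comp[OF Comp_Hom[OF f(1) g(1)] h(1)] Comp_assoc[OF f(1) g(1) h(1)] f g h by simp
next
  fix K X Y assume "K \<in> Hom Q X Y"
  then obtain f where f: "f \<in> Hom A X Y" "K = R `` {f}" by (blast elim: HomE)
  show "K \<cdot>\<^bsub>Q\<^esub> Idn Q X = K" "Idn Q Y \<cdot>\<^bsub>Q\<^esub> K = K"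
    using class_Comp[OF Idn_Hom f(1)] class_Comp[OF f(1) Idn_Hom] Hom_Ob[OF f(1)] f
      Comp_Idn_left[OF f(1)] Comp_Idn_right[OF f(1)] by (simp_all add: class_Idn)
qed

end

section \<open>Additive quotients by the maps through a class of objects\<close>

lemma hom_group_simps:
  "carrier (hom_group A X Y) = Hom A X Y"
  "f \<otimes>\<^bsub>hom_group A X Y\<^esub> g = f \<boxplus>\<^bsub>A\<^esub> g"
  "\<one>\<^bsub>hom_group A X Y\<^esub> = Zero A X Y"
  by (simp_all add: hom_group_def)

text \<open>Nonemptiness puts the zero maps among the maps through \<open>U\<close>, and biproducts
  close these maps under sums, so they form a two-sided ideal.\<close>

locale additive_ideal = additive_category A for A :: "('o, 'm, 'z) acat_scheme" (structure) +
  fixes U :: "'o set"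
  assumes U_Ob: "U \<subseteq> Ob A" and U_nonempty: "U \<noteq> {}"
    and U_biproduct: "\<lbrakk>X \<in> U; Y \<in> U\<rbrakk> \<Longrightarrow> \<exists>S \<in> U. biproduct A X Y S"
begin

lemma factoring_Hom: "f \<in> factoring A U X Y \<Longrightarrow> f \<in> Hom A X Y"
  unfolding factoring_def using Comp_Hom by blast

lemma factoringI: "V \<in> U \<Longrightarrow> a \<in> Hom A X V \<Longrightarrow> b \<in> Hom A V Y \<Longrightarrow> b \<cdot> a \<in> factoring A U X Y"
  unfolding factoring_def by blast

lemma factoring_Comp_left:
  assumes "f \<in> factoring A U X Y" "g \<in> Hom A Y Z"
  shows "g \<cdot> f \<in> factoring A U X Z"
proof -
  obtain V a b where V: "V \<in> U" "a \<in> Hom A X V" "b \<in> Hom A V Y" "f = b \<cdot> a"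
    using assms(1) unfolding factoring_def by blast
  then show ?thesis
    using factoringI[OF V(1,2) Comp_Hom[OF V(3) assms(2)]] Comp_assoc[OF V(2,3) assms(2)] by simp
qed

lemma factoring_Comp_right:
  assumes "f \<in> factoring A U Y Z" "g \<in> Hom A X Y"
  shows "f \<cdot> g \<in> factoring A U X Z"
proof -
  obtain V a b where V: "V \<in> U" "a \<in> Hom A Y V" "b \<in> Hom A V Z" "f = b \<cdot> a"
    using assms(1) unfolding factoring_def by blast
  then show ?thesis
    using factoringI[OF V(1) Comp_Hom[OF assms(2) V(2)] V(3)] Comp_assoc[OF assms(2) V(2,3)] by simp
qed

lemma factoring_Zero:
  assumes "X \<in> Ob A" "Y \<in> Ob A"
  shows "Zero A X Y \<in> factoring A U X Y"
proof -
  obtain V where V: "V \<in> U" "V \<in> Ob A" using U_nonempty U_Ob by blast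
  have "Zero A V Y \<cdot> Zero A X V \<in> factoring A U X Y"
    using factoringI[OF V(1) Zero_Hom Zero_Hom] V assms by simp
  then show ?thesis using Comp_Zero_left[OF Zero_Hom] V assms by simp
qed

text \<open>\<open>b \<cdot> a\<close> and \<open>d \<cdot> c\<close> add up through the biproduct
  of \<open>V\<close> and \<open>W\<close>: their sum is the row \<open>(b, d)\<close> after the
  column \<open>(a, c)\<close>.\<close>

lemma factoring_Add:
  assumes "f \<in> factoring A U X Y" "g \<in> factoring A U X Y"
  shows "f \<boxplus> g \<in> factoring A U X Y"
proof -
  obtain V a b where V: "V \<in> U" "a \<in> Hom A X V" "b \<in> Hom A V Y" "f = b \<cdot> a"
    using assms(1) unfolding factoring_def by blast
  obtain W c d where W: "W \<in> U" "c \<in> Hom A X W" "d \<in> Hom A W Y" "g = d \<cdot> c"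
    using assms(2) unfolding factoring_def by blast
  obtain S where S: "S \<in> U" "biproduct A V W S" using U_biproduct V W by blast
  obtain i j p q where b: "i \<in> Hom A V S" "j \<in> Hom A W S" "p \<in> Hom A S V" "q \<in> Hom A S W"
    "p \<cdot> i = Idn A V" "q \<cdot> j = Idn A W" "p \<cdot> j = Zero A W V" "q \<cdot> i = Zero A V W"
    using S(2) by (rule biproductE)
  note ia = Comp_Hom[OF V(2) b(1)] and jc = Comp_Hom[OF W(2) b(2)]
    and bp = Comp_Hom[OF b(3) V(3)] and dq = Comp_Hom[OF b(4) W(3)]
  have X: "X \<in> Ob A" using Hom_Ob[OF V(2)] by blast
  have "p \<cdot> (i \<cdot> a) = a" "p \<cdot> (j \<cdot> c) = Zero A X V" "q \<cdot> (i \<cdot> a) = Zero A X W" "q \<cdot> (j \<cdot> c) = c"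
    using Comp_assoc[OF V(2) b(1,3)] Comp_assoc[OF W(2) b(2,3)] Comp_assoc[OF V(2) b(1,4)]
      Comp_assoc[OF W(2) b(2,4)] b(5-) Comp_Idn_left[OF V(2)] Comp_Idn_left[OF W(2)]
      Comp_Zero_left[OF V(2)] Comp_Zero_left[OF W(2)] Hom_Ob[OF V(2)] Hom_Ob[OF W(2)] by simp_all
  then have "p \<cdot> (i \<cdot> a \<boxplus> j \<cdot> c) = a" "q \<cdot> (i \<cdot> a \<boxplus> j \<cdot> c) = c"
    using Comp_Add_right[OF ia jc b(3)] Comp_Add_right[OF ia jc b(4)]
      Add_Zero_right[OF V(2)] Add_Zero_left[OF W(2)] by simp_all
  then have "(b \<cdot> p \<boxplus> d \<cdot> q) \<cdot> (i \<cdot> a \<boxplus> j \<cdot> c) = f \<boxplus> g"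
    using Comp_Add_left[OF Add_closed[OF ia jc] bp dq] V(4) W(4)
      Comp_assoc[OF Add_closed[OF ia jc] b(3) V(3)] Comp_assoc[OF Add_closed[OF ia jc] b(4) W(3)]
    by simp
  then show ?thesis
    using factoringI[OF S(1) Add_closed[OF ia jc] Add_closed[OF bp dq]] by simp
qed

text \<open>Closure under subtraction: if \<open>f = b \<cdot> a\<close>, then
  \<open>-f = (-b) \<cdot> a\<close> goes through the same object.\<close>

lemma factoring_difference:
  assumes "f \<in> Hom A X Y" "f \<boxplus> d \<in> factoring A U X Y" "f \<in> factoring A U X Y" "d \<in> Hom A X Y"
  shows "d \<in> factoring A U X Y"
proof -
  obtain V a b where V: "V \<in> U" "a \<in> Hom A X V" "b \<in> Hom A V Y" "f = b \<cdot> a"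
    using assms(3) unfolding factoring_def by blast
  obtain n where n: "n \<in> Hom A V Y" "n \<boxplus> b = Zero A V Y" using ex_neg Hom_Ob[OF V(3)] V(3) by blast
  have "(n \<cdot> a) \<boxplus> f = Zero A X Y"
    using Comp_Add_left[OF V(2) n(1) V(3)] n(2) V(4) Comp_Zero_left[OF V(2)] Hom_Ob[OF V(3)] by simp
  then have "(n \<cdot> a) \<boxplus> (f \<boxplus> d) = d"
    using Add_assoc[OF Comp_Hom[OF V(2) n(1)] assms(1,4)] Add_Zero_left[OF assms(4)] by simp
  then show ?thesis
    using factoring_Add[OF factoringI[OF V(1,2) n(1)] assms(2)] by simp
qed

abbreviation R where "R \<equiv> factoring_rel A U"

text \<open>Turns the coset condition on the inverse of \<open>f\<close> times \<open>g\<close> into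
  \<open>g = f \<boxplus> d\<close>, a form without inverses.\<close>

lemma rel_iff: "(f, g) \<in> R \<longleftrightarrow> (\<exists>X Y. f \<in> Hom A X Y \<and> (\<exists>d \<in> factoring A U X Y. g = f \<boxplus> d))"
proof -
  have "(f, g) \<in> r_congruent (hom_group A X Y) (factoring A U X Y) \<longleftrightarrow>
      f \<in> Hom A X Y \<and> (\<exists>d \<in> factoring A U X Y. g = f \<boxplus> d)" if XY: "X \<in> Ob A" "Y \<in> Ob A" for X Y
  proof -
    let ?G = "hom_group A X Y"
    interpret G: comm_group ?G using XY by (rule hom_comm_group)
    have "inv\<^bsub>?G\<^esub> f \<otimes>\<^bsub>?G\<^esub> g = d \<longleftrightarrow> g = f \<otimes>\<^bsub>?G\<^esub> d"
      if "f \<in> carrier ?G" "g \<in> carrier ?G" "d \<in> carrier ?G" for d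
      using G.inv_solve_left[of d f g] that by auto
    then have *: "inv\<^bsub>?G\<^esub> f \<otimes>\<^bsub>?G\<^esub> g = d \<longleftrightarrow> g = f \<boxplus> d"
      if "f \<in> Hom A X Y" "g \<in> Hom A X Y" "d \<in> Hom A X Y" for d
      using that by (simp only: hom_group_simps)
    show ?thesis
      unfolding r_congruent_def using * factoring_Hom Add_closed
      by (auto simp only: mem_Collect_eq case_prod_conv hom_group_simps(1)) metis+
  qed
  then show ?thesis unfolding factoring_rel_def using Hom_Ob by fastforce
qed

lemma relI: "f \<in> Hom A X Y \<Longrightarrow> d \<in> factoring A U X Y \<Longrightarrow> (f, f \<boxplus> d) \<in> R"
  using rel_iff by blast

lemma relE:
  assumes "(f, g) \<in> R" "f \<in> Hom A X Y"
  obtains d where "d \<in> factoring A U X Y" "g = f \<boxplus> d"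
  using assms rel_iff by (auto simp: Hom_def)

lemma congruence_rel: "congruence A R"
proof
  have refl: "(f, f) \<in> R" if "f \<in> Arr A" for f
    using relI[OF Arr_Hom[OF that] factoring_Zero] Dom_Ob[OF that] Cod_Ob[OF that]
      Add_Zero_right[OF Arr_Hom[OF that]] by simp
  have sym: "(g, f) \<in> R" if r: "(f, g) \<in> R" for f g
  proof -
    obtain X Y d where d: "f \<in> Hom A X Y" "d \<in> factoring A U X Y" "g = f \<boxplus> d"
      using r rel_iff by blast
    note g = Add_closed[OF d(1) factoring_Hom[OF d(2)], folded d(3)]
    obtain e where e: "e \<in> Hom A X Y" "f = g \<boxplus> e" using difference[OF d(1) g] by blast
    \<comment> \<open>\<open>e\<close> turns out to be \<open>-d\<close>, and subtraction stays
      inside the ideal.\<close>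
    have "f \<boxplus> (d \<boxplus> e) = f \<boxplus> Zero A X Y"
      using e d Add_assoc[OF d(1) factoring_Hom[OF d(2)] e(1)] Add_Zero_right[OF d(1)] by simp
    then have "d \<boxplus> e = Zero A X Y"
      using Add_left_cancel[OF d(1) Add_closed[OF factoring_Hom[OF d(2)] e(1)] Zero_Hom] Hom_Ob[OF d(1)]
      by simp
    then have "e \<in> factoring A U X Y"
      using factoring_difference[OF factoring_Hom[OF d(2)] _ d(2) e(1)] factoring_Zero Hom_Ob[OF d(1)]
      by simp
    then show ?thesis using relI[OF g] e by metis
  qed
  have trans: "(f, h) \<in> R" if r: "(f, g) \<in> R" "(g, h) \<in> R" for f g h
  proof -
    obtain X Y d where d: "f \<in> Hom A X Y" "d \<in> factoring A U X Y" "g = f \<boxplus> d"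
      using r rel_iff by blast
    note g = Add_closed[OF d(1) factoring_Hom[OF d(2)], folded d(3)]
    obtain e where e: "e \<in> factoring A U X Y" "h = g \<boxplus> e" using relE[OF r(2) g] by blast
    show ?thesis
      using relI[OF d(1) factoring_Add[OF d(2) e(1)]] d e
        Add_assoc[OF d(1) factoring_Hom[OF d(2)] factoring_Hom[OF e(1)]] by simp
  qed
  have "R \<subseteq> Arr A \<times> Arr A"
    using rel_iff factoring_Hom Add_closed Hom_Arr by auto metis+
  then show "equiv (Arr A) R"
    unfolding equiv_def refl_on_def sym_def trans_def using refl sym trans by blast
  fix f g assume "(f, g) \<in> R"
  then obtain X Y d where "f \<in> Hom A X Y" "d \<in> factoring A U X Y" "g = f \<boxplus> d" using rel_iff by blast
  then show "Dom A f = Dom A g \<and> Cod A f = Cod A g"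
    using Add_closed[OF _ factoring_Hom] by (auto simp: Hom_def)
next
  fix f f' g g' assume r: "(f, f') \<in> R" "(g, g') \<in> R" and "Cod A f = Dom A g"
  then obtain X Y Z d e where f: "f \<in> Hom A X Y" "d \<in> factoring A U X Y" "f' = f \<boxplus> d"
    and g: "g \<in> Hom A Y Z" "e \<in> factoring A U Y Z" "g' = g \<boxplus> e"
    unfolding rel_iff by (auto simp: Hom_def)
  note d = factoring_Hom[OF f(2)] and e = factoring_Hom[OF g(2)]
  note f' = Add_closed[OF f(1) d, folded f(3)]
  \<comment> \<open>With \<open>f' = f \<boxplus> d\<close> and \<open>g' = g \<boxplus> e\<close>,
    the error \<open>g \<cdot> d \<boxplus> e \<cdot> f'\<close> goes through \<open>U\<close>
    because the ideal is two-sided.\<close>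
  have "g' \<cdot> f' = (g \<cdot> f \<boxplus> g \<cdot> d) \<boxplus> e \<cdot> f'"
    using Comp_Add_left[OF f' g(1) e] g(3) Comp_Add_right[OF f(1) d g(1)] f(3) by simp
  also have "\<dots> = g \<cdot> f \<boxplus> (g \<cdot> d \<boxplus> e \<cdot> f')"
    using f(1) g(1) d e f' by (intro Add_assoc) (rule Comp_Hom; assumption)+
  finally show "(g \<cdot> f, g' \<cdot> f') \<in> R"
    using relI[OF Comp_Hom[OF f(1) g(1)]
        factoring_Add[OF factoring_Comp_left[OF f(2) g(1)] factoring_Comp_right[OF g(2) f']]]
    by simp
qed

sublocale congruence A R by (rule congruence_rel)

abbreviation B where "B \<equiv> additive_quotient A U"

lemma B_simps: "Ob B = Ob A" "Arr B = Arr Q" "Dom B = Dom Q" "Cod B = Cod Q" "Idn B = Idn Q"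
    "Comp B = Comp Q" "Hom B = Hom Q" "Zero B X Y = R `` {Zero A X Y}"
    "Add B K L = (\<Union>f \<in> K. \<Union>g \<in> L. R `` {f \<boxplus> g})"
  by (simp_all add: additive_quotient_def cat.extend_def acat.fields_def Ob_quotient Hom_def fun_eq_iff)

lemma class_Add:
  assumes "f \<in> Hom A X Y" "g \<in> Hom A X Y"
  shows "R `` {f} \<boxplus>\<^bsub>B\<^esub> R `` {g} = R `` {f \<boxplus> g}"
proof -
  have "R `` {f' \<boxplus> g'} = R `` {f \<boxplus> g}" if r: "(f, f') \<in> R" "(g, g') \<in> R" for f' g'
  proof -
    obtain d where d: "d \<in> factoring A U X Y" "f' = f \<boxplus> d" using relE r(1) assms(1) by blast
    obtain e where e: "e \<in> factoring A U X Y" "g' = g \<boxplus> e" using relE r(2) assms(2) by blast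
    note dH = factoring_Hom[OF d(1)] and eH = factoring_Hom[OF e(1)]
    have "d \<boxplus> (g \<boxplus> e) = g \<boxplus> (d \<boxplus> e)"
      using Add_assoc[OF dH assms(2) eH] Add_assoc[OF assms(2) dH eH] Add_commute[OF dH assms(2)]
      by simp
    then have "f' \<boxplus> g' = (f \<boxplus> g) \<boxplus> (d \<boxplus> e)"
      using d e Add_assoc[OF assms(1) dH Add_closed[OF assms(2) eH]]
        Add_assoc[OF assms Add_closed[OF dH eH]] by simp
    then show ?thesis
      using relI[OF Add_closed[OF assms] factoring_Add[OF d(1) e(1)]] equiv_class_eq[OF equiv] by simp
  qed
  then show ?thesis
    using rel_refl[OF Hom_Arr[OF assms(1)]] rel_refl[OF Hom_Arr[OF assms(2)]]
    unfolding B_simps by (intro SUP_eq_const) blast+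
qed

lemma category_B: "category B"
  by (rule category_cong[OF category_quotient]) (simp_all add: B_simps Ob_quotient)

text \<open>Taking classes is additive, functorial and onto on Hom-sets, so the identities, the zero
  object and the biproducts of \<open>A\<close> descend.\<close>

lemma additive_category_B: "additive_category B"
proof -
  have grp: "comm_group (hom_group B X Y)" if XY: "X \<in> Ob B" "Y \<in> Ob B" for X Y
  proof -
    have z: "Zero A X Y \<in> Hom A X Y" using XY Zero_Hom by (simp add: B_simps)
    show ?thesis
    proof (rule comm_groupI; unfold hom_group_simps B_simps(7))
      fix K L assume "K \<in> Hom Q X Y" "L \<in> Hom Q X Y"
      then show "K \<boxplus>\<^bsub>B\<^esub> L \<in> Hom Q X Y" "K \<boxplus>\<^bsub>B\<^esub> L = L \<boxplus>\<^bsub>B\<^esub> K"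
        by (elim HomE; simp add: class_Add class_Hom Add_closed Add_commute)+
    next
      show "Zero B X Y \<in> Hom Q X Y" using class_Hom[OF z] by (simp add: B_simps)
    next
      fix K L M assume "K \<in> Hom Q X Y" "L \<in> Hom Q X Y" "M \<in> Hom Q X Y"
      then obtain f g h where f: "f \<in> Hom A X Y" "K = R `` {f}" and g: "g \<in> Hom A X Y" "L = R `` {g}"
        and h: "h \<in> Hom A X Y" "M = R `` {h}" by (blast elim: HomE)
      show "K \<boxplus>\<^bsub>B\<^esub> L \<boxplus>\<^bsub>B\<^esub> M = K \<boxplus>\<^bsub>B\<^esub> (L \<boxplus>\<^bsub>B\<^esub> M)"
        using class_Add[OF f(1) g(1)] class_Add[OF g(1) h(1)] class_Add[OF Add_closed[OF f(1) g(1)] h(1)]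
          class_Add[OF f(1) Add_closed[OF g(1) h(1)]] Add_assoc[OF f(1) g(1) h(1)] f g h by simp
    next
      fix K assume "K \<in> Hom Q X Y"
      then obtain f where f: "f \<in> Hom A X Y" "K = R `` {f}" by (rule HomE)
      show "Zero B X Y \<boxplus>\<^bsub>B\<^esub> K = K"
        using class_Add[OF z f(1)] Add_Zero_left[OF f(1)] f by (simp add: B_simps(8))
      obtain g where g: "g \<in> Hom A X Y" "g \<boxplus> f = Zero A X Y"
        using ex_neg[OF _ _ f(1)] XY by (auto simp: B_simps)
      show "\<exists>L \<in> Hom Q X Y. L \<boxplus>\<^bsub>B\<^esub> K = Zero B X Y"
        using class_Add[OF g(1) f(1)] class_Hom[OF g(1)] g f by (auto simp: B_simps(8))
    qed
  qed
  show ?thesis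
  proof (intro additive_category.intro additive_category_axioms.intro category_B grp)
    fix K L M X Y Z
    assume "K \<in> Hom B X Y" "L \<in> Hom B X Y" "M \<in> Hom B Y Z"
    then obtain f g h where f: "f \<in> Hom A X Y" "K = R `` {f}" and g: "g \<in> Hom A X Y" "L = R `` {g}"
      and h: "h \<in> Hom A Y Z" "M = R `` {h}" unfolding B_simps by (blast elim: HomE)
    show "M \<cdot>\<^bsub>B\<^esub> (K \<boxplus>\<^bsub>B\<^esub> L) = M \<cdot>\<^bsub>B\<^esub> K \<boxplus>\<^bsub>B\<^esub> M \<cdot>\<^bsub>B\<^esub> L"
      using class_Add[OF f(1) g(1)] class_Comp[OF Add_closed[OF f(1) g(1)] h(1)]
        class_Comp[OF f(1) h(1)] class_Comp[OF g(1) h(1)] Comp_Add_right[OF f(1) g(1) h(1)]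
        class_Add[OF Comp_Hom[OF f(1) h(1)] Comp_Hom[OF g(1) h(1)]] f g h by (simp add: B_simps(6))
  next
    fix K L M X Y Z
    assume "K \<in> Hom B X Y" "L \<in> Hom B Y Z" "M \<in> Hom B Y Z"
    then obtain f g h where f: "f \<in> Hom A X Y" "K = R `` {f}" and g: "g \<in> Hom A Y Z" "L = R `` {g}"
      and h: "h \<in> Hom A Y Z" "M = R `` {h}" unfolding B_simps by (blast elim: HomE)
    show "(L \<boxplus>\<^bsub>B\<^esub> M) \<cdot>\<^bsub>B\<^esub> K = L \<cdot>\<^bsub>B\<^esub> K \<boxplus>\<^bsub>B\<^esub> M \<cdot>\<^bsub>B\<^esub> K"
      using class_Add[OF g(1) h(1)] class_Comp[OF f(1) Add_closed[OF g(1) h(1)]]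
        class_Comp[OF f(1) g(1)] class_Comp[OF f(1) h(1)] Comp_Add_left[OF f(1) g(1) h(1)]
        class_Add[OF Comp_Hom[OF f(1) g(1)] Comp_Hom[OF f(1) h(1)]] f g h by (simp add: B_simps(6))
  next
    have "\<exists>!K. K \<in> Hom Q X Y" if "\<exists>!f. f \<in> Hom A X Y" for X Y
      using that class_Hom HomE by metis
    then show "\<exists>Z. zero_object B Z"
      using zero_object_zero_ob
      by (intro exI[of _ "zero_ob A"]) (simp add: zero_object_def B_simps(1,7))
  next
    fix X Y assume "X \<in> Ob B" "Y \<in> Ob B"
    then obtain S where "biproduct A X Y S" using ex_biproduct by (auto simp: B_simps)
    then have S: "S \<in> Ob A" by (simp add: biproduct_def)
    obtain i j p q where b: "i \<in> Hom A X S" "j \<in> Hom A Y S" "p \<in> Hom A S X" "q \<in> Hom A S Y"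
      "p \<cdot> i = Idn A X" "q \<cdot> j = Idn A Y" "p \<cdot> j = Zero A Y X" "q \<cdot> i = Zero A X Y"
      "(i \<cdot> p) \<boxplus> (j \<cdot> q) = Idn A S"
      using \<open>biproduct A X Y S\<close> by (rule biproductE)
    show "\<exists>S. biproduct B X Y S"
      unfolding biproduct_def B_simps(1,5-8)
      using S b class_Hom[OF b(1)] class_Hom[OF b(2)] class_Hom[OF b(3)] class_Hom[OF b(4)]
        class_Comp[OF b(1,3)] class_Comp[OF b(2,4)] class_Comp[OF b(2,3)] class_Comp[OF b(1,4)]
        class_Comp[OF b(3,1)] class_Comp[OF b(4,2)]
        class_Add[OF Comp_Hom[OF b(3,1)] Comp_Hom[OF b(4,2)]]
      by (intro exI[of _ S] conjI bexI[of _ "R `` {i}"] bexI[of _ "R `` {j}"]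
          bexI[of _ "R `` {p}"] bexI[of _ "R `` {q}"]) (simp_all add: class_Idn)
  qed
qed

end

section \<open>Full subcategories\<close>

lemma full_simps:
  "Ob (full_subcategory A C) = Ob A \<inter> C"
  "Arr (full_subcategory A C) = {f \<in> Arr A. Dom A f \<in> C \<and> Cod A f \<in> C}"
  "Dom (full_subcategory A C) = Dom A" "Cod (full_subcategory A C) = Cod A"
  "Idn (full_subcategory A C) = Idn A" "Comp (full_subcategory A C) = Comp A"
  "Hom (full_subcategory A C) X Y = {f \<in> Hom A X Y. X \<in> C \<and> Y \<in> C}"
  by (auto simp: full_subcategory_def Hom_def)

lemma full_additive_simps:
  fixes A :: "('o, 'm, 'z) acat_scheme"
  shows "Add (full_subcategory A C) = Add A" "Zero (full_subcategory A C) = Zero A"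
  by (simp_all add: full_subcategory_def)

lemma (in category) category_full: "category (full_subcategory A C)"
  by unfold_locales (auto simp: full_simps Dom_Ob Cod_Ob Idn_Hom Comp_Idn_left Comp_Idn_right
      intro: Comp_Hom Comp_assoc)

text \<open>Hom-sets and composition are those of \<open>A\<close>, so a zero object or a biproduct
  of \<open>A\<close> remains one as soon as its object lies in \<open>C\<close>.\<close>

lemma (in additive_category) additive_category_full:
  assumes "C \<subseteq> Ob A" "zero_ob A \<in> C"
    and bip: "\<And>X Y S. X \<in> C \<Longrightarrow> Y \<in> C \<Longrightarrow> biproduct A X Y S \<Longrightarrow> S \<in> C"
  shows "additive_category (full_subcategory A C)"
proof (intro additive_category.intro additive_category_axioms.intro category_full)
  fix X Y assume "X \<in> Ob (full_subcategory A C)" "Y \<in> Ob (full_subcategory A C)"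
  then have *: "X \<in> Ob A" "Y \<in> Ob A" "X \<in> C" "Y \<in> C" by (auto simp: full_simps)
  then have "hom_group (full_subcategory A C) X Y = hom_group A X Y"
    by (simp add: hom_group_def full_simps full_additive_simps)
  then show "comm_group (hom_group (full_subcategory A C) X Y)" using hom_comm_group * by simp
  obtain S where S: "biproduct A X Y S" using ex_biproduct * by blast
  then have "S \<in> C" using bip * by blast
  have "biproduct (full_subcategory A C) X Y S \<longleftrightarrow> biproduct A X Y S"
    using * \<open>S \<in> C\<close> by (simp add: biproduct_def full_simps full_additive_simps)
  then show "\<exists>S. biproduct (full_subcategory A C) X Y S" using S by blast
next
  have "zero_object (full_subcategory A C) (zero_ob A)"
    unfolding zero_object_def
  proof (intro conjI ballI)
    show "zero_ob A \<in> Ob (full_subcategory A C)" using zero_ob_Ob assms(2) by (simp add: full_simps)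
    fix X assume "X \<in> Ob (full_subcategory A C)"
    then have "X \<in> Ob A" "X \<in> C" by (simp_all add: full_simps)
    then show "\<exists>!f. f \<in> Hom (full_subcategory A C) (zero_ob A) X"
      "\<exists>!f. f \<in> Hom (full_subcategory A C) X (zero_ob A)"
      using zero_object_zero_ob assms(2) unfolding zero_object_def full_simps(7) by simp_all
  qed
  then show "\<exists>Z. zero_object (full_subcategory A C) Z" by blast
qed (unfold full_simps(6,7) full_additive_simps mem_Collect_eq,
    metis Comp_Add_right, metis Comp_Add_left)

section \<open>Localizations\<close>

lemma is_functorD:
  assumes "is_functor A B Fo Fa" "category A"
  shows "X \<in> Ob A \<Longrightarrow> Fo X \<in> Ob B"
    and "f \<in> Hom A X Y \<Longrightarrow> Fa f \<in> Hom B (Fo X) (Fo Y)"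
    and "X \<in> Ob A \<Longrightarrow> Fa (Idn A X) = Idn B (Fo X)"
    and "f \<in> Hom A X Y \<Longrightarrow> g \<in> Hom A Y Z \<Longrightarrow> Fa (g \<cdot>\<^bsub>A\<^esub> f) = Fa g \<cdot>\<^bsub>B\<^esub> Fa f"
proof -
  note d = assms(1)[unfolded is_functor_def]
  show "X \<in> Ob A \<Longrightarrow> Fo X \<in> Ob B" using d by blast
  show "f \<in> Hom A X Y \<Longrightarrow> Fa f \<in> Hom B (Fo X) (Fo Y)" using d by (auto simp: Hom_def[of A])
  show "X \<in> Ob A \<Longrightarrow> Fa (Idn A X) = Idn B (Fo X)" using d by blast
  show "f \<in> Hom A X Y \<Longrightarrow> g \<in> Hom A Y Z \<Longrightarrow> Fa (g \<cdot>\<^bsub>A\<^esub> f) = Fa g \<cdot>\<^bsub>B\<^esub> Fa f"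
    using d by (auto simp: Hom_def[of A])
qed

lemma (in category) is_functorI:
  assumes "\<And>X. X \<in> Ob A \<Longrightarrow> Fo X \<in> Ob B"
    and "\<And>f X Y. f \<in> Hom A X Y \<Longrightarrow> Fa f \<in> Hom B (Fo X) (Fo Y)"
    and "\<And>X. X \<in> Ob A \<Longrightarrow> Fa (Idn A X) = Idn B (Fo X)"
    and "\<And>f g X Y Z. f \<in> Hom A X Y \<Longrightarrow> g \<in> Hom A Y Z \<Longrightarrow> Fa (g \<cdot> f) = Fa g \<cdot>\<^bsub>B\<^esub> Fa f"
  shows "is_functor A B Fo Fa"
  unfolding is_functor_def
proof (intro conjI ballI impI)
  show "Fo ` Ob A \<subseteq> Ob B" using assms(1) by blast
  show "Fa f \<in> Hom B (Fo (Dom A f)) (Fo (Cod A f))" if "f \<in> Arr A" for f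
    using assms(2)[OF Arr_Hom[OF that]] .
  show "Fa (g \<cdot> f) = Fa g \<cdot>\<^bsub>B\<^esub> Fa f" if "f \<in> Arr A" "g \<in> Arr A" "Cod A f = Dom A g" for f g
    using assms(4)[OF Arr_Hom[OF that(1)]] Arr_Hom[OF that(2)] that(3) by simp
qed (rule assms(3))

text \<open>Zigzags are evaluated by a function on lists, so formal inverses need a function value;
  uniqueness of inverses makes the choice harmless.\<close>

definition inverse_arrow :: "('o, 'm, 'z) cat_scheme \<Rightarrow> 'm \<Rightarrow> 'm" where
  "inverse_arrow A f = (SOME g. g \<in> Hom A (Cod A f) (Dom A f) \<and>
     g \<cdot>\<^bsub>A\<^esub> f = Idn A (Dom A f) \<and> f \<cdot>\<^bsub>A\<^esub> g = Idn A (Cod A f))"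

lemma (in category) inverse_arrow:
  assumes "f \<in> Hom A X Y" "isomorphism A f"
  shows "inverse_arrow A f \<in> Hom A Y X" "inverse_arrow A f \<cdot> f = Idn A X"
    "f \<cdot> inverse_arrow A f = Idn A Y"
proof -
  have "\<exists>g. g \<in> Hom A (Cod A f) (Dom A f) \<and>
      g \<cdot> f = Idn A (Dom A f) \<and> f \<cdot> g = Idn A (Cod A f)"
    using assms(2) by (auto simp: isomorphism_def)
  from someI_ex[OF this] show "inverse_arrow A f \<in> Hom A Y X" "inverse_arrow A f \<cdot> f = Idn A X"
    "f \<cdot> inverse_arrow A f = Idn A Y"
    unfolding inverse_arrow_def Hom_Dom[OF assms(1)] Hom_Cod[OF assms(1)] by auto
qed

section \<open>Zigzags and the localization relation\<close>

context category
begin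

lemma is_path_Ob: "is_path A W X es Y \<Longrightarrow> X \<in> Ob A \<and> Y \<in> Ob A"
proof (induction es arbitrary: X)
  case (Cons e es)
  then show ?case by (cases e) (auto simp: Dom_Ob Cod_Ob)
qed simp

lemma is_path_append: "is_path A W X (es @ fs) Z \<longleftrightarrow> (\<exists>Y. is_path A W X es Y \<and> is_path A W Y fs Z)"
proof (induction es arbitrary: X)
  case Nil
  then show ?case using is_path_Ob by auto
next
  case (Cons e es)
  then show ?case by (cases e) auto
qed

lemma path_cat_simps:
  "Ob (path_cat A W) = Ob A" "Dom (path_cat A W) (X, es, Y) = X" "Cod (path_cat A W) (X, es, Y) = Y"
  "Arr (path_cat A W) = {(X, es, Y). is_path A W X es Y}"
  "Idn (path_cat A W) X = (X, [], X)"
  "(Y', fs, Z) \<cdot>\<^bsub>path_cat A W\<^esub> (X, es, Y) = (X, es @ fs, Z)"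
  by (simp_all add: path_cat_def)

lemma path_HomI: "is_path A W X es Y \<Longrightarrow> (X, es, Y) \<in> Hom (path_cat A W) X Y"
  by (simp add: Hom_def path_cat_simps)

lemma path_HomE:
  assumes "p \<in> Hom (path_cat A W) X Y"
  obtains es where "p = (X, es, Y)" "is_path A W X es Y"
  using assms by (auto simp: Hom_def path_cat_simps)

lemma category_path: "category (path_cat A W)"
proof
  fix p assume "p \<in> Arr (path_cat A W)"
  then show "Dom (path_cat A W) p \<in> Ob (path_cat A W)" "Cod (path_cat A W) p \<in> Ob (path_cat A W)"
    using is_path_Ob by (auto simp: path_cat_simps)
next
  fix X assume "X \<in> Ob (path_cat A W)"
  then show "Idn (path_cat A W) X \<in> Hom (path_cat A W) X X"
    by (simp add: path_HomI path_cat_simps)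
next
  fix p q X Y Z assume "p \<in> Hom (path_cat A W) X Y" "q \<in> Hom (path_cat A W) Y Z"
  then show "q \<cdot>\<^bsub>path_cat A W\<^esub> p \<in> Hom (path_cat A W) X Z"
    by (elim path_HomE) (auto simp: path_cat_simps(6) is_path_append intro!: path_HomI)
qed (auto elim!: path_HomE simp: path_cat_simps)

text \<open>Each generator relates parallel well-formed zigzags and the closure rules keep the end
  points. So the inductive closure stays within the arrows of \<open>path_cat A W\<close> and
  relates parallel ones only.\<close>

lemma localization_rel_Hom:
  "(p, q) \<in> localization_rel A W \<Longrightarrow>
    p \<in> Hom (path_cat A W) (Dom (path_cat A W) p) (Cod (path_cat A W) p) \<and>
    q \<in> Hom (path_cat A W) (Dom (path_cat A W) p) (Cod (path_cat A W) p)"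
proof (induction rule: localization_rel.induct)
  case (Idn X)
  then show ?case using Idn_Hom[OF Idn]
    by (auto simp: path_cat_simps Hom_def)
next
  case (Comp f X Y g Z)
  then show ?case using Comp_Hom[OF Comp] Hom_Ob[OF Comp(2)]
    by (auto simp: path_cat_simps Hom_def)
next
  case (inv_left w X Y)
  then show ?case using Hom_Ob[OF inv_left(1)]
    by (auto simp: path_cat_simps Hom_def)
next
  case (inv_right w X Y)
  then show ?case using Hom_Ob[OF inv_right(1)]
    by (auto simp: path_cat_simps Hom_def)
next
  case (refl p)
  then show ?case by (auto simp: Hom_def)
next
  case (sym p q)
  then show ?case by (auto simp: Hom_def)
next
  case (trans p q r)
  then show ?case by (auto simp: Hom_def)
next
  case (cong p p' q q')
  interpret P: category "path_cat A W" by (rule category_path)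
  have "Dom (path_cat A W) (q \<cdot>\<^bsub>path_cat A W\<^esub> p) = Dom (path_cat A W) p"
    "Cod (path_cat A W) (q \<cdot>\<^bsub>path_cat A W\<^esub> p) = Cod (path_cat A W) q"
    using P.Comp_Hom[of p _ _ q] cong by (auto simp: Hom_def)
  then show ?case using cong P.Comp_Hom by metis
qed

lemma congruence_localization: "congruence (path_cat A W) (localization_rel A W)"
proof (intro congruence.intro congruence_axioms.intro category_path)
  have "localization_rel A W \<subseteq> Arr (path_cat A W) \<times> Arr (path_cat A W)"
    using localization_rel_Hom by (fastforce simp: Hom_def)
  then show "equiv (Arr (path_cat A W)) (localization_rel A W)"
    unfolding equiv_def refl_on_def sym_def trans_def
    using localization_rel.refl localization_rel.sym localization_rel.trans by blast
  fix p q assume "(p, q) \<in> localization_rel A W"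
  from localization_rel_Hom[OF this]
  show "Dom (path_cat A W) p = Dom (path_cat A W) q \<and> Cod (path_cat A W) p = Cod (path_cat A W) q"
    by (auto simp: Hom_def)
qed (rule localization_rel.cong)

end

section \<open>Functors out of the localization\<close>

fun path_map :: "('p, 'n, 'y) cat_scheme \<Rightarrow> ('m \<Rightarrow> 'n) \<Rightarrow> 'p \<Rightarrow> 'm edge list \<Rightarrow> 'n" where
  "path_map B Fa Y [] = Idn B Y"
| "path_map B Fa Y (Fwd f # es) = path_map B Fa Y es \<cdot>\<^bsub>B\<^esub> Fa f"
| "path_map B Fa Y (Bwd w # es) = path_map B Fa Y es \<cdot>\<^bsub>B\<^esub> inverse_arrow B (Fa w)"

text \<open>Existence half of the universal property: a functor inverting \<open>W\<close> extends
  to the localization. \<open>path_map\<close> evaluates a zigzag edge by edge; its object argument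
  is the image of the end point, which an empty list does not record.\<close>

locale inverting_functor = A: category A + B: category B
  for A :: "('o, 'm, 'z) cat_scheme" and B :: "('p, 'n, 'y) cat_scheme" +
  fixes Fo :: "'o \<Rightarrow> 'p" and Fa :: "'m \<Rightarrow> 'n" and W :: "'m set"
  assumes is_func: "is_functor A B Fo Fa"
    and inverts: "w \<in> Arr A \<Longrightarrow> w \<in> W \<Longrightarrow> isomorphism B (Fa w)"
begin

lemmas F_Ob = is_functorD(1)[OF is_func A.category_axioms]
  and F_Hom = is_functorD(2)[OF is_func A.category_axioms]
  and F_Idn = is_functorD(3)[OF is_func A.category_axioms]
  and F_Comp = is_functorD(4)[OF is_func A.category_axioms]

sublocale L: congruence "path_cat A W" "localization_rel A W" by (rule A.congruence_localization)

lemma F_inverse: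
  assumes "w \<in> Hom A X Y" "w \<in> W"
  shows "inverse_arrow B (Fa w) \<in> Hom B (Fo Y) (Fo X)"
    "inverse_arrow B (Fa w) \<cdot>\<^bsub>B\<^esub> Fa w = Idn B (Fo X)"
    "Fa w \<cdot>\<^bsub>B\<^esub> inverse_arrow B (Fa w) = Idn B (Fo Y)"
  using B.inverse_arrow[OF F_Hom[OF assms(1)] inverts[OF A.Hom_Arr[OF assms(1)] assms(2)]] by auto

lemma path_map_Hom: "is_path A W X es Y \<Longrightarrow> path_map B Fa (Fo Y) es \<in> Hom B (Fo X) (Fo Y)"
proof (induction es arbitrary: X)
  case Nil
  then show ?case by (auto simp: B.Idn_Hom F_Ob)
next
  case (Cons e es)
  show ?case
  proof (cases e)
    case (Fwd f)
    then have "f \<in> Hom A X (Cod A f)" "is_path A W (Cod A f) es Y"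
      using Cons.prems by (auto simp: Hom_def)
    then show ?thesis using B.Comp_Hom[OF F_Hom Cons.IH] by (simp add: Fwd)
  next
    case (Bwd w)
    then have "w \<in> Hom A (Dom A w) X" "w \<in> W" "is_path A W (Dom A w) es Y"
      using Cons.prems by (auto simp: Hom_def)
    then show ?thesis using B.Comp_Hom[OF F_inverse(1) Cons.IH] by (simp add: Bwd)
  qed
qed

lemma path_map_append:
  "is_path A W X es Y \<Longrightarrow> is_path A W Y fs Z \<Longrightarrow>
    path_map B Fa (Fo Z) (es @ fs) = path_map B Fa (Fo Z) fs \<cdot>\<^bsub>B\<^esub> path_map B Fa (Fo Y) es"
proof (induction es arbitrary: X)
  case Nil
  then show ?case using B.Comp_Idn_right[OF path_map_Hom[OF Nil(2)]] by simp
next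
  case (Cons e es)
  note fs = path_map_Hom[OF Cons.prems(2)]
  show ?case
  proof (cases e)
    case (Fwd f)
    then have f: "f \<in> Hom A X (Cod A f)" "is_path A W (Cod A f) es Y"
      using Cons.prems by (auto simp: Hom_def)
    show ?thesis
      using Cons.IH[OF f(2) Cons.prems(2)] B.Comp_assoc[OF F_Hom[OF f(1)] path_map_Hom[OF f(2)] fs]
      by (simp add: Fwd)
  next
    case (Bwd w)
    then have w: "w \<in> Hom A (Dom A w) X" "w \<in> W" "is_path A W (Dom A w) es Y"
      using Cons.prems by (auto simp: Hom_def)
    show ?thesis
      using Cons.IH[OF w(3) Cons.prems(2)]
        B.Comp_assoc[OF F_inverse(1)[OF w(1,2)] path_map_Hom[OF w(3)] fs] by (simp add: Bwd)
  qed
qed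

definition path_value :: "('o, 'm) path \<Rightarrow> 'n" where
  "path_value = (\<lambda>(X, es, Y). path_map B Fa (Fo Y) es)"

text \<open>The generators become functoriality and the two inverse laws in \<open>B\<close>, and
  \<open>cong\<close> reduces to \<open>path_map_append\<close>.\<close>

lemma path_value_rel: "(p, q) \<in> localization_rel A W \<Longrightarrow> path_value p = path_value q"
proof (induction rule: localization_rel.induct)
  case (Idn X)
  then show ?case
    using B.Comp_Idn_left[OF B.Idn_Hom[OF F_Ob]] F_Idn by (simp add: path_value_def)
next
  case (Comp f X Y g Z)
  have "Z \<in> Ob A" using A.Hom_Ob Comp by blast
  then show ?case
    using F_Comp[OF Comp] B.Comp_Idn_left[OF F_Hom[OF Comp(2)]]
      B.Comp_Idn_left[OF F_Hom[OF A.Comp_Hom[OF Comp]]] by (simp add: path_value_def)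
next
  case (inv_left w X Y)
  then show ?case
    using F_inverse[OF inv_left] B.Comp_Idn_left[OF F_inverse(1)[OF inv_left]]
    by (simp add: path_value_def)
next
  case (inv_right w X Y)
  then show ?case
    using F_inverse[OF inv_right] B.Comp_Idn_left[OF F_Hom[OF inv_right(1)]]
    by (simp add: path_value_def)
next
  case (cong p p' q q')
  obtain X es Y where p: "p = (X, es, Y)" by (cases p)
  obtain Y1 fs Z where q: "q = (Y1, fs, Z)" by (cases q)
  obtain X' es' Y' where p': "p' = (X', es', Y')" by (cases p')
  obtain Y1' fs' Z' where q': "q' = (Y1', fs', Z')" by (cases q')
  have "is_path A W X es Y" "is_path A W X es' Y" "X' = X" "Y' = Y"
    using A.localization_rel_Hom[OF cong.hyps(1)] by (auto simp: p p' Hom_def A.path_cat_simps)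
  moreover have "is_path A W Y fs Z" "is_path A W Y fs' Z" "Y1 = Y" "Y1' = Y" "Z' = Z"
    using A.localization_rel_Hom[OF cong.hyps(2)] cong.hyps(3) by (auto simp: p q q' Hom_def A.path_cat_simps)
  ultimately show ?case
    using cong.IH by (simp add: p q p' q' A.path_cat_simps path_value_def path_map_append)
qed simp_all

text \<open>The representative is immaterial because \<open>path_value\<close> is constant on
  classes.\<close>

definition extension :: "('o, 'm) path set \<Rightarrow> 'n" where
  "extension K = path_value (SOME p. p \<in> K)"

abbreviation cls where "cls p \<equiv> localization_rel A W `` {p}"

lemma extension_class:
  assumes "is_path A W X es Y"
  shows "extension (cls (X, es, Y)) = path_map B Fa (Fo Y) es"
proof -
  have "((X, es, Y), SOME p. p \<in> cls (X, es, Y)) \<in> localization_rel A W"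
    using someI[of "\<lambda>p. p \<in> cls (X, es, Y)" "(X, es, Y)"]
      L.rel_refl[OF L.Hom_Arr[OF A.path_HomI[OF assms]]] by simp
  from path_value_rel[OF this] show ?thesis by (simp add: extension_def path_value_def)
qed

abbreviation LA where "LA \<equiv> localization A W"

lemma LA_Ob: "Ob LA = Ob A"
  using L.Ob_quotient by (simp add: localization_def A.path_cat_simps)

lemma LA_HomE:
  assumes "K \<in> Hom LA X Y"
  obtains es where "is_path A W X es Y" "K = cls (X, es, Y)"
  using assms unfolding localization_def by (blast elim: L.HomE A.path_HomE)

lemma cls_Hom: "is_path A W X es Y \<Longrightarrow> cls (X, es, Y) \<in> Hom LA X Y"
  unfolding localization_def by (rule L.class_Hom[OF A.path_HomI])

lemma cls_Comp:
  "is_path A W X es Y \<Longrightarrow> is_path A W Y fs Z \<Longrightarrow>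
    cls (Y, fs, Z) \<cdot>\<^bsub>LA\<^esub> cls (X, es, Y) = cls (X, es @ fs, Z)"
  using L.class_Comp[OF A.path_HomI A.path_HomI] by (simp add: localization_def A.path_cat_simps)

lemma category_LA: "category LA"
  unfolding localization_def by (rule L.category_quotient)

lemma functor_extension: "is_functor LA B Fo extension"
proof (rule category.is_functorI[OF category_LA])
  show "X \<in> Ob LA \<Longrightarrow> Fo X \<in> Ob B" for X by (simp add: LA_Ob F_Ob)
  show "K \<in> Hom LA X Y \<Longrightarrow> extension K \<in> Hom B (Fo X) (Fo Y)" for K X Y
    by (elim LA_HomE) (simp add: extension_class path_map_Hom)
  show "X \<in> Ob LA \<Longrightarrow> extension (Idn LA X) = Idn B (Fo X)" for X
    using extension_class[of X "[]" X] L.class_Idn[of X] LA_Ob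
    by (simp add: localization_def A.path_cat_simps)
  fix K L X Y Z assume "K \<in> Hom LA X Y" "L \<in> Hom LA Y Z"
  then obtain es fs where es: "is_path A W X es Y" "K = cls (X, es, Y)"
    and fs: "is_path A W Y fs Z" "L = cls (Y, fs, Z)" by (blast elim: LA_HomE)
  then show "extension (L \<cdot>\<^bsub>LA\<^esub> K) = extension L \<cdot>\<^bsub>B\<^esub> extension K"
    using A.is_path_append[of W X es fs Z]
    by (auto simp: cls_Comp extension_class path_map_append)
qed

lemma localization_map_Hom: "f \<in> Hom A X Y \<Longrightarrow> localization_map A W f \<in> Hom LA X Y"
  using cls_Hom[of X "[Fwd f]" Y] A.Hom_Ob[of f X Y] by (auto simp: localization_map_def Hom_def[of A])

lemma functor_localization: "is_functor A LA (\<lambda>X. X) (localization_map A W)"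
proof (rule A.is_functorI)
  show "X \<in> Ob A \<Longrightarrow> X \<in> Ob LA" for X by (simp add: LA_Ob)
  show "X \<in> Ob A \<Longrightarrow> localization_map A W (Idn A X) = Idn LA X" for X
    using L.class_Idn[of X] A.Idn_Hom[of X] equiv_class_eq[OF L.equiv localization_rel.Idn]
    by (simp add: localization_def localization_map_def Hom_def A.path_cat_simps)
  fix f g X Y Z assume fg: "f \<in> Hom A X Y" "g \<in> Hom A Y Z"
  have paths: "is_path A W X [Fwd f] Y" "is_path A W Y [Fwd g] Z"
    using fg A.Hom_Ob[OF fg(1)] A.Hom_Ob[OF fg(2)] by (auto simp: Hom_def)
  then show "localization_map A W (g \<cdot>\<^bsub>A\<^esub> f) = localization_map A W g \<cdot>\<^bsub>LA\<^esub> localization_map A W f"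
    using fg A.Comp_Hom[OF fg] cls_Comp[OF paths]
      equiv_class_eq[OF L.equiv localization_rel.Comp[OF fg]]
    by (simp add: localization_map_def Hom_def)
qed (rule localization_map_Hom)

lemma extension_localization_map: "f \<in> Hom A X Y \<Longrightarrow> extension (localization_map A W f) = Fa f"
  using extension_class[of X "[Fwd f]" Y] A.Hom_Ob[of f X Y] B.Comp_Idn_left[OF F_Hom]
  by (auto simp: localization_map_def Hom_def[of A])

lemma localization_map_iso:
  assumes "w \<in> Hom A X Y" "w \<in> W"
  shows "isomorphism LA (localization_map A W w)"
proof -
  interpret LA: category LA by (rule category_LA)
  have p: "is_path A W X [Fwd w] Y" "is_path A W Y [Bwd w] X"
    using assms A.Hom_Ob[OF assms(1)] by (auto simp: Hom_def)
  have "cls (Y, [Bwd w], X) \<cdot>\<^bsub>LA\<^esub> cls (X, [Fwd w], Y) = Idn LA X"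
    "cls (X, [Fwd w], Y) \<cdot>\<^bsub>LA\<^esub> cls (Y, [Bwd w], X) = Idn LA Y"
    using cls_Comp[OF p] cls_Comp[OF p(2,1)] L.class_Idn
      equiv_class_eq[OF L.equiv localization_rel.inv_left[OF assms]]
      equiv_class_eq[OF L.equiv localization_rel.inv_right[OF assms]]
    by (simp_all add: localization_def A.path_cat_simps)
  then show ?thesis
    using LA.isomorphismI[OF cls_Hom[OF p(1)] cls_Hom[OF p(2)]] assms(1)
    by (simp add: localization_map_def Hom_def)
qed

text \<open>Detaches the first edge of a zigzag. For a backward edge the equation is composed with
  the image of \<open>w\<close>, so that no inverse has to be named.\<close>

lemma localization_edge:
  shows "f \<in> Hom A X Z \<Longrightarrow> is_path A W Z es Y \<Longrightarrow>
      cls (X, Fwd f # es, Y) = cls (Z, es, Y) \<cdot>\<^bsub>LA\<^esub> localization_map A W f"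
    and "w \<in> Hom A Z X \<Longrightarrow> w \<in> W \<Longrightarrow> is_path A W Z es Y \<Longrightarrow>
      cls (X, Bwd w # es, Y) \<cdot>\<^bsub>LA\<^esub> localization_map A W w = cls (Z, es, Y)"
proof -
  assume f: "f \<in> Hom A X Z" "is_path A W Z es Y"
  then have p: "is_path A W X [Fwd f] Z" using A.Hom_Ob[OF f(1)] by (auto simp: Hom_def)
  show "cls (X, Fwd f # es, Y) = cls (Z, es, Y) \<cdot>\<^bsub>LA\<^esub> localization_map A W f"
    using cls_Comp[OF p f(2)] f(1) by (simp add: localization_map_def Hom_def)
next
  interpret LA: category LA by (rule category_LA)
  assume w: "w \<in> Hom A Z X" "w \<in> W" "is_path A W Z es Y"
  then have p: "is_path A W Z [Fwd w] X" "is_path A W X [Bwd w] Z"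
    using A.Hom_Ob[OF w(1)] by (auto simp: Hom_def)
  have b: "cls (X, [Bwd w], Z) \<cdot>\<^bsub>LA\<^esub> cls (Z, [Fwd w], X) = Idn LA Z"
    using cls_Comp[OF p] L.class_Idn equiv_class_eq[OF L.equiv localization_rel.inv_left[OF w(1,2)]]
    by (simp add: localization_def A.path_cat_simps)
  have "cls (X, Bwd w # es, Y) = cls (Z, es, Y) \<cdot>\<^bsub>LA\<^esub> cls (X, [Bwd w], Z)"
    using cls_Comp[OF p(2) w(3)] by simp
  then show "cls (X, Bwd w # es, Y) \<cdot>\<^bsub>LA\<^esub> localization_map A W w = cls (Z, es, Y)"
    using LA.Comp_assoc[OF cls_Hom[OF p(1)] cls_Hom[OF p(2)] cls_Hom[OF w(3)]] b
      LA.Comp_Idn_right[OF cls_Hom[OF w(3)]] w(1) by (simp add: localization_map_def Hom_def)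
qed

end

section \<open>Transport of additive structure\<close>

text \<open>A fully faithful and dense functor from a bare category to an additive one. It is meant
  for the localization, whose arrows come without an addition.\<close>

locale equivalence_to_additive = H: category H + B: additive_category B
  for H :: "('o, 'm) cat" and B :: "('p, 'n, 'y) acat_scheme" +
  fixes Fo :: "'o \<Rightarrow> 'p" and Fa :: "'m \<Rightarrow> 'n"
  assumes is_func: "is_functor H B Fo Fa"
    and bij: "\<lbrakk>X \<in> Ob H; Y \<in> Ob H\<rbrakk> \<Longrightarrow> bij_betw Fa (Hom H X Y) (Hom B (Fo X) (Fo Y))"
    and dense: "P \<in> Ob B \<Longrightarrow> \<exists>X \<in> Ob H. \<exists>e \<in> Hom B (Fo X) P. isomorphism B e"
begin

lemmas F_Ob = is_functorD(1)[OF is_func H.category_axioms]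
  and F_Hom = is_functorD(2)[OF is_func H.category_axioms]
  and F_Idn = is_functorD(3)[OF is_func H.category_axioms]
  and F_Comp = is_functorD(4)[OF is_func H.category_axioms]

definition lift :: "'o \<Rightarrow> 'o \<Rightarrow> 'n \<Rightarrow> 'm" where
  "lift X Y = the_inv_into (Hom H X Y) Fa"

lemma
  assumes "X \<in> Ob H" "Y \<in> Ob H" "m \<in> Hom B (Fo X) (Fo Y)"
  shows lift_Hom: "lift X Y m \<in> Hom H X Y" and F_lift: "Fa (lift X Y m) = m"
proof -
  have b: "bij_betw Fa (Hom H X Y) (Hom B (Fo X) (Fo Y))" using bij assms by blast
  then have "inj_on Fa (Hom H X Y)" and m: "m \<in> Fa ` Hom H X Y"
    using assms(3) by (auto simp: bij_betw_def)
  then show "lift X Y m \<in> Hom H X Y" "Fa (lift X Y m) = m"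
    unfolding lift_def by (auto intro: the_inv_into_into f_the_inv_into_f)
qed

lemma F_inj:
  assumes "f \<in> Hom H X Y" "g \<in> Hom H X Y" "Fa f = Fa g"
  shows "f = g"
  using bij[of X Y] H.Hom_Ob[OF assms(1)] assms unfolding bij_betw_def inj_on_def by blast

text \<open>The inverse of the image has a preimage by fullness; faithfulness returns the two
  inverse laws.\<close>

lemma isomorphism_reflect:
  assumes "f \<in> Hom H X Y" "isomorphism B (Fa f)"
  shows "isomorphism H f"
proof -
  obtain g where g: "g \<in> Hom B (Fo Y) (Fo X)" "g \<cdot>\<^bsub>B\<^esub> Fa f = Idn B (Fo X)"
    "Fa f \<cdot>\<^bsub>B\<^esub> g = Idn B (Fo Y)"
    using assms(2) F_Hom[OF assms(1)] by (rule B.isomorphismE)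
  have XY: "X \<in> Ob H" "Y \<in> Ob H" using H.Hom_Ob[OF assms(1)] by auto
  note l = lift_Hom[OF XY(2,1) g(1)] and Fl = F_lift[OF XY(2,1) g(1)]
  show ?thesis
    using F_inj[OF H.Comp_Hom[OF assms(1) l] H.Idn_Hom] F_inj[OF H.Comp_Hom[OF l assms(1)] H.Idn_Hom]
      F_Comp[OF assms(1) l] F_Comp[OF l assms(1)] F_Idn XY g Fl
    by (intro H.isomorphismI[OF assms(1) l]) simp_all
qed

text \<open>Extends the record \<open>H\<close> itself, so that forgetting the addition gives back
  \<open>H\<close> on the nose. Sums and zeros are preimages under the bijections \<open>Fa\<close>;
  the end points of \<open>f\<close> select the Hom-set, because an addition receives only two
  arrows.\<close>

definition T :: "('o, 'm) acat" where
  "T = cat.extend H (acat.fields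
     (\<lambda>f g. lift (Dom H f) (Cod H f) (Fa f \<boxplus>\<^bsub>B\<^esub> Fa g))
     (\<lambda>X Y. lift X Y (Zero B (Fo X) (Fo Y))))"

lemma T_simps: "Ob T = Ob H" "Arr T = Arr H" "Dom T = Dom H" "Cod T = Cod H" "Idn T = Idn H"
    "Comp T = Comp H" "Hom T = Hom H" "Zero T X Y = lift X Y (Zero B (Fo X) (Fo Y))"
    "f \<boxplus>\<^bsub>T\<^esub> g = lift (Dom H f) (Cod H f) (Fa f \<boxplus>\<^bsub>B\<^esub> Fa g)"
  by (simp_all add: T_def cat.extend_def acat.fields_def Hom_def fun_eq_iff)

lemma truncate_T: "cat.truncate T = H"
  by (simp add: T_def cat.extend_def cat.truncate_def)

text \<open>By construction \<open>Fa\<close> preserves sums. With \<open>F_inj\<close>, each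
  additive law in \<open>T\<close> reduces to the same law in \<open>B\<close>.\<close>

lemma
  assumes "f \<in> Hom H X Y" "g \<in> Hom H X Y"
  shows T_Add_Hom: "f \<boxplus>\<^bsub>T\<^esub> g \<in> Hom H X Y" and F_Add: "Fa (f \<boxplus>\<^bsub>T\<^esub> g) = Fa f \<boxplus>\<^bsub>B\<^esub> Fa g"
  using lift_Hom[of X Y "Fa f \<boxplus>\<^bsub>B\<^esub> Fa g"] F_lift[of X Y "Fa f \<boxplus>\<^bsub>B\<^esub> Fa g"] H.Hom_Ob[OF assms(1)]
    B.Add_closed[OF F_Hom[OF assms(1)] F_Hom[OF assms(2)]]
    H.Hom_Dom[OF assms(1)] H.Hom_Cod[OF assms(1)] by (simp_all add: T_simps)

lemma
  assumes "X \<in> Ob H" "Y \<in> Ob H"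
  shows T_Zero_Hom: "Zero T X Y \<in> Hom H X Y" and F_Zero: "Fa (Zero T X Y) = Zero B (Fo X) (Fo Y)"
  using lift_Hom[OF assms B.Zero_Hom] F_lift[OF assms B.Zero_Hom] F_Ob assms
  by (simp_all add: T_simps)

lemma category_T: "category T"
  by (rule category_cong[OF H.category_axioms]) (simp_all add: T_simps)

lemma T_Add_assoc:
  assumes "f \<in> Hom H X Y" "g \<in> Hom H X Y" "h \<in> Hom H X Y"
  shows "f \<boxplus>\<^bsub>T\<^esub> g \<boxplus>\<^bsub>T\<^esub> h = f \<boxplus>\<^bsub>T\<^esub> (g \<boxplus>\<^bsub>T\<^esub> h)"
proof (rule F_inj[OF T_Add_Hom[OF T_Add_Hom] T_Add_Hom[OF _ T_Add_Hom]])
  show "Fa (f \<boxplus>\<^bsub>T\<^esub> g \<boxplus>\<^bsub>T\<^esub> h) = Fa (f \<boxplus>\<^bsub>T\<^esub> (g \<boxplus>\<^bsub>T\<^esub> h))"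
    using F_Add[OF T_Add_Hom[OF assms(1,2)] assms(3)] F_Add[OF assms(1,2)] F_Add[OF assms(2,3)]
      F_Add[OF assms(1) T_Add_Hom[OF assms(2,3)]]
      B.Add_assoc[OF F_Hom[OF assms(1)] F_Hom[OF assms(2)] F_Hom[OF assms(3)]] by simp
qed (fact assms)+

lemma comm_group_T:
  assumes "X \<in> Ob H" "Y \<in> Ob H"
  shows "comm_group (hom_group T X Y)"
proof (rule comm_groupI; unfold hom_group_simps T_simps(7))
  fix f g assume fg: "f \<in> Hom H X Y" "g \<in> Hom H X Y"
  then show "f \<boxplus>\<^bsub>T\<^esub> g \<in> Hom H X Y" by (rule T_Add_Hom)
  show "f \<boxplus>\<^bsub>T\<^esub> g = g \<boxplus>\<^bsub>T\<^esub> f"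
    using F_inj[OF T_Add_Hom[OF fg] T_Add_Hom[OF fg(2,1)]] F_Add[OF fg] F_Add[OF fg(2,1)]
      B.Add_commute[OF F_Hom[OF fg(1)] F_Hom[OF fg(2)]] by simp
next
  show "Zero T X Y \<in> Hom H X Y" using assms by (rule T_Zero_Hom)
next
  fix f assume f: "f \<in> Hom H X Y"
  note z = T_Zero_Hom[OF assms]
  show "Zero T X Y \<boxplus>\<^bsub>T\<^esub> f = f"
    using F_inj[OF T_Add_Hom[OF z f] f] F_Add[OF z f] F_Zero[OF assms] B.Add_Zero_left[OF F_Hom[OF f]]
    by simp
  obtain g where g: "g \<in> Hom B (Fo X) (Fo Y)" "g \<boxplus>\<^bsub>B\<^esub> Fa f = Zero B (Fo X) (Fo Y)"
    using B.ex_neg[OF _ _ F_Hom[OF f]] F_Ob assms by blast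
  note l = lift_Hom[OF assms g(1)]
  have "lift X Y g \<boxplus>\<^bsub>T\<^esub> f = Zero T X Y"
    using F_inj[OF T_Add_Hom[OF l f] z] F_Add[OF l f] F_Zero[OF assms] F_lift[OF assms g(1)] g(2)
    by simp
  then show "\<exists>g \<in> Hom H X Y. g \<boxplus>\<^bsub>T\<^esub> f = Zero T X Y" using l by blast
qed (rule T_Add_assoc)

text \<open>By density some \<open>Fo Z\<close> is isomorphic to \<open>0\<close>. Its identity
  factors through \<open>0\<close> and vanishes, and faithfulness makes the Hom-sets at
  \<open>Z\<close> singletons.\<close>

lemma ex_zero_T: "\<exists>Z. zero_object T Z"
proof -
  obtain Z e where Z: "Z \<in> Ob H" and e: "e \<in> Hom B (Fo Z) (zero_ob B)" "isomorphism B e"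
    using dense[OF B.zero_ob_Ob] by blast
  obtain e' where e': "e' \<in> Hom B (zero_ob B) (Fo Z)" "e' \<cdot>\<^bsub>B\<^esub> e = Idn B (Fo Z)"
    using e(2,1) by (rule B.isomorphismE)
  have "Idn B (Fo Z) = Zero B (Fo Z) (Fo Z)"
    using e'(2) B.from_zero_ob[OF e'(1)] B.Comp_Zero_left[OF e(1) F_Ob[OF Z]] by simp
  then have FZ: "zero_object B (Fo Z)" using B.zero_objectI F_Ob[OF Z] by blast
  have "f = g" if "f \<in> Hom H Z X \<and> g \<in> Hom H Z X \<or> f \<in> Hom H X Z \<and> g \<in> Hom H X Z" for f g X
    using that FZ F_inj F_Hom F_Ob H.Hom_Ob unfolding zero_object_def by metis
  then have "zero_object T Z"
    unfolding zero_object_def T_simps using Z T_Zero_Hom by blast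
  then show ?thesis ..
qed

text \<open>The biproduct \<open>P\<close> of the images need not be a value of \<open>Fo\<close>.
  Its injections and projections are composed with an isomorphism \<open>e : Fo S -> P\<close> or
  its inverse and then lifted.\<close>

lemma ex_biproduct_T:
  assumes "X \<in> Ob H" "Y \<in> Ob H"
  shows "\<exists>S. biproduct T X Y S"
proof -
  obtain P where "biproduct B (Fo X) (Fo Y) P"
    using B.ex_biproduct F_Ob assms by blast
  then have P: "P \<in> Ob B" by (simp add: biproduct_def)
  obtain i j p q where b: "i \<in> Hom B (Fo X) P" "j \<in> Hom B (Fo Y) P" "p \<in> Hom B P (Fo X)"
    "q \<in> Hom B P (Fo Y)" "p \<cdot>\<^bsub>B\<^esub> i = Idn B (Fo X)" "q \<cdot>\<^bsub>B\<^esub> j = Idn B (Fo Y)"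
    "p \<cdot>\<^bsub>B\<^esub> j = Zero B (Fo Y) (Fo X)" "q \<cdot>\<^bsub>B\<^esub> i = Zero B (Fo X) (Fo Y)"
    "(i \<cdot>\<^bsub>B\<^esub> p) \<boxplus>\<^bsub>B\<^esub> (j \<cdot>\<^bsub>B\<^esub> q) = Idn B P"
    using \<open>biproduct B (Fo X) (Fo Y) P\<close> by (rule B.biproductE)
  obtain S e where S: "S \<in> Ob H" and e: "e \<in> Hom B (Fo S) P" "isomorphism B e" using dense P by blast
  obtain e' where e': "e' \<in> Hom B P (Fo S)" "e' \<cdot>\<^bsub>B\<^esub> e = Idn B (Fo S)" "e \<cdot>\<^bsub>B\<^esub> e' = Idn B P"
    using e(2,1) by (rule B.isomorphismE)
  note i' = B.Comp_Hom[OF b(1) e'(1)] and j' = B.Comp_Hom[OF b(2) e'(1)]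
    and p' = B.Comp_Hom[OF e(1) b(3)] and q' = B.Comp_Hom[OF e(1) b(4)]
  note I = lift_Hom[OF assms(1) S i'] F_lift[OF assms(1) S i']
    and J = lift_Hom[OF assms(2) S j'] F_lift[OF assms(2) S j']
    and P = lift_Hom[OF S assms(1) p'] F_lift[OF S assms(1) p']
    and Q = lift_Hom[OF S assms(2) q'] F_lift[OF S assms(2) q']
  \<comment> \<open>\<open>e\<close> and its inverse cancel between a projection and an injection,
    but stay outside in the sum of the two idempotents; hence two bracketing rules.\<close>
  have cancel: "(g \<cdot>\<^bsub>B\<^esub> e) \<cdot>\<^bsub>B\<^esub> (e' \<cdot>\<^bsub>B\<^esub> f) = g \<cdot>\<^bsub>B\<^esub> f"
    if "f \<in> Hom B M P" "g \<in> Hom B P N" for f g M N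
    using B.Comp_assoc[OF B.Comp_Hom[OF that(1) e'(1)] e(1) that(2)] B.Comp_assoc[OF that(1) e'(1) e(1)]
      e'(3) B.Comp_Idn_left[OF that(1)] by simp
  have sandwich: "(e' \<cdot>\<^bsub>B\<^esub> f) \<cdot>\<^bsub>B\<^esub> (g \<cdot>\<^bsub>B\<^esub> e) = e' \<cdot>\<^bsub>B\<^esub> ((f \<cdot>\<^bsub>B\<^esub> g) \<cdot>\<^bsub>B\<^esub> e)"
    if "f \<in> Hom B M P" "g \<in> Hom B P M" for f g M
    using B.Comp_assoc[OF B.Comp_Hom[OF e(1) that(2)] that(1) e'(1)] B.Comp_assoc[OF e(1) that(2,1)]
    by simp
  note ip = B.Comp_Hom[OF b(3,1)] and jq = B.Comp_Hom[OF b(4,2)]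
  note ipe = B.Comp_Hom[OF e(1) ip] and jqe = B.Comp_Hom[OF e(1) jq]
  have sum: "(e' \<cdot>\<^bsub>B\<^esub> ((i \<cdot>\<^bsub>B\<^esub> p) \<cdot>\<^bsub>B\<^esub> e)) \<boxplus>\<^bsub>B\<^esub> (e' \<cdot>\<^bsub>B\<^esub> ((j \<cdot>\<^bsub>B\<^esub> q) \<cdot>\<^bsub>B\<^esub> e)) = Idn B (Fo S)"
    using B.Comp_Add_right[OF ipe jqe e'(1)] B.Comp_Add_left[OF e(1) ip jq] b(9)
      B.Comp_Idn_left[OF e(1)] e'(2) by simp
  let ?i = "lift X S (e' \<cdot>\<^bsub>B\<^esub> i)" and ?j = "lift Y S (e' \<cdot>\<^bsub>B\<^esub> j)"
    and ?p = "lift S X (p \<cdot>\<^bsub>B\<^esub> e)" and ?q = "lift S Y (q \<cdot>\<^bsub>B\<^esub> e)"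
  have "?p \<cdot>\<^bsub>H\<^esub> ?i = Idn H X" "?q \<cdot>\<^bsub>H\<^esub> ?j = Idn H Y"
    using F_inj[OF H.Comp_Hom[OF I(1) P(1)] H.Idn_Hom[OF assms(1)]]
      F_inj[OF H.Comp_Hom[OF J(1) Q(1)] H.Idn_Hom[OF assms(2)]]
      F_Comp[OF I(1) P(1)] F_Comp[OF J(1) Q(1)] I(2) J(2) P(2) Q(2) cancel[OF b(1,3)] cancel[OF b(2,4)]
      b(5,6) F_Idn assms by simp_all
  moreover have "?p \<cdot>\<^bsub>H\<^esub> ?j = Zero T Y X" "?q \<cdot>\<^bsub>H\<^esub> ?i = Zero T X Y"
    using F_inj[OF H.Comp_Hom[OF J(1) P(1)] T_Zero_Hom] F_inj[OF H.Comp_Hom[OF I(1) Q(1)] T_Zero_Hom]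
      F_Comp[OF J(1) P(1)] F_Comp[OF I(1) Q(1)] I(2) J(2) P(2) Q(2) cancel[OF b(2,3)] cancel[OF b(1,4)]
      b(7,8) F_Zero assms by simp_all
  moreover have "(?i \<cdot>\<^bsub>H\<^esub> ?p) \<boxplus>\<^bsub>T\<^esub> (?j \<cdot>\<^bsub>H\<^esub> ?q) = Idn H S"
    using F_inj[OF T_Add_Hom[OF H.Comp_Hom[OF P(1) I(1)] H.Comp_Hom[OF Q(1) J(1)]] H.Idn_Hom[OF S]]
      F_Add[OF H.Comp_Hom[OF P(1) I(1)] H.Comp_Hom[OF Q(1) J(1)]] F_Comp[OF P(1) I(1)]
      F_Comp[OF Q(1) J(1)] I(2) J(2) P(2) Q(2) sandwich[OF b(1,3)] sandwich[OF b(2,4)] sum F_Idn[OF S]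
    by simp
  ultimately show ?thesis
    unfolding biproduct_def T_simps(1,5-7) using S I(1) J(1) P(1) Q(1)
    by (intro exI[of _ S] conjI bexI[of _ ?i] bexI[of _ ?j] bexI[of _ ?p] bexI[of _ ?q])
qed

lemma additive_category_T: "additive_category T"
proof (intro additive_category.intro additive_category_axioms.intro category_T ex_zero_T)
  fix X Y assume "X \<in> Ob T" "Y \<in> Ob T"
  then show "comm_group (hom_group T X Y)" "\<exists>S. biproduct T X Y S"
    by (simp_all add: T_simps(1) comm_group_T ex_biproduct_T)
next
  fix f f' g X Y Z assume "f \<in> Hom T X Y" "f' \<in> Hom T X Y" "g \<in> Hom T Y Z"
  then have a: "f \<in> Hom H X Y" "f' \<in> Hom H X Y" "g \<in> Hom H Y Z" by (simp_all add: T_simps(7))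
  note c = H.Comp_Hom[OF a(1,3)] H.Comp_Hom[OF a(2,3)]
  show "g \<cdot>\<^bsub>T\<^esub> (f \<boxplus>\<^bsub>T\<^esub> f') = g \<cdot>\<^bsub>T\<^esub> f \<boxplus>\<^bsub>T\<^esub> g \<cdot>\<^bsub>T\<^esub> f'"
    using F_inj[OF H.Comp_Hom[OF T_Add_Hom[OF a(1,2)] a(3)] T_Add_Hom[OF c]]
      F_Comp[OF T_Add_Hom[OF a(1,2)] a(3)] F_Add[OF a(1,2)] F_Add[OF c] F_Comp[OF a(1,3)]
      F_Comp[OF a(2,3)] B.Comp_Add_right[OF F_Hom[OF a(1)] F_Hom[OF a(2)] F_Hom[OF a(3)]]
    by (simp add: T_simps(6))
next
  fix f g g' X Y Z assume "f \<in> Hom T X Y" "g \<in> Hom T Y Z" "g' \<in> Hom T Y Z"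
  then have a: "f \<in> Hom H X Y" "g \<in> Hom H Y Z" "g' \<in> Hom H Y Z" by (simp_all add: T_simps(7))
  note c = H.Comp_Hom[OF a(1,2)] H.Comp_Hom[OF a(1,3)]
  show "(g \<boxplus>\<^bsub>T\<^esub> g') \<cdot>\<^bsub>T\<^esub> f = g \<cdot>\<^bsub>T\<^esub> f \<boxplus>\<^bsub>T\<^esub> g' \<cdot>\<^bsub>T\<^esub> f"
    using F_inj[OF H.Comp_Hom[OF a(1) T_Add_Hom[OF a(2,3)]] T_Add_Hom[OF c]]
      F_Comp[OF a(1) T_Add_Hom[OF a(2,3)]] F_Add[OF a(2,3)] F_Add[OF c] F_Comp[OF a(1,2)]
      F_Comp[OF a(1,3)] B.Comp_Add_left[OF F_Hom[OF a(1)] F_Hom[OF a(2)] F_Hom[OF a(3)]]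
    by (simp add: T_simps(6))
qed

lemma additive_functor_F: "additive_functor T B Fo Fa"
proof -
  have "is_functor T B Fo Fa"
    using is_func unfolding is_functor_def T_simps by simp
  then show ?thesis
    unfolding additive_functor_def T_simps(2-4) using F_Add[OF H.Arr_Hom] H.Arr_Hom by fastforce
qed

section \<open>A quasi-inverse and the two natural isomorphisms\<close>

definition Go :: "'p \<Rightarrow> 'o" where
  "Go P = (SOME X. X \<in> Ob H \<and> (\<exists>e \<in> Hom B (Fo X) P. isomorphism B e))"

definition counit :: "'p \<Rightarrow> 'n" where
  "counit P = (SOME e. e \<in> Hom B (Fo (Go P)) P \<and> isomorphism B e)"

definition counit_inv :: "'p \<Rightarrow> 'n" where
  "counit_inv P = inverse_arrow B (counit P)"

text \<open>The unique arrow that makes \<open>counit\<close> natural: \<open>m\<close> conjugated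
  by \<open>counit\<close>, then pulled back along \<open>Fa\<close>.\<close>

definition Ga :: "'n \<Rightarrow> 'm" where
  "Ga m = lift (Go (Dom B m)) (Go (Cod B m)) (counit_inv (Cod B m) \<cdot>\<^bsub>B\<^esub> (m \<cdot>\<^bsub>B\<^esub> counit (Dom B m)))"

lemma
  assumes "P \<in> Ob B"
  shows Go_Ob: "Go P \<in> Ob H" and counit_Hom: "counit P \<in> Hom B (Fo (Go P)) P"
    and counit_iso: "isomorphism B (counit P)"
    and counit_inv: "counit_inv P \<in> Hom B P (Fo (Go P))"
      "counit_inv P \<cdot>\<^bsub>B\<^esub> counit P = Idn B (Fo (Go P))" "counit P \<cdot>\<^bsub>B\<^esub> counit_inv P = Idn B P"
proof -
  have "\<exists>X. X \<in> Ob H \<and> (\<exists>e \<in> Hom B (Fo X) P. isomorphism B e)" using dense assms by blast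
  from someI_ex[OF this, folded Go_def]
  have g: "Go P \<in> Ob H" "\<exists>e. e \<in> Hom B (Fo (Go P)) P \<and> isomorphism B e" by blast+
  then show "Go P \<in> Ob H" by blast
  show c: "counit P \<in> Hom B (Fo (Go P)) P" "isomorphism B (counit P)"
    using someI_ex[OF g(2), folded counit_def] by blast+
  show "counit_inv P \<in> Hom B P (Fo (Go P))" "counit_inv P \<cdot>\<^bsub>B\<^esub> counit P = Idn B (Fo (Go P))"
    "counit P \<cdot>\<^bsub>B\<^esub> counit_inv P = Idn B P"
    unfolding counit_inv_def using B.inverse_arrow[OF c] by blast+
qed

lemma
  assumes "m \<in> Hom B P Q"
  shows Ga_Hom: "Ga m \<in> Hom H (Go P) (Go Q)"
    and F_Ga: "Fa (Ga m) = counit_inv Q \<cdot>\<^bsub>B\<^esub> (m \<cdot>\<^bsub>B\<^esub> counit P)"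
proof -
  have PQ: "P \<in> Ob B" "Q \<in> Ob B" using B.Hom_Ob[OF assms] by auto
  have h: "counit_inv Q \<cdot>\<^bsub>B\<^esub> (m \<cdot>\<^bsub>B\<^esub> counit P) \<in> Hom B (Fo (Go P)) (Fo (Go Q))"
    using B.Comp_Hom[OF B.Comp_Hom[OF counit_Hom[OF PQ(1)] assms] counit_inv(1)[OF PQ(2)]] .
  have eq: "Ga m = lift (Go P) (Go Q) (counit_inv Q \<cdot>\<^bsub>B\<^esub> (m \<cdot>\<^bsub>B\<^esub> counit P))"
    by (simp add: Ga_def B.Hom_Dom[OF assms] B.Hom_Cod[OF assms])
  show "Ga m \<in> Hom H (Go P) (Go Q)"
    "Fa (Ga m) = counit_inv Q \<cdot>\<^bsub>B\<^esub> (m \<cdot>\<^bsub>B\<^esub> counit P)"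
    unfolding eq using lift_Hom[OF Go_Ob Go_Ob h] F_lift[OF Go_Ob Go_Ob h] PQ by blast+
qed

lemma counit_natural:
  assumes "m \<in> Hom B P Q"
  shows "counit Q \<cdot>\<^bsub>B\<^esub> Fa (Ga m) = m \<cdot>\<^bsub>B\<^esub> counit P"
proof -
  have PQ: "P \<in> Ob B" "Q \<in> Ob B" using B.Hom_Ob[OF assms] by auto
  note mc = B.Comp_Hom[OF counit_Hom[OF PQ(1)] assms]
  show ?thesis
    using F_Ga[OF assms] B.Comp_assoc[OF mc counit_inv(1)[OF PQ(2)] counit_Hom[OF PQ(2)]]
      counit_inv(3)[OF PQ(2)] B.Comp_Idn_left[OF mc] by simp
qed

lemma additive_functor_G: "additive_functor B T Go Ga"
proof -
  have "is_functor B T Go Ga"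
  proof (rule B.is_functorI; unfold T_simps(1,5-7))
    show "P \<in> Ob B \<Longrightarrow> Go P \<in> Ob H" for P by (rule Go_Ob)
    show "m \<in> Hom B P Q \<Longrightarrow> Ga m \<in> Hom H (Go P) (Go Q)" for m P Q by (rule Ga_Hom)
    fix P assume P: "P \<in> Ob B"
    show "Ga (Idn B P) = Idn H (Go P)"
      using F_inj[OF Ga_Hom[OF B.Idn_Hom[OF P]] H.Idn_Hom[OF Go_Ob[OF P]]] F_Ga[OF B.Idn_Hom[OF P]]
        B.Comp_Idn_left[OF counit_Hom[OF P]] counit_inv(2)[OF P] F_Idn[OF Go_Ob[OF P]] by simp
  next
    fix m n P Q S assume mn: "m \<in> Hom B P Q" "n \<in> Hom B Q S"
    have PQS: "P \<in> Ob B" "Q \<in> Ob B" "S \<in> Ob B" using B.Hom_Ob mn by blast+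
    note c = counit_Hom[OF PQS(1)] counit_Hom[OF PQS(2)] and ci = counit_inv(1)[OF PQS(3)]
    note Gm = F_Hom[OF Ga_Hom[OF mn(1)]] and nm = B.Comp_Hom[OF mn]
    \<comment> \<open>Naturality applies where \<open>counit Q\<close> meets
      \<open>Fa (Ga m)\<close> and moves the counit past \<open>m\<close>.\<close>
    have "Fa (Ga n) \<cdot>\<^bsub>B\<^esub> Fa (Ga m) = counit_inv S \<cdot>\<^bsub>B\<^esub> ((n \<cdot>\<^bsub>B\<^esub> counit Q) \<cdot>\<^bsub>B\<^esub> Fa (Ga m))"
      using F_Ga[OF mn(2)] B.Comp_assoc[OF Gm B.Comp_Hom[OF c(2) mn(2)] ci] by simp
    also have "\<dots> = counit_inv S \<cdot>\<^bsub>B\<^esub> ((n \<cdot>\<^bsub>B\<^esub> m) \<cdot>\<^bsub>B\<^esub> counit P)"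
      using B.Comp_assoc[OF Gm c(2) mn(2)] counit_natural[OF mn(1)] B.Comp_assoc[OF c(1) mn] by simp
    finally have "Fa (Ga (n \<cdot>\<^bsub>B\<^esub> m)) = Fa (Ga n \<cdot>\<^bsub>H\<^esub> Ga m)"
      using F_Ga[OF nm] F_Comp[OF Ga_Hom[OF mn(1)] Ga_Hom[OF mn(2)]] by simp
    then show "Ga (n \<cdot>\<^bsub>B\<^esub> m) = Ga n \<cdot>\<^bsub>H\<^esub> Ga m"
      by (rule F_inj[OF Ga_Hom[OF nm] H.Comp_Hom[OF Ga_Hom[OF mn(1)] Ga_Hom[OF mn(2)]]])
  qed
  moreover have "Ga (m \<boxplus>\<^bsub>B\<^esub> n) = Ga m \<boxplus>\<^bsub>T\<^esub> Ga n" if mn: "m \<in> Hom B P Q" "n \<in> Hom B P Q" for m n P Q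
  proof -
    have PQ: "P \<in> Ob B" "Q \<in> Ob B" using B.Hom_Ob mn by blast+
    note c = counit_Hom[OF PQ(1)] and ci = counit_inv(1)[OF PQ(2)]
    show ?thesis
      using F_inj[OF Ga_Hom[OF B.Add_closed[OF mn]] T_Add_Hom[OF Ga_Hom[OF mn(1)] Ga_Hom[OF mn(2)]]]
        F_Ga[OF B.Add_closed[OF mn]] F_Add[OF Ga_Hom[OF mn(1)] Ga_Hom[OF mn(2)]]
        F_Ga[OF mn(1)] F_Ga[OF mn(2)] B.Comp_Add_left[OF c mn]
        B.Comp_Add_right[OF B.Comp_Hom[OF c mn(1)] B.Comp_Hom[OF c mn(2)] ci] by simp
  qed
  ultimately show ?thesis
    unfolding additive_functor_def using B.Arr_Hom by metis
qed

text \<open>Preimage of the inverse counit at \<open>Fo X\<close>, as the triangle identity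
  dictates.\<close>

definition unit :: "'o \<Rightarrow> 'm" where
  "unit X = lift X (Go (Fo X)) (counit_inv (Fo X))"

lemma
  assumes "X \<in> Ob H"
  shows unit_Hom: "unit X \<in> Hom H X (Go (Fo X))" and F_unit: "Fa (unit X) = counit_inv (Fo X)"
    and unit_iso: "isomorphism H (unit X)"
proof -
  note P = F_Ob[OF assms]
  show u: "unit X \<in> Hom H X (Go (Fo X))" and Fu: "Fa (unit X) = counit_inv (Fo X)"
    unfolding unit_def using lift_Hom[OF assms Go_Ob counit_inv(1)] F_lift[OF assms Go_Ob counit_inv(1)] P
    by blast+
  have "isomorphism B (counit_inv (Fo X))"
    using B.isomorphismI[OF counit_inv(1)[OF P] counit_Hom[OF P]] counit_inv[OF P] by blast
  then show "isomorphism H (unit X)" using isomorphism_reflect[OF u] Fu by simp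
qed

lemma equivalent_T: "equivalent_as_additive_categories T B"
proof -
  have iso: "isomorphism T f = isomorphism H f" for f
    by (simp add: isomorphism_def T_simps)
  have "naturally_isomorphic T T (\<lambda>X. X) (\<lambda>f. f) (Go \<circ> Fo) (Ga \<circ> Fa)"
    unfolding naturally_isomorphic_def T_simps(1-4,6,7) iso
  proof (intro exI[of _ unit] conjI ballI)
    fix X assume "X \<in> Ob H"
    then show "unit X \<in> Hom H X ((Go \<circ> Fo) X)" "isomorphism H (unit X)"
      by (simp_all add: unit_Hom unit_iso)
  next
    fix f assume "f \<in> Arr H"
    then obtain X Y where f: "f \<in> Hom H X Y" using H.Arr_Hom by blast
    have XY: "X \<in> Ob H" "Y \<in> Ob H" using H.Hom_Ob[OF f] by auto
    note P = F_Ob[OF XY(1)] and Ff = F_Hom[OF f] and u = unit_Hom[OF XY(1)] unit_Hom[OF XY(2)]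
    note GF = Ga_Hom[OF Ff]
    have "Fa (Ga (Fa f) \<cdot>\<^bsub>H\<^esub> unit X) =
        counit_inv (Fo Y) \<cdot>\<^bsub>B\<^esub> ((Fa f \<cdot>\<^bsub>B\<^esub> counit (Fo X)) \<cdot>\<^bsub>B\<^esub> counit_inv (Fo X))"
      using F_Comp[OF u(1) GF] F_unit[OF XY(1)] F_Ga[OF Ff] 
        B.Comp_assoc[OF counit_inv(1)[OF P] B.Comp_Hom[OF counit_Hom[OF P] Ff]
          counit_inv(1)[OF F_Ob[OF XY(2)]]] by simp
    also have "(Fa f \<cdot>\<^bsub>B\<^esub> counit (Fo X)) \<cdot>\<^bsub>B\<^esub> counit_inv (Fo X) = Fa f"
      using B.Comp_assoc[OF counit_inv(1)[OF P] counit_Hom[OF P] Ff] counit_inv(3)[OF P]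
        B.Comp_Idn_right[OF Ff] by simp
    finally have "Fa (Ga (Fa f) \<cdot>\<^bsub>H\<^esub> unit X) = Fa (unit Y \<cdot>\<^bsub>H\<^esub> f)"
      using F_Comp[OF f u(2)] F_unit[OF XY(2)] by simp
    then show "(Ga \<circ> Fa) f \<cdot>\<^bsub>H\<^esub> unit (Dom H f) = unit (Cod H f) \<cdot>\<^bsub>H\<^esub> f"
      using F_inj[OF H.Comp_Hom[OF u(1) GF] H.Comp_Hom[OF f u(2)]] H.Hom_Dom[OF f] H.Hom_Cod[OF f]
      by simp
  qed
  moreover have "naturally_isomorphic B B (Fo \<circ> Go) (Fa \<circ> Ga) (\<lambda>X. X) (\<lambda>f. f)"
    unfolding naturally_isomorphic_def
    using counit_Hom counit_iso counit_natural[OF B.Arr_Hom]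
    by (intro exI[of _ counit] conjI ballI) simp_all
  ultimately show ?thesis
    unfolding equivalent_as_additive_categories_def
    using additive_category_T B.additive_category_axioms additive_functor_F additive_functor_G by blast
qed

end

section \<open>Model structures on additive categories\<close>

context model_structure
begin

text \<open>Factor \<open>f = q \<cdot> j\<close> with \<open>q\<close> a trivial fibration; lifting
  against \<open>q\<close> makes \<open>f\<close> a retract of the cofibration
  \<open>j\<close>.\<close>

lemma CoFibI:
  assumes "f \<in> Arr M" "\<And>g. g \<in> Fib \<inter> Weq \<Longrightarrow> lifts_against M f g"
  shows "f \<in> CoFib"
proof -
  obtain j q where jq: "j \<in> CoFib" "q \<in> Fib \<inter> Weq" "Cod M j = Dom M q" "f = q \<cdot> j"
    using factor_CoFib_TFib[OF assms(1)] by blast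
  have "j \<in> Hom M (Dom M j) (Dom M q)" "q \<in> Hom M (Dom M q) (Cod M q)"
    using jq CoFib_Arr Fib_Arr Arr_Hom by (auto simp: Hom_def)
  then have "is_retract M f j"
    using retract_of_left_factor assms(2)[OF jq(2)] jq(4) by blast
  then show ?thesis using retract_CoFib jq(1) by blast
qed

text \<open>Uses the other factorization, whose left factor is a trivial cofibration;
  \<open>CoFib\<close> and \<open>Weq\<close> are both closed under retracts.\<close>

lemma TCoFibI:
  assumes "f \<in> Arr M" "\<And>g. g \<in> Fib \<Longrightarrow> lifts_against M f g"
  shows "f \<in> CoFib \<inter> Weq"
proof -
  obtain i p where ip: "i \<in> CoFib \<inter> Weq" "p \<in> Fib" "Cod M i = Dom M p" "f = p \<cdot> i"
    using factor_TCoFib_Fib[OF assms(1)] by blast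
  have "i \<in> Hom M (Dom M i) (Dom M p)" "p \<in> Hom M (Dom M p) (Cod M p)"
    using ip CoFib_Arr Fib_Arr Arr_Hom by (auto simp: Hom_def)
  then have "is_retract M f i"
    using retract_of_left_factor assms(2)[OF ip(2)] ip(4) by blast
  then show ?thesis using retract_CoFib retract_Weq ip(1) by blast
qed

text \<open>The same factorization read from the right: since \<open>i\<close> lifts against
  \<open>f\<close>, the morphism \<open>f\<close> is a retract of the fibration
  \<open>p\<close>.\<close>

lemma FibI:
  assumes "f \<in> Arr M" "\<And>i. i \<in> CoFib \<inter> Weq \<Longrightarrow> lifts_against M i f"
  shows "f \<in> Fib"
proof -
  obtain i p where ip: "i \<in> CoFib \<inter> Weq" "p \<in> Fib" "Cod M i = Dom M p" "f = p \<cdot> i"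
    using factor_TCoFib_Fib[OF assms(1)] by blast
  have "i \<in> Hom M (Dom M i) (Dom M p)" "p \<in> Hom M (Dom M p) (Cod M p)"
    using ip CoFib_Arr Fib_Arr Arr_Hom by (auto simp: Hom_def)
  then have "is_retract M f p"
    using retract_of_right_factor assms(2)[OF ip(1)] ip(4) by blast
  then show ?thesis using retract_Fib ip(2) by blast
qed

text \<open>Two out of three, applied to a weak equivalence \<open>i\<close> out of
  \<open>X\<close>: both \<open>i\<close> and \<open>i \<cdot> Id\<close> lie in \<open>Weq\<close>.
  Factoring the identity provides such an \<open>i\<close>.\<close>

lemma Weq_Idn:
  assumes "X \<in> Ob M"
  shows "Idn M X \<in> Weq"
proof -
  note X = Idn_Hom[OF assms]
  obtain i p where ip: "i \<in> CoFib \<inter> Weq" "p \<in> Fib" "Cod M i = Dom M p" "Idn M X = p \<cdot> i"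
    using factor_TCoFib_Fib[OF Hom_Arr[OF X]] by blast
  have i: "i \<in> Hom M (Dom M i) (Dom M p)" and p: "p \<in> Hom M (Dom M p) (Cod M p)"
    using ip CoFib_Arr Fib_Arr Arr_Hom by (auto simp: Hom_def)
  have "Dom M i = X" using Comp_Hom[OF i p] X ip(4) by (auto simp: Hom_def)
  then have i: "i \<in> Hom M X (Dom M p)" using i by simp
  show ?thesis
    using two_of_three[OF X i] Comp_Idn_right[OF i] ip(1) by simp
qed

end

section \<open>Cofibrant objects and the three conditions\<close>

locale additive_model_structure = weakly_idempotent_complete A + model_structure A CoFib Fib Weq
  for A :: "('o, 'm, 'z) acat_scheme" (structure) and CoFib Fib Weq :: "'m set"
begin

definition C where "C = cofibrant_objects A CoFib"
definition TC where "TC = cofibrant_objects A CoFib \<inter> trivial_objects A Weq"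

text \<open>The lifting criterion for \<open>CoFib\<close> applied to \<open>0 -> X\<close>. Closure
  of \<open>C\<close> under biproducts is read off from this form, that of \<open>TC\<close> from
  \<open>TC_iff\<close>.\<close>

lemma C_iff: "X \<in> C \<longleftrightarrow> X \<in> Ob A \<and> (\<forall>g \<in> Fib \<inter> Weq. hom_epic A {X} g)"
proof (cases "X \<in> Ob A")
  case True
  have "Zero A (zero_ob A) X \<in> CoFib \<longleftrightarrow> (\<forall>g \<in> Fib \<inter> Weq. lifts_against A (Zero A (zero_ob A) X) g)"
    using lifting CoFibI[OF Hom_Arr[OF Zero_Hom[OF zero_ob_Ob True]]] by blast
  then show ?thesis
    using True lifts_against_from_zero[OF True] Fib_Arr by (auto simp: C_def cofibrant_objects_def)
qed (simp add: C_def cofibrant_objects_def)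

lemma TC_iff: "X \<in> TC \<longleftrightarrow> X \<in> Ob A \<and> (\<forall>g \<in> Fib. hom_epic A {X} g)"
proof (cases "X \<in> Ob A")
  case True
  have "Zero A (zero_ob A) X \<in> CoFib \<inter> Weq \<longleftrightarrow> (\<forall>g \<in> Fib. lifts_against A (Zero A (zero_ob A) X) g)"
    using lifting TCoFibI[OF Hom_Arr[OF Zero_Hom[OF zero_ob_Ob True]]] by blast
  then show ?thesis
    using True lifts_against_from_zero[OF True] Fib_Arr
    by (auto simp: TC_def cofibrant_objects_def trivial_objects_def)
qed (simp add: TC_def cofibrant_objects_def)

lemma C_Ob: "X \<in> C \<Longrightarrow> X \<in> Ob A" and TC_C: "X \<in> TC \<Longrightarrow> X \<in> C"
  by (simp_all add: C_iff TC_iff)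

text \<open>Phrased with explicit splitting data, so that it covers injections into biproducts as
  well as split monomorphisms with a given cokernel.\<close>

lemma summand_TCoFib:
  assumes "f \<in> Hom A X Y" "c \<in> Hom A Y K" "r \<in> Hom A Y X" "s \<in> Hom A K Y"
    "r \<cdot> f = Idn A X" "c \<cdot> f = Zero A X K" "(f \<cdot> r) \<boxplus> (s \<cdot> c) = Idn A Y" "K \<in> TC"
  shows "f \<in> CoFib \<inter> Weq"
  using TCoFibI[OF Hom_Arr[OF assms(1)]] lifts_against_summand[OF assms(1-7)] assms(8) TC_iff by blast

lemma split_mono_TCoFib:
  assumes "split_mono A f" "is_cokernel A f c" "Cod A c \<in> TC"
  shows "f \<in> CoFib \<inter> Weq"
proof -
  have f: "f \<in> Hom A (Dom A f) (Cod A f)" and c: "c \<in> Hom A (Cod A f) (Cod A c)"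
    using assms(2) by (auto simp: is_cokernel_def Hom_def)
  obtain r s where rs: "r \<in> Hom A (Cod A f) (Dom A f)" "s \<in> Hom A (Cod A c) (Cod A f)"
    "r \<cdot> f = Idn A (Dom A f)" "(f \<cdot> r) \<boxplus> (s \<cdot> c) = Idn A (Cod A f)"
    using split_mono_decomposition[OF assms(1,2) f c] by blast
  show ?thesis
    using summand_TCoFib[OF f c rs(1-3) is_cokernelD(1)[OF assms(2) f c] rs(4) assms(3)] .
qed

lemma fibrant_iff: "fibrant_objects A Fib = Ob A \<longleftrightarrow> (\<forall>X \<in> Ob A. Zero A X (zero_ob A) \<in> Fib)"
  by (auto simp: fibrant_objects_def)

text \<open>Weak idempotent completeness enters here: the retraction of \<open>f\<close> gives it a
  cokernel, and lifting against all fibrations passes on to \<open>0 -> Cod A c\<close>, which puts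
  this object in \<open>TC\<close>.\<close>

lemma fibrant_TCoFib:
  assumes "fibrant_objects A Fib = Ob A" "f \<in> CoFib \<inter> Weq"
  obtains c where "split_mono A f" "is_cokernel A f c" "Cod A c \<in> TC"
proof -
  obtain X Y where f: "f \<in> Hom A X Y" using assms(2) CoFib_Arr Arr_Hom by blast
  have XY: "X \<in> Ob A" "Y \<in> Ob A" using Hom_Ob[OF f] by auto
  have l: "lifts_against A f g" if "g \<in> Fib" for g using lifting assms(2) that by blast
  have X: "Zero A X (zero_ob A) \<in> Fib" using assms(1) XY by (simp add: fibrant_iff)
  \<comment> \<open>The square has the identity of \<open>X\<close> on top and \<open>X -> 0\<close>
    on the right, so a lift is a retraction of \<open>f\<close>.\<close>
  have "Zero A X (zero_ob A) \<cdot> Idn A X = Zero A Y (zero_ob A) \<cdot> f"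
    using Comp_Idn_right[OF Zero_Hom] Comp_Zero_left[OF f] zero_ob_Ob XY by simp
  then obtain r where "r \<in> Hom A Y X" "r \<cdot> f = Idn A X"
    using lifts_againstD[OF l[OF X] f Zero_Hom Idn_Hom Zero_Hom] XY zero_ob_Ob by metis
  then have sm: "split_mono A f"
    using f unfolding split_mono_def by (auto simp: Hom_def)
  then obtain c where c: "is_cokernel A f c" using split_mono_has_cokernel by blast
  have cH: "c \<in> Hom A Y (Cod A c)" using c f by (auto simp: is_cokernel_def Hom_def)
  have "Cod A c \<in> TC"
    using hom_epic_cokernel[OF f cH c l] Fib_Arr Hom_Ob[OF cH] by (auto simp: TC_iff)
  then show thesis using that sm c by blast
qed

lemma hom_epic_TC_iff: "hom_epic A TC f \<longleftrightarrow> f \<in> Arr A \<and> (\<forall>K \<in> TC. hom_epic A {K} f)"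
  by (auto simp: hom_epic_def)

lemma fibrant_imp_TCoFib_eq:
  assumes "fibrant_objects A Fib = Ob A"
  shows "CoFib \<inter> Weq = {f. split_mono A f \<and> (\<exists>c. is_cokernel A f c \<and> Cod A c \<in> TC)}"
  using split_mono_TCoFib fibrant_TCoFib[OF assms] by blast

text \<open>\<open>Fib\<close> consists of everything that \<open>TCoFib\<close> lifts against, and
  for a split monomorphism this only asks to be Hom-epic for its cokernel.\<close>

lemma TCoFib_eq_imp_Fib_eq:
  assumes "CoFib \<inter> Weq = {f. split_mono A f \<and> (\<exists>c. is_cokernel A f c \<and> Cod A c \<in> TC)}"
  shows "Fib = {f \<in> Arr A. hom_epic A TC f}"
proof (intro equalityI subsetI)
  fix f assume "f \<in> Fib"
  then show "f \<in> {f \<in> Arr A. hom_epic A TC f}" using Fib_Arr hom_epic_TC_iff TC_iff by blast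
next
  fix g assume "g \<in> {f \<in> Arr A. hom_epic A TC f}"
  then have g: "g \<in> Arr A" "\<And>K. K \<in> TC \<Longrightarrow> hom_epic A {K} g" by (auto simp: hom_epic_TC_iff)
  show "g \<in> Fib"
  proof (rule FibI[OF g(1)])
    fix i assume "i \<in> CoFib \<inter> Weq"
    then obtain c where sm: "split_mono A i" and ck: "is_cokernel A i c" and K: "Cod A c \<in> TC"
      using assms by blast
    have i: "i \<in> Hom A (Dom A i) (Cod A i)" and c: "c \<in> Hom A (Cod A i) (Cod A c)"
      using ck by (auto simp: is_cokernel_def Hom_def)
    obtain r s where rs: "r \<in> Hom A (Cod A i) (Dom A i)" "s \<in> Hom A (Cod A c) (Cod A i)"
      "r \<cdot> i = Idn A (Dom A i)" "(i \<cdot> r) \<boxplus> (s \<cdot> c) = Idn A (Cod A i)"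
      using split_mono_decomposition[OF sm ck i c] by blast
    show "lifts_against A i g"
      using lifts_against_summand[OF i c rs(1-3) is_cokernelD(1)[OF ck i c] rs(4) g(2)[OF K]] .
  qed
qed

lemma Fib_eq_imp_fibrant:
  assumes "Fib = {f \<in> Arr A. hom_epic A TC f}"
  shows "fibrant_objects A Fib = Ob A"
  unfolding fibrant_iff
proof
  fix X assume X: "X \<in> Ob A"
  note z = Zero_Hom[OF X zero_ob_Ob]
  have "hom_epic A TC (Zero A X (zero_ob A))"
  proof (rule hom_epicI[OF z])
    fix K v assume "K \<in> TC" and v: "v \<in> Hom A K (zero_ob A)"
    then have "K \<in> Ob A" by (simp add: TC_iff)
    then show "\<exists>h \<in> Hom A K X. Zero A X (zero_ob A) \<cdot> h = v"
      using Zero_Hom[OF _ X] Comp_Zero_right[OF z] to_zero_ob[OF v] by auto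
  qed
  then show "Zero A X (zero_ob A) \<in> Fib" using assms Hom_Arr[OF z] by blast
qed

lemma hom_epic_zero_ob:
  assumes "g \<in> Arr A"
  shows "hom_epic A {zero_ob A} g"
proof -
  obtain P Q where g: "g \<in> Hom A P Q" using Arr_Hom assms by blast
  show ?thesis
  proof (rule hom_epicI[OF g])
    fix X v assume "X \<in> {zero_ob A}" "v \<in> Hom A X Q"
    then show "\<exists>h \<in> Hom A X P. g \<cdot> h = v"
      using Zero_Hom[OF zero_ob_Ob] Hom_Ob[OF g] Comp_Zero_right[OF g zero_ob_Ob] from_zero_ob
      by (intro bexI[of _ "Zero A (zero_ob A) P"]) auto
  qed
qed

lemma zero_ob_TC: "zero_ob A \<in> TC"
  using zero_ob_Ob hom_epic_zero_ob Fib_Arr by (auto simp: TC_iff)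

lemma C_biproduct: "X \<in> C \<Longrightarrow> Y \<in> C \<Longrightarrow> biproduct A X Y S \<Longrightarrow> S \<in> C"
  by (simp add: C_iff hom_epic_biproduct[of X Y S] biproduct_Ob)

lemma TC_biproduct: "X \<in> TC \<Longrightarrow> Y \<in> TC \<Longrightarrow> biproduct A X Y S \<Longrightarrow> S \<in> TC"
  by (simp add: TC_iff hom_epic_biproduct[of X Y S] biproduct_Ob)

text \<open>Closure of cofibrations under composition, in the case \<open>0 -> X -> E\<close>: a map
  out of \<open>E\<close> is lifted over \<open>X\<close> because \<open>X\<close> is cofibrant, and
  the lift is then extended along \<open>j\<close>.\<close>

lemma CoFib_C:
  assumes "X \<in> C" "j \<in> Hom A X E" "j \<in> CoFib"
  shows "E \<in> C"
  unfolding C_iff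
proof (intro conjI ballI)
  show "E \<in> Ob A" using Hom_Ob[OF assms(2)] by blast
  fix g assume g': "g \<in> Fib \<inter> Weq"
  then obtain P Q where g: "g \<in> Hom A P Q" using Fib_Arr Arr_Hom by blast
  show "hom_epic A {E} g"
  proof (rule hom_epicI[OF g])
    fix E' v assume "E' \<in> {E}" "v \<in> Hom A E' Q"
    then have v: "v \<in> Hom A E Q" "E' = E" by auto
    have "hom_epic A {X} g" using assms(1) g' by (simp add: C_iff)
    then obtain u where u: "u \<in> Hom A X P" "g \<cdot> u = v \<cdot> j"
      using hom_epicD[OF _ g _ Comp_Hom[OF assms(2) v(1)]] by blast
    have "lifts_against A j g" using lifting assms(3) g' by blast
    then show "\<exists>h \<in> Hom A E' P. g \<cdot> h = v"
      using lifts_againstD[OF _ assms(2) g u(1) v(1) u(2)] v(2) by blast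
  qed
qed

text \<open>Such a \<open>t\<close> extends along a cofibration from \<open>K\<close> to a trivially fibrant, hence trivial, object.\<close>

lemma TFib_null:
  assumes K: "K \<in> C" and t: "t \<in> Hom A K P" and q: "q \<in> Hom A P Y" "q \<in> Fib \<inter> Weq"
    and qt: "q \<cdot> t = Zero A K Y"
  shows "t \<in> factoring A TC K P"
proof -
  have KP: "K \<in> Ob A" "P \<in> Ob A" "Y \<in> Ob A" using Hom_Ob t q(1) by blast+
  note z = Zero_Hom[OF KP(1) zero_ob_Ob]
  obtain j p where jp: "j \<in> CoFib" "p \<in> Fib \<inter> Weq" "Cod A j = Dom A p" "Zero A K (zero_ob A) = p \<cdot> j"
    using factor_CoFib_TFib[OF Hom_Arr[OF z]] by blast
  have j': "j \<in> Hom A (Dom A j) (Dom A p)" and p': "p \<in> Hom A (Dom A p) (Cod A p)"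
    using jp CoFib_Arr Fib_Arr Arr_Hom by (auto simp: Hom_def)
  obtain I where j: "j \<in> Hom A K I" and p: "p \<in> Hom A I (zero_ob A)"
    using Comp_Hom[OF j' p'] z jp(4) j' p' by (auto simp: Hom_def)
  have I: "I \<in> Ob A" using Hom_Ob[OF j] by blast
  \<comment> \<open>\<open>I -> 0\<close> is a weak equivalence and \<open>0 -> I -> 0\<close> is
    the identity, so two out of three makes \<open>I\<close> trivial.\<close>
  have "Zero A I (zero_ob A) \<in> Weq" using jp(2) to_zero_ob[OF p] by simp
  moreover have "Zero A I (zero_ob A) \<cdot> Zero A (zero_ob A) I \<in> Weq"
    using Comp_Zero_right[OF Zero_Hom[OF I zero_ob_Ob] zero_ob_Ob] Weq_Idn[OF zero_ob_Ob]
      Zero_zero_ob by simp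
  ultimately have "Zero A (zero_ob A) I \<in> Weq"
    using two_of_three[OF Zero_Hom[OF zero_ob_Ob I] Zero_Hom[OF I zero_ob_Ob]] by blast
  then have IT: "I \<in> TC"
    using CoFib_C[OF K j jp(1)] I by (simp add: TC_def C_def trivial_objects_def)
  \<comment> \<open>The assumption \<open>q \<cdot> t = 0\<close> says that \<open>t\<close> on top
    and the zero map \<open>I -> Y\<close> below form a commutative square from the cofibration
    \<open>j\<close> to \<open>q\<close>.\<close>
  have "q \<cdot> t = Zero A I Y \<cdot> j" using Comp_Zero_left[OF j] KP qt by simp
  then obtain h where "h \<in> Hom A I P" "h \<cdot> j = t"
    using lifts_againstD[OF lifting j q(1) t Zero_Hom[OF I]] jp(1) q(2) KP by blast
  then show ?thesis using IT j unfolding factoring_def by blast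
qed

section \<open>The quotient of \<open>C\<close> by \<open>TC\<close>\<close>

abbreviation D where "D \<equiv> full_subcategory A C"
abbreviation R where "R \<equiv> factoring_rel D TC"
abbreviation B where "B \<equiv> additive_quotient D TC"

lemma C_subset: "C \<subseteq> Ob A" using C_Ob by blast

lemma additive_category_D: "additive_category D"
  using additive_category_full[OF C_subset TC_C[OF zero_ob_TC] C_biproduct] .

sublocale Q: additive_ideal D TC
proof (intro additive_ideal.intro additive_category_D additive_ideal_axioms.intro)
  show "TC \<subseteq> Ob D" "TC \<noteq> {}" using TC_C C_Ob zero_ob_TC by (auto simp: full_simps)
  fix X Y assume XY: "X \<in> TC" "Y \<in> TC"
  then have "X \<in> C" "Y \<in> C" using TC_C by blast+
  then obtain S where S: "biproduct A X Y S" using ex_biproduct C_Ob by blast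
  then have "S \<in> TC" "S \<in> C" using TC_biproduct[OF XY] TC_C by blast+
  moreover have "biproduct D X Y S"
    using S \<open>X \<in> C\<close> \<open>Y \<in> C\<close> \<open>S \<in> C\<close> by (simp add: biproduct_def full_simps full_additive_simps)
  ultimately show "\<exists>S \<in> TC. biproduct D X Y S" by blast
qed

sublocale B: additive_category B by (rule Q.additive_category_B)

abbreviation cl where "cl f \<equiv> R `` {f}"

lemma D_Hom: "X \<in> C \<Longrightarrow> Y \<in> C \<Longrightarrow> Hom D X Y = Hom A X Y"
  by (simp add: full_simps(7))

lemma D_factoring: "X \<in> C \<Longrightarrow> Y \<in> C \<Longrightarrow> factoring D TC X Y = factoring A TC X Y"
  using TC_C unfolding factoring_def full_simps(6,7) by blast

lemma B_Ob: "Ob B = C"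
  using C_Ob by (auto simp: Q.B_simps full_simps)

lemma cl_Hom: "X \<in> C \<Longrightarrow> Y \<in> C \<Longrightarrow> f \<in> Hom A X Y \<Longrightarrow> cl f \<in> Hom B X Y"
  using Q.class_Hom[of f X Y] by (simp add: Q.B_simps D_Hom)

lemma cl_HomE:
  assumes "K \<in> Hom B X Y"
  obtains f where "X \<in> C" "Y \<in> C" "f \<in> Hom A X Y" "K = cl f"
  using assms unfolding Q.B_simps by (elim Q.HomE) (auto simp: full_simps(7))

lemma cl_Comp:
  "X \<in> C \<Longrightarrow> Y \<in> C \<Longrightarrow> Z \<in> C \<Longrightarrow> f \<in> Hom A X Y \<Longrightarrow> g \<in> Hom A Y Z \<Longrightarrow>
    cl g \<cdot>\<^bsub>B\<^esub> cl f = cl (g \<cdot> f)"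
  using Q.class_Comp[of f X Y g Z] by (simp add: Q.B_simps(6) D_Hom full_simps(6))

lemma cl_Idn: "Idn B X = cl (Idn A X)"
  by (simp add: Q.B_simps(5) Q.class_Idn full_simps(5))

lemma cl_Add:
  "X \<in> C \<Longrightarrow> Y \<in> C \<Longrightarrow> f \<in> Hom A X Y \<Longrightarrow> g \<in> Hom A X Y \<Longrightarrow> cl f \<boxplus>\<^bsub>B\<^esub> cl g = cl (f \<boxplus> g)"
  using Q.class_Add[of f X Y g] by (simp add: D_Hom full_additive_simps)

lemma cl_eq_iff:
  assumes "X \<in> C" "Y \<in> C" "f \<in> Hom A X Y" "g \<in> Hom A X Y"
  shows "cl f = cl g \<longleftrightarrow> (\<exists>d \<in> factoring A TC X Y. g = f \<boxplus> d)"
proof -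
  have fg: "f \<in> Hom D X Y" "g \<in> Hom D X Y" using assms by (simp_all add: D_Hom)
  have "cl f = cl g \<longleftrightarrow> (f, g) \<in> R"
    by (rule Q.class_eq_iff[OF Q.Hom_Arr[OF fg(1)] Q.Hom_Arr[OF fg(2)]])
  then show ?thesis
    using Q.relI[OF fg(1)] Q.relE[of f g X Y] fg(1)
    unfolding D_factoring[OF assms(1,2)] full_additive_simps by metis
qed

text \<open>The difference of \<open>a\<close> and \<open>b\<close> is killed by \<open>q\<close>
  and so goes through \<open>TC\<close>. As \<open>Y\<close> ranges over all objects,
  \<open>q\<close> may fail to be an arrow of \<open>C/TC\<close>; so the equation to be cancelled
  is stated in \<open>A\<close>.\<close>

lemma TFib_cancel:
  assumes KP: "K \<in> C" "P \<in> C" and q: "q \<in> Hom A P Y" "q \<in> Fib \<inter> Weq"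
    and ab: "a \<in> Hom A K P" "b \<in> Hom A K P" and eq: "q \<cdot> a = q \<cdot> b"
  shows "cl a = cl b"
proof -
  obtain d where d: "d \<in> Hom A K P" "b = a \<boxplus> d" using difference[OF ab(2,1)] by blast
  note qa = Comp_Hom[OF ab(1) q(1)] and qd = Comp_Hom[OF d(1) q(1)]
  have "q \<cdot> a \<boxplus> q \<cdot> d = q \<cdot> a \<boxplus> Zero A K Y"
    using Comp_Add_right[OF ab(1) d(1) q(1)] d(2) eq Add_Zero_right[OF qa] by simp
  then have "q \<cdot> d = Zero A K Y"
    using Add_left_cancel[OF qa qd Zero_Hom] Hom_Ob[OF qa] by simp
  then show ?thesis
    using cl_eq_iff[OF KP ab] TFib_null[OF KP(1) d(1) q] d(2) by blast
qed

lemma TFib_section: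
  assumes "X \<in> C" "q \<in> Hom A P X" "q \<in> Fib \<inter> Weq"
  obtains s where "s \<in> Hom A X P" "q \<cdot> s = Idn A X"
  using assms hom_epicD[OF _ assms(2) _ Idn_Hom[of X], of "{X}"] C_iff by blast

text \<open>A section \<open>s\<close> of \<open>q\<close> is a right inverse already in
  \<open>A\<close>. It is a left inverse modulo \<open>TC\<close> because
  \<open>q \<cdot> s \<cdot> q = q\<close> and \<open>q\<close> can be cancelled.\<close>

lemma TFib_iso:
  assumes PX: "P \<in> C" "X \<in> C" and q: "q \<in> Hom A P X" "q \<in> Fib \<inter> Weq"
  shows "isomorphism B (cl q)"
proof -
  obtain s where s: "s \<in> Hom A X P" "q \<cdot> s = Idn A X" using TFib_section PX q by blast
  have P: "Idn A P \<in> Hom A P P" using Idn_Hom C_Ob PX by blast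
  have "q \<cdot> (s \<cdot> q) = q \<cdot> Idn A P"
    using Comp_assoc[OF q(1) s(1) q(1)] s(2) Comp_Idn_left[OF q(1)] Comp_Idn_right[OF q(1)] by simp
  then have "cl (s \<cdot> q) = cl (Idn A P)"
    using TFib_cancel[OF PX(1,1) q Comp_Hom[OF q(1) s(1)] P] by blast
  then show ?thesis
    using B.isomorphismI[OF cl_Hom[OF PX q(1)] cl_Hom[OF PX(2,1) s(1)]]
      cl_Comp[OF PX PX(1) q(1) s(1)] cl_Comp[OF PX(2,1,2) s(1) q(1)] s(2) by (simp add: cl_Idn)
qed

text \<open>The identity of \<open>E\<close> is \<open>i \<cdot> r\<close> plus
  \<open>s \<cdot> c\<close>, and the second summand goes through the cokernel, an object of
  \<open>TC\<close>. So the retraction \<open>r\<close> becomes a two-sided inverse.\<close>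

lemma TCoFib_iso:
  assumes fib: "fibrant_objects A Fib = Ob A" and XE: "X \<in> C" "E \<in> C"
    and i: "i \<in> Hom A X E" "i \<in> CoFib \<inter> Weq"
  shows "isomorphism B (cl i)"
proof -
  obtain c where c: "split_mono A i" "is_cokernel A i c" "Cod A c \<in> TC"
    using fibrant_TCoFib[OF fib i(2)] .
  have cH: "c \<in> Hom A E (Cod A c)" using c(2) i(1) by (auto simp: is_cokernel_def Hom_def)
  obtain r s where rs: "r \<in> Hom A E X" "s \<in> Hom A (Cod A c) E" "r \<cdot> i = Idn A X"
    "(i \<cdot> r) \<boxplus> (s \<cdot> c) = Idn A E"
    using split_mono_decomposition[OF c(1,2) i(1) cH] by blast
  have "s \<cdot> c \<in> factoring A TC E E" using c(3) cH rs(2) unfolding factoring_def by blast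
  then have "cl (i \<cdot> r) = cl (Idn A E)"
    using cl_eq_iff[OF XE(2,2) Comp_Hom[OF rs(1) i(1)] Idn_Hom[OF C_Ob[OF XE(2)]]] rs(4) by metis
  then show ?thesis
    using B.isomorphismI[OF cl_Hom[OF XE i(1)] cl_Hom[OF XE(2,1) rs(1)]]
      cl_Comp[OF XE XE(1) i(1) rs(1)] cl_Comp[OF XE(2,1,2) rs(1) i(1)] rs(3) by (simp add: cl_Idn)
qed

text \<open>Two out of three makes \<open>p\<close> in the factorization
  \<open>w = p \<cdot> i\<close> a trivial fibration. The middle object is cofibrant with
  \<open>X\<close>, so both factors are arrows of \<open>C\<close> and already known to become
  invertible.\<close>

lemma Weq_iso:
  assumes fib: "fibrant_objects A Fib = Ob A" and XY: "X \<in> C" "Y \<in> C"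
    and w: "w \<in> Hom A X Y" "w \<in> Weq"
  shows "isomorphism B (cl w)"
proof -
  obtain i p where ip: "i \<in> CoFib \<inter> Weq" "p \<in> Fib" "Cod A i = Dom A p" "w = p \<cdot> i"
    using factor_TCoFib_Fib[OF Hom_Arr[OF w(1)]] by blast
  have i': "i \<in> Hom A (Dom A i) (Dom A p)" and p': "p \<in> Hom A (Dom A p) (Cod A p)"
    using ip CoFib_Arr Fib_Arr Arr_Hom by (auto simp: Hom_def)
  obtain E where i: "i \<in> Hom A X E" and p: "p \<in> Hom A E Y"
    using Comp_Hom[OF i' p'] w(1) ip(4) i' p' by (auto simp: Hom_def)
  have E: "E \<in> C" using CoFib_C[OF XY(1) i] ip(1) by blast
  have "p \<in> Weq" using two_of_three[OF i p] ip w(2) by blast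
  then have "isomorphism B (cl i)" "isomorphism B (cl p)"
    using TCoFib_iso[OF fib XY(1) E i ip(1)] TFib_iso[OF E XY(2) p] ip(2) by blast+
  then show ?thesis
    using B.isomorphism_Comp[OF cl_Hom[OF XY(1) E i] cl_Hom[OF E XY(2) p]]
      cl_Comp[OF XY(1) E XY(2) i p] ip(4) by simp
qed

section \<open>Cofibrant replacement\<close>

definition rep :: "'o \<Rightarrow> 'm" where
  "rep X = (SOME q. q \<in> Fib \<inter> Weq \<and> Cod A q = X \<and> Dom A q \<in> C)"

text \<open>The choice is not normalized: \<open>Qo X\<close> may differ from \<open>X\<close> even
  for cofibrant \<open>X\<close>. This is why second replacements \<open>rep (Qo X)\<close> occur
  below.\<close>

abbreviation Qo where "Qo X \<equiv> Dom A (rep X)"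

lemma
  assumes "X \<in> Ob A"
  shows rep_TFib: "rep X \<in> Fib \<inter> Weq" and Qo_C: "Qo X \<in> C" and rep_Hom: "rep X \<in> Hom A (Qo X) X"
proof -
  note z = Zero_Hom[OF zero_ob_Ob assms]
  obtain j q where jq: "j \<in> CoFib" "q \<in> Fib \<inter> Weq" "Cod A j = Dom A q" "Zero A (zero_ob A) X = q \<cdot> j"
    using factor_CoFib_TFib[OF Hom_Arr[OF z]] by blast
  have j': "j \<in> Hom A (Dom A j) (Dom A q)" and q': "q \<in> Hom A (Dom A q) (Cod A q)"
    using jq CoFib_Arr Fib_Arr Arr_Hom by (auto simp: Hom_def)
  have "Cod A q = X" "Dom A j = zero_ob A" using Comp_Hom[OF j' q'] z jq(4) by (auto simp: Hom_def)
  then have "\<exists>q. q \<in> Fib \<inter> Weq \<and> Cod A q = X \<and> Dom A q \<in> C"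
    using jq j' CoFib_C[OF TC_C[OF zero_ob_TC], of j] by auto
  from someI_ex[OF this, folded rep_def]
  show "rep X \<in> Fib \<inter> Weq" "Qo X \<in> C" "rep X \<in> Hom A (Qo X) X"
    using Fib_Arr by (auto simp: Hom_def)
qed

text \<open>An arbitrary lift of \<open>f \<cdot> rep X\<close> through \<open>rep Y\<close>; its
  class modulo \<open>TC\<close> does not depend on the choice.\<close>

definition Qa :: "'m \<Rightarrow> 'm" where
  "Qa f = (SOME h. h \<in> Hom A (Qo (Dom A f)) (Qo (Cod A f)) \<and> rep (Cod A f) \<cdot> h = f \<cdot> rep (Dom A f))"

lemma
  assumes "f \<in> Hom A X Y"
  shows Qa_Hom: "Qa f \<in> Hom A (Qo X) (Qo Y)" and rep_Qa: "rep Y \<cdot> Qa f = f \<cdot> rep X"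
proof -
  have XY: "X \<in> Ob A" "Y \<in> Ob A" using Hom_Ob[OF assms] by auto
  have "hom_epic A {Qo X} (rep Y)" using Qo_C[OF XY(1)] rep_TFib[OF XY(2)] by (auto simp: C_iff)
  then have "\<exists>h. h \<in> Hom A (Qo X) (Qo Y) \<and> rep Y \<cdot> h = f \<cdot> rep X"
    using hom_epicD[OF _ rep_Hom[OF XY(2)] _ Comp_Hom[OF rep_Hom[OF XY(1)] assms]] by blast
  from someI_ex[OF this] show "Qa f \<in> Hom A (Qo X) (Qo Y)" "rep Y \<cdot> Qa f = f \<cdot> rep X"
    unfolding Qa_def Hom_Dom[OF assms] Hom_Cod[OF assms] by auto
qed

text \<open>Two lifts have the same composite with the trivial fibration \<open>rep Y\<close>, which
  cancels modulo \<open>TC\<close>. Classes of \<open>Qa\<close> are computed below by exhibiting a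
  convenient lift.\<close>

lemma Qa_class:
  assumes "f \<in> Hom A X Y" "h \<in> Hom A (Qo X) (Qo Y)" "rep Y \<cdot> h = f \<cdot> rep X"
  shows "cl (Qa f) = cl h"
proof -
  have XY: "X \<in> Ob A" "Y \<in> Ob A" using Hom_Ob[OF assms(1)] by auto
  show ?thesis
    using TFib_cancel[OF Qo_C[OF XY(1)] Qo_C[OF XY(2)] rep_Hom[OF XY(2)] rep_TFib[OF XY(2)]
        Qa_Hom[OF assms(1)] assms(2)] rep_Qa[OF assms(1)] assms(3) by simp
qed

text \<open>The identity lifts the identity and \<open>Qa g \<cdot> Qa f\<close> lifts
  \<open>g \<cdot> f\<close>; the chosen lifts agree with these modulo \<open>TC\<close>.\<close>

lemma functor_Q: "is_functor A B Qo (\<lambda>f. cl (Qa f))"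
proof (rule is_functorI)
  show "X \<in> Ob A \<Longrightarrow> Qo X \<in> Ob B" for X by (simp add: B_Ob Qo_C)
  show "f \<in> Hom A X Y \<Longrightarrow> cl (Qa f) \<in> Hom B (Qo X) (Qo Y)" for f X Y
    using Hom_Ob[of f X Y] by (intro cl_Hom Qo_C Qa_Hom) blast+
  fix X assume X: "X \<in> Ob A"
  show "cl (Qa (Idn A X)) = Idn B (Qo X)"
    unfolding cl_Idn using Qa_class[OF Idn_Hom[OF X] Idn_Hom[OF C_Ob[OF Qo_C[OF X]]]]
      Comp_Idn_left[OF rep_Hom[OF X]] Comp_Idn_right[OF rep_Hom[OF X]] by simp
next
  fix f g X Y Z assume fg: "f \<in> Hom A X Y" "g \<in> Hom A Y Z"
  have XYZ: "X \<in> Ob A" "Y \<in> Ob A" "Z \<in> Ob A" using Hom_Ob fg by blast+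
  note r = rep_Hom[OF XYZ(1)] rep_Hom[OF XYZ(2)] rep_Hom[OF XYZ(3)]
  note Q = Qa_Hom[OF fg(1)] Qa_Hom[OF fg(2)]
  have "rep Z \<cdot> (Qa g \<cdot> Qa f) = (g \<cdot> f) \<cdot> rep X"
    using Comp_assoc[OF Q r(3)] rep_Qa[OF fg(2)] Comp_assoc[OF Q(1) r(2) fg(2)] rep_Qa[OF fg(1)]
      Comp_assoc[OF r(1) fg] by simp
  then have "cl (Qa (g \<cdot> f)) = cl (Qa g \<cdot> Qa f)"
    by (rule Qa_class[OF Comp_Hom[OF fg] Comp_Hom[OF Q]])
  then show "cl (Qa (g \<cdot> f)) = cl (Qa g) \<cdot>\<^bsub>B\<^esub> cl (Qa f)"
    using cl_Comp[OF Qo_C[OF XYZ(1)] Qo_C[OF XYZ(2)] Qo_C[OF XYZ(3)] Q] by simp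
qed

text \<open>Two out of three around the square
  \<open>rep Y \<cdot> Qa w = w \<cdot> rep X\<close>.\<close>

lemma Qa_Weq:
  assumes w: "w \<in> Hom A X Y" "w \<in> Weq"
  shows "Qa w \<in> Weq"
proof -
  have XY: "X \<in> Ob A" "Y \<in> Ob A" using Hom_Ob w by blast+
  have "w \<cdot> rep X \<in> Weq" using two_of_three[OF rep_Hom[OF XY(1)] w(1)] rep_TFib[OF XY(1)] w(2) by blast
  then show ?thesis
    using two_of_three[OF Qa_Hom[OF w(1)] rep_Hom[OF XY(2)]] rep_TFib[OF XY(2)] rep_Qa[OF w(1)] by auto
qed

end

section \<open>The localization when all objects are fibrant\<close>

locale fibrant_model_structure = additive_model_structure +
  assumes fibrant: "fibrant_objects A Fib = Ob A"
begin

sublocale L: inverting_functor A B Qo "\<lambda>f. cl (Qa f)" Weq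
proof (intro inverting_functor.intro inverting_functor_axioms.intro)
  show "category A" by (rule category_axioms)
  show "category B" by (rule Q.category_B)
  show "is_functor A B Qo (\<lambda>f. cl (Qa f))" by (rule functor_Q)
  fix w assume w: "w \<in> Arr A" "w \<in> Weq"
  show "isomorphism B (cl (Qa w))"
    using Weq_iso[OF fibrant Qo_C Qo_C Qa_Hom Qa_Weq, OF _ _ Arr_Hom Arr_Hom w(2)] w(1)
      Dom_Ob Cod_Ob by blast
qed

abbreviation LA where "LA \<equiv> localization A Weq"
abbreviation \<gamma> where "\<gamma> \<equiv> localization_map A Weq"

sublocale LA: category LA by (rule L.category_LA)

lemmas \<gamma>_Hom = L.localization_map_Hom
  and \<gamma>_Comp = is_functorD(4)[OF L.functor_localization category_axioms]
  and \<gamma>_Idn = is_functorD(3)[OF L.functor_localization category_axioms]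
  and ext_Hom = is_functorD(2)[OF L.functor_extension LA.category_axioms]
  and ext_Comp = is_functorD(4)[OF L.functor_extension LA.category_axioms]

text \<open>\<open>f\<close> and \<open>g = f + ba\<close> factor as \<open>(1, 0)\<close> and \<open>(1, a)\<close> followed by \<open>(f, b)\<close>. The first two
  are sections of the same projection, which is a weak equivalence.\<close>

lemma \<gamma>_eqI:
  assumes XY: "X \<in> C" "Y \<in> C" and fg: "f \<in> Hom A X Y" "g \<in> Hom A X Y" and "cl f = cl g"
  shows "\<gamma> f = \<gamma> g"
proof -
  have "\<exists>d \<in> factoring A TC X Y. g = f \<boxplus> d" using cl_eq_iff[OF XY fg] assms(5) by blast
  then obtain V a b where V: "V \<in> TC" and a: "a \<in> Hom A X V" and b: "b \<in> Hom A V Y"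
    and g: "g = f \<boxplus> b \<cdot> a" unfolding factoring_def by blast
  have O: "X \<in> Ob A" "V \<in> Ob A" using C_Ob XY TC_C V by blast+
  obtain S where S: "biproduct A X V S" using ex_biproduct O by blast
  obtain i j p q where bi: "i \<in> Hom A X S" "j \<in> Hom A V S" "p \<in> Hom A S X" "q \<in> Hom A S V"
    "p \<cdot> i = Idn A X" "q \<cdot> j = Idn A V" "p \<cdot> j = Zero A V X" "q \<cdot> i = Zero A X V"
    "(i \<cdot> p) \<boxplus> (j \<cdot> q) = Idn A S"
    using S by (rule biproductE)
  \<comment> \<open>\<open>i\<close> splits with complement \<open>V\<close> in \<open>TC\<close>,
    hence is a trivial cofibration; \<open>p \<cdot> i = Id\<close> then puts \<open>p\<close> in
    \<open>Weq\<close>.\<close>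
  have "i \<in> Weq" using summand_TCoFib[OF bi(1,4,3,2,5,8,9) V] by blast
  then have pW: "p \<in> Weq" using two_of_three[OF bi(1,3)] Weq_Idn[OF O(1)] bi(5) by simp
  define m n where "m = i \<boxplus> j \<cdot> a" and "n = f \<cdot> p \<boxplus> b \<cdot> q"
  note ja = Comp_Hom[OF a bi(2)] and fp = Comp_Hom[OF bi(3) fg(1)] and bq = Comp_Hom[OF bi(4) b]
  have m: "m \<in> Hom A X S" and n: "n \<in> Hom A S Y"
    unfolding m_def n_def using Add_closed[OF bi(1) ja] Add_closed[OF fp bq] by auto
  have "p \<cdot> (j \<cdot> a) = Zero A X X" "q \<cdot> (j \<cdot> a) = a"
    using Comp_assoc[OF a bi(2,3)] Comp_assoc[OF a bi(2,4)] bi(6,7) Comp_Zero_left[OF a O(1)]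
      Comp_Idn_left[OF a] by simp_all
  then have pm: "p \<cdot> m = Idn A X" and qm: "q \<cdot> m = a"
    unfolding m_def using Comp_Add_right[OF bi(1) ja bi(3)] Comp_Add_right[OF bi(1) ja bi(4)] bi(5,8)
      Add_Zero_right[OF Idn_Hom[OF O(1)]] Add_Zero_left[OF a] by simp_all
  have nm: "n \<cdot> m = g"
    unfolding n_def using Comp_Add_left[OF m fp bq] Comp_assoc[OF m bi(3) fg(1)] Comp_assoc[OF m bi(4) b]
      pm qm Comp_Idn_right[OF fg(1)] g by simp
  have ni: "n \<cdot> i = f"
    unfolding n_def using Comp_Add_left[OF bi(1) fp bq] Comp_assoc[OF bi(1,3) fg(1)]
      Comp_assoc[OF bi(1,4) b] bi(5,8) Comp_Idn_right[OF fg(1)] Comp_Zero_right[OF b O(1)]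
      Add_Zero_right[OF fg(1)] by simp
  have "\<gamma> p \<cdot>\<^bsub>LA\<^esub> \<gamma> i = \<gamma> p \<cdot>\<^bsub>LA\<^esub> \<gamma> m"
    using \<gamma>_Comp[OF bi(1,3)] \<gamma>_Comp[OF m bi(3)] bi(5) pm by simp
  then have "\<gamma> i = \<gamma> m"
    by (rule LA.isomorphism_cancel_left[OF \<gamma>_Hom[OF bi(3)] L.localization_map_iso[OF bi(3) pW]
          \<gamma>_Hom[OF bi(1)] \<gamma>_Hom[OF m]])
  then show ?thesis using \<gamma>_Comp[OF bi(1) n] \<gamma>_Comp[OF m n] ni nm by simp
qed

lemma \<gamma>_rep_iso: "X \<in> Ob A \<Longrightarrow> isomorphism LA (\<gamma> (rep X))"
  using L.localization_map_iso[OF rep_Hom, of X] rep_TFib[of X] by simp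

text \<open>Pulling an edge back along the replacements \<open>rep X\<close> turns every zigzag from \<open>X\<close> to \<open>Y\<close>
  into a single arrow between \<open>Qo X\<close> and \<open>Qo Y\<close>.\<close>

lemma path_replacement:
  "is_path A Weq X es Y \<Longrightarrow>
    \<exists>f \<in> Hom A (Qo X) (Qo Y). L.cls (X, es, Y) \<cdot>\<^bsub>LA\<^esub> \<gamma> (rep X) = \<gamma> (rep Y) \<cdot>\<^bsub>LA\<^esub> \<gamma> f"
proof (induction es arbitrary: X)
  case Nil
  then have X: "X \<in> Ob A" "Y = X" by auto
  have "Idn LA X = L.cls (X, [], X)"
    using L.L.class_Idn[of X] by (simp add: localization_def path_cat_simps)
  moreover have "Idn A (Qo X) \<in> Hom A (Qo X) (Qo X)" using Idn_Hom C_Ob Qo_C X by blast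
  ultimately show ?case
    using X LA.Comp_Idn_left[OF \<gamma>_Hom[OF rep_Hom[OF X(1)]]] Comp_Idn_right[OF rep_Hom[OF X(1)]]
      \<gamma>_Comp[OF _ rep_Hom[OF X(1)], of "Idn A (Qo X)" "Qo X"]
    by (intro bexI[of _ "Idn A (Qo X)"]) simp_all
next
  case (Cons e es)
  show ?case
  proof (cases e)
    case (Fwd g)
    define Z where "Z = Cod A g"
    have g: "g \<in> Hom A X Z" and es: "is_path A Weq Z es Y"
      using Cons.prems by (auto simp: Fwd Z_def Hom_def)
    have O: "X \<in> Ob A" "Z \<in> Ob A" "Y \<in> Ob A" using Hom_Ob[OF g] is_path_Ob[OF es] by auto
    obtain f where f: "f \<in> Hom A (Qo Z) (Qo Y)"
      "L.cls (Z, es, Y) \<cdot>\<^bsub>LA\<^esub> \<gamma> (rep Z) = \<gamma> (rep Y) \<cdot>\<^bsub>LA\<^esub> \<gamma> f" using Cons.IH[OF es] by blast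
    note r = rep_Hom[OF O(1)] rep_Hom[OF O(2)] rep_Hom[OF O(3)] and c = L.cls_Hom[OF es]
      and Q = Qa_Hom[OF g]
    have "L.cls (X, Fwd g # es, Y) \<cdot>\<^bsub>LA\<^esub> \<gamma> (rep X) = L.cls (Z, es, Y) \<cdot>\<^bsub>LA\<^esub> \<gamma> (g \<cdot> rep X)"
      using L.localization_edge(1)[OF g es] LA.Comp_assoc[OF \<gamma>_Hom[OF r(1)] \<gamma>_Hom[OF g] c]
        \<gamma>_Comp[OF r(1) g] by simp
    also have "\<dots> = (L.cls (Z, es, Y) \<cdot>\<^bsub>LA\<^esub> \<gamma> (rep Z)) \<cdot>\<^bsub>LA\<^esub> \<gamma> (Qa g)"
      using rep_Qa[OF g] \<gamma>_Comp[OF Q r(2)] LA.Comp_assoc[OF \<gamma>_Hom[OF Q] \<gamma>_Hom[OF r(2)] c] by simp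
    also have "\<dots> = \<gamma> (rep Y) \<cdot>\<^bsub>LA\<^esub> \<gamma> (f \<cdot> Qa g)"
      using f(2) LA.Comp_assoc[OF \<gamma>_Hom[OF Q] \<gamma>_Hom[OF f(1)] \<gamma>_Hom[OF r(3)]] \<gamma>_Comp[OF Q f(1)] by simp
    finally show ?thesis using Comp_Hom[OF Q f(1)] Fwd by blast
  next
    case (Bwd w)
    define Z where "Z = Dom A w"
    have w: "w \<in> Hom A Z X" "w \<in> Weq" and es: "is_path A Weq Z es Y"
      using Cons.prems by (auto simp: Bwd Z_def Hom_def)
    have O: "X \<in> Ob A" "Z \<in> Ob A" "Y \<in> Ob A" using Hom_Ob[OF w(1)] is_path_Ob[OF es] by auto
    note QC = Qo_C[OF O(1)] Qo_C[OF O(2)]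
    obtain f where f: "f \<in> Hom A (Qo Z) (Qo Y)"
      "L.cls (Z, es, Y) \<cdot>\<^bsub>LA\<^esub> \<gamma> (rep Z) = \<gamma> (rep Y) \<cdot>\<^bsub>LA\<^esub> \<gamma> f" using Cons.IH[OF es] by blast
    note r = rep_Hom[OF O(1)] rep_Hom[OF O(2)] rep_Hom[OF O(3)] and Q = Qa_Hom[OF w(1)]
      and c = L.cls_Hom[OF Cons.prems, unfolded Bwd]
    \<comment> \<open>\<open>Qa w\<close> has an inverse in \<open>C/TC\<close>, though not
      necessarily in \<open>A\<close>. A representative \<open>h\<close> of it satisfies
      \<open>Qa w \<cdot> h = Id\<close> modulo \<open>TC\<close>, and \<open>\<gamma>_eqI\<close>
      turns this into an equation in the localization.\<close>
    have "isomorphism B (cl (Qa w))" using L.inverts[OF Hom_Arr[OF w(1)] w(2)] .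
    then obtain K where K: "K \<in> Hom B (Qo X) (Qo Z)" "cl (Qa w) \<cdot>\<^bsub>B\<^esub> K = Idn B (Qo X)"
      using cl_Hom[OF QC(2,1) Q] by (rule B.isomorphismE)
    obtain h where h: "h \<in> Hom A (Qo X) (Qo Z)" "K = cl h" using K(1) by (rule cl_HomE)
    have "cl (Qa w \<cdot> h) = cl (Idn A (Qo X))"
      using K(2) h(2) cl_Comp[OF QC QC(1) h(1) Q] by (simp add: cl_Idn)
    then have Qh: "\<gamma> (Qa w \<cdot> h) = Idn LA (Qo X)"
      using \<gamma>_eqI[OF QC(1,1) Comp_Hom[OF h(1) Q] Idn_Hom] \<gamma>_Idn C_Ob[OF QC(1)] by simp
    \<comment> \<open>After localizing, \<open>rep Z \<cdot> h\<close> lifts \<open>rep X\<close>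
      along \<open>w\<close>, so the backward edge cancels against \<open>w\<close>.\<close>
    have "\<gamma> (w \<cdot> (rep Z \<cdot> h)) = \<gamma> (rep X \<cdot> (Qa w \<cdot> h))"
      using Comp_assoc[OF h(1) r(2) w(1)] rep_Qa[OF w(1)] Comp_assoc[OF h(1) Q r(1)] by simp
    also have "\<dots> = \<gamma> (rep X)"
      using \<gamma>_Comp[OF Comp_Hom[OF h(1) Q] r(1)] Qh LA.Comp_Idn_right[OF \<gamma>_Hom[OF r(1)]] by simp
    finally have wh: "\<gamma> (rep X) = \<gamma> w \<cdot>\<^bsub>LA\<^esub> (\<gamma> (rep Z) \<cdot>\<^bsub>LA\<^esub> \<gamma> h)"
      using \<gamma>_Comp[OF Comp_Hom[OF h(1) r(2)] w(1)] \<gamma>_Comp[OF h(1) r(2)] by simp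
    note rh = LA.Comp_Hom[OF \<gamma>_Hom[OF h(1)] \<gamma>_Hom[OF r(2)]]
    have "L.cls (X, Bwd w # es, Y) \<cdot>\<^bsub>LA\<^esub> \<gamma> (rep X) =
        L.cls (Z, es, Y) \<cdot>\<^bsub>LA\<^esub> (\<gamma> (rep Z) \<cdot>\<^bsub>LA\<^esub> \<gamma> h)"
      using wh LA.Comp_assoc[OF rh \<gamma>_Hom[OF w(1)] c] L.localization_edge(2)[OF w es] by simp
    also have "\<dots> = \<gamma> (rep Y) \<cdot>\<^bsub>LA\<^esub> \<gamma> (f \<cdot> h)"
      using LA.Comp_assoc[OF \<gamma>_Hom[OF h(1)] \<gamma>_Hom[OF r(2)] L.cls_Hom[OF es]] f(2)
        LA.Comp_assoc[OF \<gamma>_Hom[OF h(1)] \<gamma>_Hom[OF f(1)] \<gamma>_Hom[OF r(3)]] \<gamma>_Comp[OF h(1) f(1)] by simp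
    finally show ?thesis using Comp_Hom[OF h(1) f(1)] Bwd by blast
  qed
qed

text \<open>Apply the extended functor to \<open>eq\<close>. It sends
  \<open>\<gamma> (rep X)\<close> to the class of \<open>rep (Qo X)\<close>, which lifts the same
  map as \<open>Qa (rep X)\<close>; this class is invertible and cancels.\<close>

lemma extension_eq_class:
  assumes K: "K \<in> Hom LA X Y" and f: "f \<in> Hom A (Qo X) (Qo Y)"
    and eq: "K \<cdot>\<^bsub>LA\<^esub> \<gamma> (rep X) = \<gamma> (rep Y) \<cdot>\<^bsub>LA\<^esub> \<gamma> f"
  shows "L.extension K = cl f"
proof -
  have O: "X \<in> Ob A" "Y \<in> Ob A" using LA.Hom_Ob[OF K] by (simp_all add: L.LA_Ob)
  note QC = Qo_C[OF O(1)] Qo_C[OF O(2)] and r = rep_Hom[OF O(1)] rep_Hom[OF O(2)]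
  note QO = C_Ob[OF QC(1)]
  note q = rep_Hom[OF QO] and QQ = Qo_C[OF QO]
  have rr: "L.extension (\<gamma> (rep X)) = cl (rep (Qo X))"
    using L.extension_localization_map[OF r(1)] Qa_class[OF r(1) q] by simp
  have fq: "f \<cdot> rep (Qo X) \<in> Hom A (Qo (Qo X)) (Qo Y)" using Comp_Hom[OF q f] .
  have "L.extension (\<gamma> (rep Y \<cdot> f)) = cl (f \<cdot> rep (Qo X))"
    using L.extension_localization_map[OF Comp_Hom[OF f r(2)]] Qa_class[OF Comp_Hom[OF f r(2)] fq]
      Comp_assoc[OF q f r(2)] by simp
  then have "L.extension K \<cdot>\<^bsub>B\<^esub> cl (rep (Qo X)) = cl f \<cdot>\<^bsub>B\<^esub> cl (rep (Qo X))"
    using ext_Comp[OF \<gamma>_Hom[OF r(1)] K] rr eq \<gamma>_Comp[OF f r(2)] cl_Comp[OF QQ QC q f] by simp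
  then show ?thesis
    using B.isomorphism_cancel_right[OF cl_Hom[OF QQ QC(1) q] TFib_iso[OF QQ QC(1) q rep_TFib[OF QO]]
        ext_Hom[OF K] cl_Hom[OF QC f]] by simp
qed

text \<open>Normal forms decide both halves. Equal images give \<open>cl f = cl f'\<close>, hence
  \<open>\<gamma> f = \<gamma> f'\<close> and equal arrows. Conversely, \<open>cl f\<close> is the
  image of \<open>\<gamma> (rep Y) \<cdot> \<gamma> f\<close> composed with the inverse of
  \<open>\<gamma> (rep X)\<close>.\<close>

lemma extension_bij:
  assumes O: "X \<in> Ob A" "Y \<in> Ob A"
  shows "bij_betw L.extension (Hom LA X Y) (Hom B (Qo X) (Qo Y))"
proof -
  note QC = Qo_C[OF O(1)] Qo_C[OF O(2)] and r = rep_Hom[OF O(1)] rep_Hom[OF O(2)]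
  note q = \<gamma>_Hom[OF r(1)] \<gamma>_rep_iso[OF O(1)]
  have norm: "\<exists>f \<in> Hom A (Qo X) (Qo Y). K \<cdot>\<^bsub>LA\<^esub> \<gamma> (rep X) = \<gamma> (rep Y) \<cdot>\<^bsub>LA\<^esub> \<gamma> f"
    if "K \<in> Hom LA X Y" for K
    by (rule L.LA_HomE[OF that]) (simp add: path_replacement)
  have inj: "K = K'" if K: "K \<in> Hom LA X Y" "K' \<in> Hom LA X Y" "L.extension K = L.extension K'" for K K'
  proof -
    obtain f where f: "f \<in> Hom A (Qo X) (Qo Y)" "K \<cdot>\<^bsub>LA\<^esub> \<gamma> (rep X) = \<gamma> (rep Y) \<cdot>\<^bsub>LA\<^esub> \<gamma> f"
      using norm[OF K(1)] by blast
    obtain f' where f': "f' \<in> Hom A (Qo X) (Qo Y)" "K' \<cdot>\<^bsub>LA\<^esub> \<gamma> (rep X) = \<gamma> (rep Y) \<cdot>\<^bsub>LA\<^esub> \<gamma> f'"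
      using norm[OF K(2)] by blast
    have "cl f = cl f'" using extension_eq_class[OF K(1) f] extension_eq_class[OF K(2) f'] K(3) by simp
    then have "\<gamma> f = \<gamma> f'" using \<gamma>_eqI[OF QC f(1) f'(1)] by simp
    then show "K = K'" using LA.isomorphism_cancel_right[OF q K(1,2)] f(2) f'(2) by simp
  qed
  have surj: "\<exists>K \<in> Hom LA X Y. L.extension K = k" if k': "k \<in> Hom B (Qo X) (Qo Y)" for k
  proof -
    obtain f where f: "f \<in> Hom A (Qo X) (Qo Y)" and k: "k = cl f" using k' by (rule cl_HomE)
    obtain q' where q': "q' \<in> Hom LA X (Qo X)" "q' \<cdot>\<^bsub>LA\<^esub> \<gamma> (rep X) = Idn LA (Qo X)"
      using q(2,1) by (rule LA.isomorphismE)
    note rf = LA.Comp_Hom[OF \<gamma>_Hom[OF f] \<gamma>_Hom[OF r(2)]]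
    note K = LA.Comp_Hom[OF q'(1) rf]
    have "((\<gamma> (rep Y) \<cdot>\<^bsub>LA\<^esub> \<gamma> f) \<cdot>\<^bsub>LA\<^esub> q') \<cdot>\<^bsub>LA\<^esub> \<gamma> (rep X) = \<gamma> (rep Y) \<cdot>\<^bsub>LA\<^esub> \<gamma> f"
      using LA.Comp_assoc[OF q(1) q'(1) rf] q'(2) LA.Comp_Idn_right[OF rf] by simp
    then show ?thesis using extension_eq_class[OF K f] K k by blast
  qed
  show ?thesis
  proof (rule bij_betw_imageI)
    show "inj_on L.extension (Hom LA X Y)" by (rule inj_onI) (rule inj)
    show "L.extension ` Hom LA X Y = Hom B (Qo X) (Qo Y)"
    proof (intro equalityI subsetI)
      fix k assume "k \<in> L.extension ` Hom LA X Y"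
      then show "k \<in> Hom B (Qo X) (Qo Y)" using ext_Hom by blast
    next
      fix k assume "k \<in> Hom B (Qo X) (Qo Y)"
      from surj[OF this] show "k \<in> L.extension ` Hom LA X Y" by blast
    qed
  qed
qed

sublocale E: equivalence_to_additive LA B Qo L.extension
proof (intro equivalence_to_additive.intro equivalence_to_additive_axioms.intro)
  show "category LA" by (rule LA.category_axioms)
  show "additive_category B" by (rule B.additive_category_axioms)
  show "is_functor LA B Qo L.extension" by (rule L.functor_extension)
  show "X \<in> Ob LA \<Longrightarrow> Y \<in> Ob LA \<Longrightarrow> bij_betw L.extension (Hom LA X Y) (Hom B (Qo X) (Qo Y))" for X Y
    using extension_bij by (simp add: L.LA_Ob)
  fix P assume "P \<in> Ob B"
  then have P: "P \<in> C" "P \<in> Ob A" using C_Ob by (auto simp: B_Ob)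
  \<comment> \<open>For cofibrant \<open>P\<close> the replacement map \<open>rep P\<close> itself
    becomes the required isomorphism.\<close>
  then show "\<exists>X \<in> Ob LA. \<exists>e \<in> Hom B (Qo X) P. isomorphism B e"
    using cl_Hom[OF Qo_C[OF P(2)] P(1) rep_Hom[OF P(2)]]
      TFib_iso[OF Qo_C[OF P(2)] P(1) rep_Hom[OF P(2)] rep_TFib[OF P(2)]] L.LA_Ob by blast
qed

text \<open>The sum of the lifts \<open>Qa f\<close> and \<open>Qa g\<close> lifts
  \<open>f \<boxplus> g\<close>. The identity is tested in \<open>C/TC\<close>, from where the sum
  was transported.\<close>

lemma \<gamma>_Add:
  assumes "f \<in> Hom A X Y" "g \<in> Hom A X Y"
  shows "\<gamma> (f \<boxplus> g) = \<gamma> f \<boxplus>\<^bsub>E.T\<^esub> \<gamma> g"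
proof (rule E.F_inj[OF \<gamma>_Hom[OF Add_closed[OF assms]] E.T_Add_Hom[OF \<gamma>_Hom[OF assms(1)] \<gamma>_Hom[OF assms(2)]]])
  have O: "X \<in> Ob A" "Y \<in> Ob A" using Hom_Ob[OF assms(1)] by auto
  note Q = Qa_Hom[OF assms(1)] Qa_Hom[OF assms(2)] and r = rep_Hom[OF O(1)] rep_Hom[OF O(2)]
  have "rep Y \<cdot> (Qa f \<boxplus> Qa g) = (f \<boxplus> g) \<cdot> rep X"
    using Comp_Add_right[OF Q r(2)] rep_Qa[OF assms(1)] rep_Qa[OF assms(2)] Comp_Add_left[OF r(1) assms]
    by simp
  then have "cl (Qa (f \<boxplus> g)) = cl (Qa f) \<boxplus>\<^bsub>B\<^esub> cl (Qa g)"
    using Qa_class[OF Add_closed[OF assms] Add_closed[OF Q]] cl_Add[OF Qo_C[OF O(1)] Qo_C[OF O(2)] Q]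
    by simp
  then show "L.extension (\<gamma> (f \<boxplus> g)) = L.extension (\<gamma> f \<boxplus>\<^bsub>E.T\<^esub> \<gamma> g)"
    using E.F_Add[OF \<gamma>_Hom[OF assms(1)] \<gamma>_Hom[OF assms(2)]]
      L.extension_localization_map[OF Add_closed[OF assms]]
      L.extension_localization_map[OF assms(1)] L.extension_localization_map[OF assms(2)] by simp
qed

lemma additive_localization_T: "additive_localization A Weq E.T"
proof -
  have "is_functor A E.T (\<lambda>X. X) \<gamma>"
    using L.functor_localization unfolding is_functor_def E.T_simps by simp
  moreover have "\<gamma> (f \<boxplus> g) = \<gamma> f \<boxplus>\<^bsub>E.T\<^esub> \<gamma> g"
    if "f \<in> Arr A" "g \<in> Arr A" "Dom A f = Dom A g \<and> Cod A f = Cod A g" for f g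
    using \<gamma>_Add[OF Arr_Hom[OF that(1)]] Arr_Hom[OF that(2)] that(3) by simp
  ultimately show ?thesis
    unfolding additive_localization_def additive_functor_def
    by (intro conjI E.truncate_T E.additive_category_T) simp_all
qed

end

theorem theorem1p2:
  fixes A :: "('o, 'm) acat" and CoFib Fib Weq :: "'m set"
  defines "TCoFib \<equiv> CoFib \<inter> Weq"
    and "C \<equiv> cofibrant_objects A CoFib"
    and "TC \<equiv> cofibrant_objects A CoFib \<inter> trivial_objects A Weq"
  assumes "weakly_idempotent_complete A"
    and "model_structure A CoFib Fib Weq"
  shows "(fibrant_objects A Fib = Ob A \<longleftrightarrow>
           TCoFib = {f. split_mono A f \<and> (\<exists>c. is_cokernel A f c \<and> Cod A c \<in> TC)})
       \<and> (fibrant_objects A Fib = Ob A \<longleftrightarrow> Fib = {f \<in> Arr A. hom_epic A TC f})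
       \<and> (fibrant_objects A Fib = Ob A \<longrightarrow>
           (\<exists>H. additive_localization A Weq H \<and>
                equivalent_as_additive_categories H
                  (additive_quotient (full_subcategory A C) TC)))"
proof -
  interpret M: additive_model_structure A CoFib Fib Weq
    using assms(4,5) by (rule additive_model_structure.intro)
  have eqs: "M.C = C" "M.TC = TC" by (simp_all add: M.C_def M.TC_def C_def TC_def)
  note imps = M.fibrant_imp_TCoFib_eq M.TCoFib_eq_imp_Fib_eq M.Fib_eq_imp_fibrant
  note imps' = imps[unfolded eqs, folded TCoFib_def]
  have "\<exists>H. additive_localization A Weq H \<and>
      equivalent_as_additive_categories H (additive_quotient (full_subcategory A C) TC)"
    if "fibrant_objects A Fib = Ob A"
  proof -
    interpret F: fibrant_model_structure A CoFib Fib Weq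
      using that by unfold_locales
    show ?thesis
      using F.additive_localization_T F.E.equivalent_T unfolding eqs by (intro exI conjI)
  qed
  then show ?thesis using imps' by iprover
qed

end
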